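(* Let $\mathcal A^\bullet$ be a $G_\infty$ algebra with structure derivation $\partial$ of $\Lambda^\bullet(\mathrm{Lie}(\mathcal A^\bullet[1]^* ))$. Then the canonical deformation $\mathcal A^\bullet[\epsilon]$ of $\mathcal A^\bullet$ has a canonical $BV_\infty$ structure, given by $$\Delta_{\mathrm{can}}=\partial_{\mathrm{can}}+\Delta_{\mathrm{Lie}}+\frac{\partial}{\partial\epsilon},$$ where $\partial_{\mathrm{can}}=\partial+\epsilon[\partial,\Delta_{\mathrm{Lie}}]$ is the derivation defining the $G_\infty$ structure of the canonical deformation.
   Context: **Notation.** For a graded space $V$ let $V[m]^i=V^{i+m}$, $(V^* )^i=(V^{-i})^*$; commutators of operators are graded. Spaces are treated as finite dimensional; otherwise all maps are replaced by their transposes. For a graded Lie algebra $\mathfrak g$, $\Lambda^k\mathfrak g=S^k(\mathfrak g[-1])$; $\Lambda^\bullet\mathfrak g$ is a Gerstenhaber algebra (graded commutative product of degree $0$, bracket of degree $-1$ which is a graded Lie bracket after shift and satisfies $[a,bc]=[a,b]c+(-1)^{(|a|-1)|b|}b[a,c]$) with the exterior product and the unique bracket extending that of $\mathfrak g$ and killing $\Lambda^0$. $\Delta_{\mathrm{Lie}}$ is the Batalin–Vilkovisky operator on $\Lambda^\bullet\mathfrak g$ (degree $-1$, square zero, $\Delta(ab)=\Delta(a)b+(-1)^{|a|}a\Delta(b)+(-1)^{|a|}[a,b]$) satisfying $\Delta_{\mathrm{Lie}}(v\wedge w)=[v,w]$ for $v,w\in\mathfrak g$ (up to the conventional signs), i.e.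 the Lie algebra chain differential $\Lambda^\bullet\mathfrak g\to\Lambda^{\bullet-1}\mathfrak g$. $\mathrm{Lie}(V)=\bigoplus_{k\ge1}\mathrm{Lie}^k(V)$ is the free graded Lie algebra on $V$, with $\mathrm{Lie}^1(V)=V$, $\mathrm{Lie}^k(V)=[V,\mathrm{Lie}^{k-1}(V)]$. $\Lambda^\bullet(\mathrm{Lie}(V))$ is the completion of $\bigoplus_k\Lambda^k(\mathrm{Lie}(V))$ with respect to the filtration $\mathcal F^\bullet$ induced by $\mathcal F^k=\mathrm{Lie}^{\ge k}(V)$. All operators are continuous. **$G_\infty$ algebra.** A graded space $\mathcal A^\bullet$ with an operator $\partial$ of degree $1$ on $\Lambda^\bullet(\mathrm{Lie}(\mathcal A^\bullet[1]^* ))$ such that $\partial^2=0$ and $\partial$ is a derivation of both product and bracket. **$BV_\infty$ structure** on a $G_\infty$ algebra $(\mathcal A^\bullet,\partial)$: an operator $\Delta$ on $\Lambda^\bullet(\mathrm{Lie}(\mathcal A^\bullet[1]^* ))$ such that (1) $\Delta^2=0$ and $\Delta=\partial+\Delta_1+\Delta_3+\dots$ with $\Delta_i$ of degree $-i$ and $\Delta_i(1)=0$; (2) $\Delta_1-\Delta_{\mathrm{Lie}}$ is a differential operator (in Grothendieck's sense) of order $1$; (3) $\Delta_{2i-1}$ is a differential operator of order $i$ for $i>1$; (4) all $\Delta_k$ preserve $\mathcal F^\bullet$. **Canonical deformation.** $\epsilon$ is a formal parameter of degree $1$, $\epsilon^2=0$, $\mathcal A^\bullet[\epsilon]^n=\mathcal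 A^n+\epsilon\mathcal A^{n-1}$. Put $W=\mathcal A^\bullet[1]^*$, $L=\Lambda^\bullet(\mathrm{Lie}(W))$, $D=[\partial,\Delta_{\mathrm{Lie}}]$ (a derivation of product and bracket of degree $0$) and $\partial_{\mathrm{can}}=\partial+\epsilon D$, acting on $L[\epsilon]$ with its $\epsilon$-linearly extended product and bracket (operators extend to $L[\epsilon]$ so as to graded-commute with $\epsilon$). The corresponding $G_\infty$ structure on $\mathcal A^\bullet[\epsilon]$ is given by the $k[\epsilon]$-multilinear operations which $\partial_{\mathrm{can}}$ defines. Explicitly, write $(\mathcal A^\bullet[\epsilon])[1]^*=W_0\oplus W_1$ with copies $w\mapsto w_0$ ($|w_0|=|w|$) and $w\mapsto w_1$ ($|w_1|=|w|-1$) of $W$, and $L'=\Lambda^\bullet(\mathrm{Lie}((\mathcal A^\bullet[\epsilon])[1]^* ))$. Let $\Phi:L[\epsilon]\to L'[\epsilon]$ be the $\epsilon$-linear morphism of Gerstenhaber algebras with $\Phi(w)=w_0+\epsilon w_1$. Then $\partial_{\mathrm{can}}$ on $L'$ is the derivation of product and bracket whose $\epsilon$-linear extension satisfies $\partial_{\mathrm{can}}\Phi=\Phi\,(\partial+\epsilon D)$; $\Delta_{\mathrm{Lie}}$ on $L'$ is the Batalin–Vilkovisky operator of the Gerstenhaber algebra $\Lambda^\bullet\mathfrak g$ for $\mathfrak g=\mathrm{Lie}((\mathcal A^\bullet[\epsilon])[1]^* )$, the free graded Lie algebra on $(\mathcal A^\bullet[\epsilon])[1]^*$, satisfying $\Delta_{\mathrm{Lie}}(v\wedge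 w)=[v,w]$ for $v,w\in\mathfrak g$ (up to the conventional signs), i.e. the Lie algebra chain differential of $\mathfrak g$, extended by continuity to the completion $L'$; and $\partial/\partial\epsilon$ on $L'$ is the derivation of product and bracket of degree $-1$ dual to the operator $\partial/\partial\epsilon$ on $\mathcal A^\bullet[\epsilon]$, i.e. $w_0\mapsto w_1$, $w_1\mapsto 0$. *)

theory Defs
  imports Complex_Main "HOL-Library.Function_Algebras" "HOL-Library.Product_Plus"
begin

section \<open>Finite-dimensional graded spaces\<close>

text \<open>
  A finite-dimensional graded space $A$ over a field \<open>'k\<close> is given by a homogeneous basis
  $(a_i)$, $i \in$ \<open>gbasis\<close>, with $|a_i|$ = \<open>adeg i\<close>; the index type stands for $A$.
  The set \<open>gbasis\<close> may be empty ($A = 0$) and the index type may be infinite.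
\<close>

class graded_basis =
  fixes gbasis :: "'a set"
    and adeg :: "'a \<Rightarrow> int"
  assumes finite_gbasis: "finite gbasis"

text \<open>
  Basis of $A[\epsilon]$, where $A[\epsilon]^n = A^n + \epsilon A^{n-1}$: \<open>E0 i\<close> stands for
  $a_i$ and \<open>E1 i\<close> for $\epsilon a_i$.
\<close>

datatype 'i eps = E0 'i | E1 'i

instantiation eps :: (graded_basis) graded_basis
begin

definition gbasis_eps :: "'a eps set" where
  "gbasis_eps = E0 ` gbasis \<union> E1 ` gbasis"

fun adeg_eps :: "'a eps \<Rightarrow> int" where
  "adeg_eps (E0 i) = adeg i"
| "adeg_eps (E1 i) = adeg i + 1"

instance
  by standard (simp add: gbasis_eps_def finite_gbasis)

end

text \<open>
  Since $V[m]^i = V^{i+m}$ and $(V^*)^i = (V^{-i})^*$, the basis of $W = A[1]^*$ dual to $(a_i)$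
  has degrees $1 - |a_i|$. For $A[\epsilon]$ this gives $|w_0| = |w|$ and $|w_1| = |w| - 1$.
\<close>

definition wdeg :: "'i::graded_basis \<Rightarrow> int" where
  "wdeg i = 1 - adeg i"

text \<open>$(-1)^n x$\<close>

definition sg :: "int \<Rightarrow> 'a::uminus \<Rightarrow> 'a" where
  "sg n x = (if even n then x else - x)"


section \<open>The completed exterior algebra of the free graded Lie algebra on W\<close>

datatype 'i ltree = Leaf 'i | Br "'i ltree" "'i ltree"

fun tdeg :: "'i::graded_basis ltree \<Rightarrow> int" where
  "tdeg (Leaf i) = wdeg i"
| "tdeg (Br s t) = tdeg s + tdeg t"

fun twt :: "'i ltree \<Rightarrow> nat" where
  "twt (Leaf i) = 1"
| "twt (Br s t) = twt s + twt t"

definition unitv :: "'a \<Rightarrow> 'a \<Rightarrow> 'k::field" where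
  "unitv m = (\<lambda>x. if x = m then 1 else 0)"

text \<open>Product of the free non-associative algebra on the leaves.\<close>

fun tmul :: "('i ltree \<Rightarrow> 'k::field) \<Rightarrow> ('i ltree \<Rightarrow> 'k) \<Rightarrow> 'i ltree \<Rightarrow> 'k" where
  "tmul f g (Leaf i) = 0"
| "tmul f g (Br s t) = f s * g t"

text \<open>
  The two-sided ideal of the free non-associative algebra generated by graded antisymmetry and the
  graded Jacobi identity. The quotient by it is the free graded Lie algebra $\mathrm{Lie}(W)$, and
  $\mathrm{Lie}^k(W)$ is the image of the span of the trees with $k$ leaves. The
  identities $[x, x] = 0$ for even and $[x, [x, x]] = 0$ for odd $x$, which do not follow in
  characteristic 2 and 3, are not imposed separately.
\<close>

inductive_set lie_ideal :: "('i::graded_basis ltree \<Rightarrow> 'k::field) set" where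
  zero: "0 \<in> lie_ideal"
| add: "f \<in> lie_ideal \<Longrightarrow> g \<in> lie_ideal \<Longrightarrow> f + g \<in> lie_ideal"
| scale: "f \<in> lie_ideal \<Longrightarrow> (\<lambda>t. c * f t) \<in> lie_ideal"
| antisym: "unitv (Br s t) + sg (tdeg s * tdeg t) (unitv (Br t s)) \<in> lie_ideal"
| jacobi: "unitv (Br s (Br t u)) - unitv (Br (Br s t) u)
             - sg (tdeg s * tdeg t) (unitv (Br t (Br s u))) \<in> lie_ideal"
| left: "f \<in> lie_ideal \<Longrightarrow> tmul (unitv t) f \<in> lie_ideal"
| right: "f \<in> lie_ideal \<Longrightarrow> tmul f (unitv t) \<in> lie_ideal"

text \<open>
  A list \<open>[t\<^sub>1, \<dots>, t\<^sub>n]\<close> of trees stands for the product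
  $t_1 \cdots t_n \in \Lambda^n(\mathrm{Lie}(W)) = S^n(\mathrm{Lie}(W)[-1])$; the shift raises the
  degree of each factor by one.
\<close>

definition mdeg :: "'i::graded_basis ltree list \<Rightarrow> int" where
  "mdeg xs = (\<Sum>t\<leftarrow>xs. tdeg t + 1)"

definition mwt :: "'i ltree list \<Rightarrow> nat" where
  "mwt xs = (\<Sum>t\<leftarrow>xs. twt t)"

definition conv :: "('b list \<Rightarrow> 'k::field) \<Rightarrow> ('b list \<Rightarrow> 'k) \<Rightarrow> 'b list \<Rightarrow> 'k" where
  "conv f g xs = (\<Sum>j\<le>length xs. f (take j xs) * g (drop j xs))"

definition letters :: "('b \<Rightarrow> 'k::field) \<Rightarrow> 'b list \<Rightarrow> 'k" where
  "letters f xs = (case xs of [t] \<Rightarrow> f t | _ \<Rightarrow> 0)"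

text \<open>
  The two-sided ideal of the free associative algebra on the trees whose quotient is the graded
  symmetric algebra of $\mathrm{Lie}(W)[-1]$.
\<close>

inductive_set ext_ideal :: "('i::graded_basis ltree list \<Rightarrow> 'k::field) set" where
  zero: "0 \<in> ext_ideal"
| add: "f \<in> ext_ideal \<Longrightarrow> g \<in> ext_ideal \<Longrightarrow> f + g \<in> ext_ideal"
| scale: "f \<in> ext_ideal \<Longrightarrow> (\<lambda>xs. c * f xs) \<in> ext_ideal"
| lie: "f \<in> lie_ideal \<Longrightarrow> letters f \<in> ext_ideal"
| comm: "unitv [s, t] - sg ((tdeg s + 1) * (tdeg t + 1)) (unitv [t, s]) \<in> ext_ideal"
| left: "f \<in> ext_ideal \<Longrightarrow> conv (unitv xs) f \<in> ext_ideal"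
| right: "f \<in> ext_ideal \<Longrightarrow> conv f (unitv xs) \<in> ext_ideal"

definition admissible :: "'i::graded_basis ltree list \<Rightarrow> bool" where
  "admissible xs \<longleftrightarrow> (\<forall>t\<in>set xs. set_ltree t \<subseteq> gbasis)"

text \<open>
  The part of weight \<open>w\<close>; it also discards the lists with leaves outside \<open>gbasis\<close>.
\<close>

definition wpart :: "nat \<Rightarrow> ('i::graded_basis ltree list \<Rightarrow> 'k::field) \<Rightarrow> 'i ltree list \<Rightarrow> 'k" where
  "wpart w f xs = (if mwt xs = w \<and> admissible xs then f xs else 0)"

definition eqv ::
  "('i::graded_basis ltree list \<Rightarrow> 'k::field) \<Rightarrow> ('i ltree list \<Rightarrow> 'k) \<Rightarrow> bool" where
  "eqv f g \<longleftrightarrow> (\<forall>w. wpart w (f - g) \<in> ext_ideal)"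

lemma wpart_linear:
  "wpart w 0 = 0" "wpart w (f + g) = wpart w f + wpart w g"
  "wpart w (f - g) = wpart w f - wpart w g"
  "wpart w (\<lambda>xs. c * f xs) = (\<lambda>xs. c * wpart w f xs)" "wpart w (- f) = - wpart w f"
  by (auto simp: wpart_def fun_eq_iff)

lemma ext_ideal_uminus: "f \<in> ext_ideal \<Longrightarrow> - f \<in> ext_ideal"
  using ext_ideal.scale[of f "-1"] by (simp add: fun_Compl_def)

lemma ext_ideal_minus: "f \<in> ext_ideal \<Longrightarrow> g \<in> ext_ideal \<Longrightarrow> f - g \<in> ext_ideal"
  using ext_ideal.add[OF _ ext_ideal_uminus[of g], of f] by simp

lemma ext_ideal_sum: "(\<And>x. x \<in> A \<Longrightarrow> f x \<in> ext_ideal) \<Longrightarrow> sum f A \<in> ext_ideal"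
  by (induction A rule: infinite_finite_induct) (auto intro: ext_ideal.intros)

lemma equivp_eqv: "equivp eqv"
proof (rule equivpI)
  show "reflp eqv"
    by (auto simp: reflp_def eqv_def wpart_linear intro: ext_ideal.zero)
  show "symp eqv"
    unfolding symp_def eqv_def by (metis ext_ideal_uminus minus_diff_eq wpart_linear(5))
  show "transp eqv"
    unfolding transp_def eqv_def
    by (metis (no_types, lifting) ext_ideal.add diff_add_cancel add_diff_eq wpart_linear(2))
qed

text \<open>
  All generators of \<open>ext_ideal\<close> are homogeneous for the weight (the total number of leaves),
  the step $\mathcal F^p$ of the filtration of $\bigoplus_k \Lambda^k(\mathrm{Lie}(W))$ induced by
  $\mathcal F^k = \mathrm{Lie}^{\ge k}(W)$ is spanned by the products of weight at least $p$, and
  there are only finitely many admissible lists of a given weight. So the completion is the product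
  over all $w$ of the parts of weight $w$, that is, the space of \<^emph>\<open>all\<close>
  functions on lists of trees modulo those functions all of whose parts of fixed weight are in the
  ideal.
\<close>

quotient_type (overloaded) ('i, 'k) ext_lie = "'i::graded_basis ltree list \<Rightarrow> 'k::field" / eqv
  by (rule equivp_eqv)

lemma conv_linear:
  "conv 0 h = 0" "conv (f + g) h = conv f h + conv g h" "conv (f - g) h = conv f h - conv g h"
  "conv h 0 = 0" "conv h (f + g) = conv h f + conv h g" "conv h (f - g) = conv h f - conv h g"
  "conv h (\<lambda>xs. c * f xs) = (\<lambda>xs. c * conv h f xs)"
  "conv (\<lambda>xs. c * f xs) h = (\<lambda>xs. c * conv f h xs)"
  by (auto simp: conv_def fun_eq_iff algebra_simps sum.distrib sum_subtractf sum_distrib_left)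

lemma conv_sum: "conv (sum f A) h = (\<Sum>a\<in>A. conv (f a) h)" "conv h (sum f A) = (\<Sum>a\<in>A. conv h (f a))"
  by (induction A rule: infinite_finite_induct) (simp_all add: conv_linear)

lemma sum_apply: "sum f A x = (\<Sum>a\<in>A. f a x)"
  by (induction A rule: infinite_finite_induct) simp_all

lemma twt_pos: "0 < twt t"
  by (induction t) auto

lemma finite_trees: "finite {t::'i::graded_basis ltree. set_ltree t \<subseteq> gbasis \<and> twt t \<le> n}"
proof (induction n)
  case 0
  have "{t::'i ltree. set_ltree t \<subseteq> gbasis \<and> twt t \<le> 0} = {}"
    using twt_pos by (auto simp: not_le)
  then show ?case by (metis finite.emptyI)
next
  case (Suc n)
  let ?T = "{t::'i ltree. set_ltree t \<subseteq> gbasis \<and> twt t \<le> n}"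
  have "{t::'i ltree. set_ltree t \<subseteq> gbasis \<and> twt t \<le> Suc n}
          \<subseteq> Leaf ` gbasis \<union> (\<lambda>(s, t). Br s t) ` (?T \<times> ?T)"
  proof
    fix t :: "'i ltree"
    assume t: "t \<in> {t. set_ltree t \<subseteq> gbasis \<and> twt t \<le> Suc n}"
    show "t \<in> Leaf ` gbasis \<union> (\<lambda>(s, t). Br s t) ` (?T \<times> ?T)"
    proof (cases t)
      case (Br s u)
      then have "s \<in> ?T" "u \<in> ?T"
        using t twt_pos[of s] twt_pos[of u] by auto
      then show ?thesis using Br by force
    qed (use t in auto)
  qed
  then show ?case
    by (rule finite_subset) (use Suc finite_gbasis in auto)
qed

lemma twt_le_mwt: "t \<in> set xs \<Longrightarrow> twt t \<le> mwt xs"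
  unfolding mwt_def by (induction xs) auto

lemma length_le_mwt: "length xs \<le> mwt xs"
proof (induction xs)
  case (Cons t xs)
  then show ?case using twt_pos[of t] by (simp add: mwt_def)
qed (simp add: mwt_def)

lemma finite_admissible: "finite {xs::'i::graded_basis ltree list. mwt xs = w \<and> admissible xs}"
proof (rule finite_subset)
  show "{xs::'i ltree list. mwt xs = w \<and> admissible xs}
          \<subseteq> {xs. set xs \<subseteq> {t. set_ltree t \<subseteq> gbasis \<and> twt t \<le> w} \<and> length xs \<le> w}"
    using length_le_mwt twt_le_mwt by (auto simp: admissible_def)
qed (rule finite_lists_length_le[OF finite_trees])

lemma wpart_expand:
  "wpart w f = (\<Sum>xs | mwt xs = w \<and> admissible xs. (\<lambda>ys. f xs * unitv xs ys))"
proof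
  fix ys
  have "(\<Sum>xs | mwt xs = w \<and> admissible xs. f xs * unitv xs ys)
          = (\<Sum>xs | mwt xs = w \<and> admissible xs. if ys = xs then f xs else 0)"
    by (intro sum.cong) (auto simp: unitv_def)
  then show "wpart w f ys = (\<Sum>xs | mwt xs = w \<and> admissible xs. (\<lambda>ys. f xs * unitv xs ys)) ys"
    using finite_admissible[where 'i = 'a, of w] by (simp add: wpart_def sum_apply)
qed

lemma conv_wpart_left: "f \<in> ext_ideal \<Longrightarrow> conv (wpart w h) f \<in> ext_ideal"
  unfolding wpart_expand conv_sum conv_linear
  by (intro ext_ideal_sum ext_ideal.scale ext_ideal.left)

lemma conv_wpart_right: "f \<in> ext_ideal \<Longrightarrow> conv f (wpart w h) \<in> ext_ideal"
  unfolding wpart_expand conv_sum conv_linear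
  by (intro ext_ideal_sum ext_ideal.scale ext_ideal.right)

lemma wpart_conv: "wpart w (conv f g) = (\<Sum>u\<le>w. conv (wpart u f) (wpart (w - u) g))"
proof
  fix xs :: "'a ltree list"
  have mwt: "mwt xs = mwt (take j xs) + mwt (drop j xs)" for j
    unfolding mwt_def by (metis append_take_drop_id map_append sum_list_append)
  have adm: "admissible xs \<longleftrightarrow> admissible (take j xs) \<and> admissible (drop j xs)" for j
    unfolding admissible_def by (metis append_take_drop_id Un_iff set_append)
  have eq: "(\<Sum>u\<le>w. wpart u f (take j xs) * wpart (w - u) g (drop j xs))
         = (if mwt xs = w \<and> admissible xs then f (take j xs) * g (drop j xs) else 0)" for j
  proof -
    have "(\<Sum>u\<le>w. wpart u f (take j xs) * wpart (w - u) g (drop j xs))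
        = (\<Sum>u\<le>w. if u = mwt (take j xs)
             then wpart u f (take j xs) * wpart (w - u) g (drop j xs) else 0)"
      by (intro sum.cong) (auto simp: wpart_def)
    also have "\<dots> = (if mwt xs = w \<and> admissible xs then f (take j xs) * g (drop j xs) else 0)"
      using mwt[of j] adm[of j] by (auto simp: wpart_def)
    finally show ?thesis .
  qed
  have "(\<Sum>u\<le>w. conv (wpart u f) (wpart (w - u) g)) xs
      = (\<Sum>j\<le>length xs. \<Sum>u\<le>w. wpart u f (take j xs) * wpart (w - u) g (drop j xs))"
    unfolding sum_apply conv_def by (rule sum.swap)
  then show "wpart w (conv f g) xs = (\<Sum>u\<le>w. conv (wpart u f) (wpart (w - u) g)) xs"
    unfolding eq by (auto simp: wpart_def conv_def)
qed

lemma eqv_conv: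
  assumes "eqv f f'" "eqv g g'"
  shows "eqv (conv f g) (conv f' g')"
proof -
  have "conv f g - conv f' g' = conv (f - f') g + conv f' (g - g')"
    by (simp add: conv_linear)
  then show ?thesis
    using assms unfolding eqv_def
    by (simp add: wpart_linear(2) wpart_conv ext_ideal.add ext_ideal_sum
        conv_wpart_left conv_wpart_right)
qed

lemma ext_ideal_Nil: "f \<in> ext_ideal \<Longrightarrow> f [] = 0"
  by (induction rule: ext_ideal.induct) (auto simp: unitv_def sg_def letters_def conv_def)

lemma conv_unit_left: "conv (unitv []) f = f"
proof
  fix xs
  have "conv (unitv []) f xs = (\<Sum>j\<le>length xs. if j = 0 then f xs else 0)"
    unfolding conv_def by (intro sum.cong) (auto simp: unitv_def)
  then show "conv (unitv []) f xs = f xs" by simp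
qed

lemma conv_unit_right: "conv f (unitv []) = f"
proof
  fix xs
  have "conv f (unitv []) xs = (\<Sum>j\<le>length xs. if j = length xs then f xs else 0)"
    unfolding conv_def by (intro sum.cong) (auto simp: unitv_def)
  then show "conv f (unitv []) xs = f xs" by simp
qed

lemma conv_assoc: "conv (conv f g) h = conv f (conv g h)"
proof
  fix xs :: "'a list"
  let ?n = "length xs"
  have "conv (conv f g) h xs
      = (\<Sum>j\<le>?n. \<Sum>i\<le>j. f (take i xs) * g (drop i (take j xs)) * h (drop j xs))"
    unfolding conv_def sum_distrib_right
    by (intro sum.cong) (auto simp: min_def)
  also have "\<dots> = (\<Sum>i\<le>?n. \<Sum>j\<in>{i..?n}. f (take i xs) * g (drop i (take j xs)) * h (drop j xs))"
  proof -
    have "{i \<in> {..?n}. i \<le> j} = {..j}" if "j \<in> {..?n}" for j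
      using that by auto
    moreover have "{j \<in> {..?n}. i \<le> j} = {i..?n}" for i
      by auto
    ultimately show ?thesis
      using sum.swap_restrict[of "{..?n}" "{..?n}"
        "\<lambda>j i. f (take i xs) * g (drop i (take j xs)) * h (drop j xs)" "\<lambda>j i. i \<le> j"]
      by simp
  qed
  also have "\<dots> = (\<Sum>i\<le>?n. \<Sum>l\<le>?n - i. f (take i xs) * g (take l (drop i xs)) * h (drop (i + l) xs))"
  proof (rule sum.cong[OF refl])
    fix i
    assume "i \<in> {..?n}"
    then show "(\<Sum>j\<in>{i..?n}. f (take i xs) * g (drop i (take j xs)) * h (drop j xs))
        = (\<Sum>l\<le>?n - i. f (take i xs) * g (take l (drop i xs)) * h (drop (i + l) xs))"
      by (intro sum.reindex_bij_witness[of _ "\<lambda>l. i + l" "\<lambda>j. j - i"]) (auto simp: drop_take)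
  qed
  also have "\<dots> = conv f (conv g h) xs"
    unfolding conv_def sum_distrib_left
    by (intro sum.cong) (auto simp: add.commute mult.assoc)
  finally show "conv (conv f g) h xs = conv f (conv g h) xs" .
qed

instantiation ext_lie :: (graded_basis, field) ring_1
begin

lift_definition zero_ext_lie :: "('a, 'b) ext_lie" is 0 .

lift_definition one_ext_lie :: "('a, 'b) ext_lie" is "unitv []" .

lift_definition plus_ext_lie :: "('a, 'b) ext_lie \<Rightarrow> ('a, 'b) ext_lie \<Rightarrow> ('a, 'b) ext_lie"
  is "(+)"
  unfolding eqv_def by (auto simp: wpart_linear add_diff_add intro: ext_ideal.add)

lift_definition minus_ext_lie :: "('a, 'b) ext_lie \<Rightarrow> ('a, 'b) ext_lie \<Rightarrow> ('a, 'b) ext_lie"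
  is "(-)"
proof -
  fix f f' g g' :: "'a ltree list \<Rightarrow> 'b"
  assume "eqv f f'" "eqv g g'"
  moreover have "(f - g) - (f' - g') = (f - f') - (g - g')"
    by simp
  ultimately show "eqv (f - g) (f' - g')"
    unfolding eqv_def by (metis ext_ideal_minus wpart_linear(3))
qed

lift_definition uminus_ext_lie :: "('a, 'b) ext_lie \<Rightarrow> ('a, 'b) ext_lie" is uminus
  unfolding eqv_def by (metis ext_ideal_uminus minus_diff_minus wpart_linear(5))

lift_definition times_ext_lie :: "('a, 'b) ext_lie \<Rightarrow> ('a, 'b) ext_lie \<Rightarrow> ('a, 'b) ext_lie"
  is conv
  by (rule eqv_conv)

instance
proof
  fix a b c :: "('a, 'b) ext_lie"
  have refl: "f = g \<Longrightarrow> eqv f g" for f g :: "'a ltree list \<Rightarrow> 'b"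
    by (simp add: equivp_reflp[OF equivp_eqv])
  show "a + b + c = a + (b + c)" by transfer (rule refl, simp add: algebra_simps)
  show "a + b = b + a" by transfer (rule refl, simp add: algebra_simps)
  show "0 + a = a" by transfer (rule refl, simp)
  show "- a + a = 0" by transfer (rule refl, simp)
  show "a - b = a + - b" by transfer (rule refl, simp)
  show "a * b * c = a * (b * c)" by transfer (rule refl, rule conv_assoc)
  show "1 * a = a" by transfer (rule refl, rule conv_unit_left)
  show "a * 1 = a" by transfer (rule refl, rule conv_unit_right)
  show "(a + b) * c = a * c + b * c" by transfer (rule refl, rule conv_linear)
  show "a * (b + c) = a * b + a * c" by transfer (rule refl, rule conv_linear)
  show "(0::('a, 'b) ext_lie) \<noteq> 1"
  proof (transfer, rule notI)
    assume "eqv (0 :: 'a ltree list \<Rightarrow> 'b) (unitv [])"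
    then have "wpart 0 (0 - unitv [] :: 'a ltree list \<Rightarrow> 'b) [] = 0"
      unfolding eqv_def by (intro ext_ideal_Nil) blast
    then show False by (simp add: wpart_def mwt_def admissible_def unitv_def)
  qed
qed

end

lift_definition smul :: "'k::field \<Rightarrow> ('i::graded_basis, 'k) ext_lie \<Rightarrow> ('i, 'k) ext_lie"
  is "\<lambda>c f xs. c * f xs"
proof -
  fix c :: 'k and f g :: "'i ltree list \<Rightarrow> 'k"
  have *: "(\<lambda>xs. c * f xs) - (\<lambda>xs. c * g xs) = (\<lambda>xs. c * (f - g) xs)"
    by (auto simp: algebra_simps)
  assume "eqv f g"
  then show "eqv (\<lambda>xs. c * f xs) (\<lambda>xs. c * g xs)"
    unfolding eqv_def * wpart_linear(4) by (blast intro: ext_ideal.scale)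
qed

lemma lie_ideal_sign: "f \<in> lie_ideal \<Longrightarrow> (\<lambda>t. sg (tdeg t) (f t)) \<in> lie_ideal"
proof (induction rule: lie_ideal.induct)
  case zero
  have "(\<lambda>t. sg (tdeg t) ((0 :: 'a ltree \<Rightarrow> 'b) t)) = 0" by (auto simp: sg_def)
  then show ?case by (simp only: lie_ideal.zero)
next
  case (add f g)
  have "(\<lambda>t. sg (tdeg t) ((f + g) t)) = (\<lambda>t. sg (tdeg t) (f t)) + (\<lambda>t. sg (tdeg t) (g t))"
    by (auto simp: sg_def)
  with add show ?case by (simp only: lie_ideal.add)
next
  case (scale f c)
  have "(\<lambda>t. sg (tdeg t) (c * f t)) = (\<lambda>t. c * sg (tdeg t) (f t))"
    by (auto simp: sg_def)
  with scale show ?case by (simp only: lie_ideal.scale)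
next
  case (antisym s t)
  let ?f = "unitv (Br s t) + sg (tdeg s * tdeg t) (unitv (Br t s)) :: 'a ltree \<Rightarrow> 'b"
  have "(\<lambda>x. sg (tdeg x) (?f x)) = (\<lambda>x. sg (tdeg s + tdeg t) 1 * ?f x)"
    by (auto simp: sg_def unitv_def fun_eq_iff)
  then show ?case by (simp only: lie_ideal.scale lie_ideal.antisym)
next
  case (jacobi s t u)
  let ?f = "unitv (Br s (Br t u)) - unitv (Br (Br s t) u)
             - sg (tdeg s * tdeg t) (unitv (Br t (Br s u))) :: 'a ltree \<Rightarrow> 'b"
  have "(\<lambda>x. sg (tdeg x) (?f x)) = (\<lambda>x. sg (tdeg s + tdeg t + tdeg u) 1 * ?f x)"
    by (auto simp: sg_def unitv_def fun_eq_iff)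
  then show ?case by (simp only: lie_ideal.scale lie_ideal.jacobi)
next
  case (left f t)
  have "sg (tdeg x) (tmul (unitv t) f x)
          = sg (tdeg t) 1 * tmul (unitv t) (\<lambda>t. sg (tdeg t) (f t)) x" for x
    by (cases x) (auto simp: sg_def unitv_def)
  with left show ?case by (simp only: lie_ideal.scale lie_ideal.left)
next
  case (right f t)
  have "sg (tdeg x) (tmul f (unitv t) x)
          = sg (tdeg t) 1 * tmul (\<lambda>t. sg (tdeg t) (f t)) (unitv t) x" for x
    by (cases x) (auto simp: sg_def unitv_def)
  with right show ?case by (simp only: lie_ideal.scale lie_ideal.right)
qed

lemma mdeg_append: "mdeg (xs @ ys) = mdeg xs + mdeg ys"
  by (simp add: mdeg_def)

lemma ext_ideal_sign: "f \<in> ext_ideal \<Longrightarrow> (\<lambda>xs. sg (mdeg xs) (f xs)) \<in> ext_ideal"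
proof (induction rule: ext_ideal.induct)
  case zero
  have "(\<lambda>t. sg (mdeg t) ((0 :: 'a ltree list \<Rightarrow> 'b) t)) = 0" by (auto simp: sg_def)
  then show ?case by (simp only: ext_ideal.zero)
next
  case (add f g)
  have "(\<lambda>t. sg (mdeg t) ((f + g) t)) = (\<lambda>t. sg (mdeg t) (f t)) + (\<lambda>t. sg (mdeg t) (g t))"
    by (auto simp: sg_def)
  with add show ?case by (simp only: ext_ideal.add)
next
  case (scale f c)
  have "(\<lambda>t. sg (mdeg t) (c * f t)) = (\<lambda>t. c * sg (mdeg t) (f t))"
    by (auto simp: sg_def)
  with scale show ?case by (simp only: ext_ideal.scale)
next
  case (lie f)
  have "(\<lambda>xs. sg (mdeg xs) (letters f xs)) = (\<lambda>xs. (-1) * letters (\<lambda>t. sg (tdeg t) (f t)) xs)"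
    by (auto simp: letters_def sg_def mdeg_def fun_eq_iff split: list.split)
  with lie show ?case by (simp only: ext_ideal.scale ext_ideal.lie lie_ideal_sign)
next
  case (comm s t)
  let ?f = "unitv [s, t] - sg ((tdeg s + 1) * (tdeg t + 1)) (unitv [t, s]) :: 'a ltree list \<Rightarrow> 'b"
  have "sg (mdeg x) (?f x) = sg (tdeg s + tdeg t) 1 * ?f x" for x
  proof (cases "x = [s, t] \<or> x = [t, s]")
    case True
    then have "even (mdeg x) \<longleftrightarrow> even (tdeg s + tdeg t)"
      by (auto simp: mdeg_def)
    then show ?thesis by (simp add: sg_def)
  next
    case False
    then have "?f x = 0" by (simp add: unitv_def sg_def)
    then show ?thesis by (simp add: sg_def)
  qed
  then show ?case by (simp only: ext_ideal.scale ext_ideal.comm)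
next
  case (left f xs)
  have "sg (mdeg ys) (conv (unitv xs) f ys)
          = sg (mdeg xs) 1 * conv (unitv xs) (\<lambda>xs. sg (mdeg xs) (f xs)) ys" for ys
  proof -
    have "even (mdeg ys) \<longleftrightarrow> (even (mdeg (take j ys)) \<longleftrightarrow> even (mdeg (drop j ys)))" for j
      by (metis append_take_drop_id mdeg_append even_add)
    then have "sg (mdeg ys) 1 * (unitv xs (take j ys) * f (drop j ys))
       = sg (mdeg xs) 1 * (unitv xs (take j ys) * sg (mdeg (drop j ys)) (f (drop j ys)))" for j
      by (auto simp: sg_def unitv_def)
    moreover have "sg (mdeg ys) (conv (unitv xs) f ys) = sg (mdeg ys) 1 * conv (unitv xs) f ys"
      by (simp add: sg_def)
    ultimately show ?thesis
      by (simp only: conv_def sum_distrib_left)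
  qed
  with left show ?case by (simp only: ext_ideal.scale ext_ideal.left)
next
  case (right f xs)
  have "sg (mdeg ys) (conv f (unitv xs) ys)
          = sg (mdeg xs) 1 * conv (\<lambda>xs. sg (mdeg xs) (f xs)) (unitv xs) ys" for ys
  proof -
    have "even (mdeg ys) \<longleftrightarrow> (even (mdeg (take j ys)) \<longleftrightarrow> even (mdeg (drop j ys)))" for j
      by (metis append_take_drop_id mdeg_append even_add)
    then have "sg (mdeg ys) 1 * (f (take j ys) * unitv xs (drop j ys))
       = sg (mdeg xs) 1 * (sg (mdeg (take j ys)) (f (take j ys)) * unitv xs (drop j ys))" for j
      by (auto simp: sg_def unitv_def)
    moreover have "sg (mdeg ys) (conv f (unitv xs) ys) = sg (mdeg ys) 1 * conv f (unitv xs) ys"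
      by (simp add: sg_def)
    ultimately show ?thesis
      by (simp only: conv_def sum_distrib_left)
  qed
  with right show ?case by (simp only: ext_ideal.scale ext_ideal.right)
qed

text \<open>The linear extension of $x \mapsto (-1)^{|x|} x$.\<close>

lift_definition parity :: "('i::graded_basis, 'k::field) ext_lie \<Rightarrow> ('i, 'k) ext_lie"
  is "\<lambda>f xs. sg (mdeg xs) (f xs)"
proof -
  fix f g :: "'i ltree list \<Rightarrow> 'k"
  have "wpart w ((\<lambda>xs. sg (mdeg xs) (f xs)) - (\<lambda>xs. sg (mdeg xs) (g xs)))
          = (\<lambda>xs. sg (mdeg xs) (wpart w (f - g) xs))" for w
    by (auto simp: wpart_def sg_def)
  moreover assume "eqv f g"
  ultimately show "eqv (\<lambda>xs. sg (mdeg xs) (f xs)) (\<lambda>xs. sg (mdeg xs) (g xs))"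
    by (simp add: eqv_def ext_ideal_sign)
qed

text \<open>The element of $\mathrm{Lie}(W) = \Lambda^1(\mathrm{Lie}(W))$ given by an iterated bracket.\<close>

lift_definition lie_elem :: "'i::graded_basis ltree \<Rightarrow> ('i, 'k::field) ext_lie"
  is "\<lambda>t. unitv [t]" .

text \<open>The dual basis of $W$ (zero for indices outside \<open>gbasis\<close>).\<close>

definition gen :: "'i::graded_basis \<Rightarrow> ('i, 'k::field) ext_lie" where
  "gen i = lie_elem (Leaf i)"

definition gr :: "int \<Rightarrow> ('i::graded_basis, 'k::field) ext_lie set" where
  "gr n = {abs_ext_lie f | f. \<forall>xs. mdeg xs \<noteq> n \<longrightarrow> f xs = 0}"

definition Fil :: "nat \<Rightarrow> ('i::graded_basis, 'k::field) ext_lie set" where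
  "Fil p = {abs_ext_lie f | f. \<forall>xs. mwt xs < p \<longrightarrow> f xs = 0}"


section \<open>Operators, Gerstenhaber bracket and Batalin-Vilkovisky operator\<close>

definition operator ::
  "(('i::graded_basis, 'k::field) ext_lie \<Rightarrow> ('i, 'k) ext_lie) \<Rightarrow> bool" where
  "operator T \<longleftrightarrow>
     Vector_Spaces.linear smul smul T \<and> (\<forall>p. \<exists>q. \<forall>x\<in>Fil q. T x \<in> Fil p)"

definition has_degree ::
  "int \<Rightarrow> (('i::graded_basis, 'k::field) ext_lie \<Rightarrow> ('i, 'k) ext_lie) \<Rightarrow> bool" where
  "has_degree d T \<longleftrightarrow> (\<forall>n. \<forall>x\<in>gr n. T x \<in> gr (n + d))"

definition preserves_Fil ::
  "(('i::graded_basis, 'k::field) ext_lie \<Rightarrow> ('i, 'k) ext_lie) \<Rightarrow> bool" where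
  "preserves_Fil T \<longleftrightarrow> (\<forall>p. \<forall>x\<in>Fil p. T x \<in> Fil p)"

definition gerstenhaber_bracket ::
  "(('i::graded_basis, 'k::field) ext_lie \<Rightarrow> ('i, 'k) ext_lie \<Rightarrow> ('i, 'k) ext_lie) \<Rightarrow> bool" where
  "gerstenhaber_bracket B \<longleftrightarrow>
     (\<forall>a. operator (B a)) \<and> (\<forall>b. operator (\<lambda>a. B a b)) \<and>
     (\<forall>m n. \<forall>a\<in>gr m. \<forall>b\<in>gr n. B a b \<in> gr (m + n - 1)) \<and>
     (\<forall>m n. \<forall>a\<in>gr m. \<forall>b\<in>gr n. B a b = - sg ((m - 1) * (n - 1)) (B b a)) \<and>
     (\<forall>m n. \<forall>a\<in>gr m. \<forall>b\<in>gr n. \<forall>c.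
        B a (B b c) = B (B a b) c + sg ((m - 1) * (n - 1)) (B b (B a c))) \<and>
     (\<forall>m n. \<forall>a\<in>gr m. \<forall>b\<in>gr n. \<forall>c.
        B a (b * c) = B a b * c + sg ((m - 1) * n) (b * B a c))"

definition bracket ::
  "('i::graded_basis, 'k::field) ext_lie \<Rightarrow> ('i, 'k) ext_lie \<Rightarrow> ('i, 'k) ext_lie" where
  "bracket = (THE B. gerstenhaber_bracket B \<and>
     (\<forall>s t. B (lie_elem s) (lie_elem t) = lie_elem (Br s t)) \<and> (\<forall>c a. B (smul c 1) a = 0))"

definition BV_operator ::
  "(('i::graded_basis, 'k::field) ext_lie \<Rightarrow> ('i, 'k) ext_lie) \<Rightarrow> bool" where
  "BV_operator \<Delta> \<longleftrightarrow>
     operator \<Delta> \<and> has_degree (-1) \<Delta> \<and> (\<forall>a. \<Delta> (\<Delta> a) = 0) \<and>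
     (\<forall>m. \<forall>a\<in>gr m. \<forall>b. \<Delta> (a * b) = \<Delta> a * b + sg m (a * \<Delta> b) + sg m (bracket a b))"

text \<open>
  The sign in $\Delta(v \wedge w) = \pm [v, w]$ is the one forced by the Batalin-Vilkovisky
  identity. The chain differential with trivial coefficients vanishes on $\Lambda^1$.
\<close>

definition Delta_Lie :: "('i::graded_basis, 'k::field) ext_lie \<Rightarrow> ('i, 'k) ext_lie" where
  "Delta_Lie = (THE \<Delta>. BV_operator \<Delta> \<and> (\<forall>t. \<Delta> (lie_elem t) = 0) \<and>
     (\<forall>s t. \<Delta> (lie_elem s * lie_elem t)
              = sg (tdeg s + 1) (bracket (lie_elem s) (lie_elem t))))"

definition derivation ::
  "int \<Rightarrow> (('i::graded_basis, 'k::field) ext_lie \<Rightarrow> ('i, 'k) ext_lie) \<Rightarrow> bool" where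
  "derivation d T \<longleftrightarrow>
     operator T \<and> has_degree d T \<and>
     (\<forall>m. \<forall>a\<in>gr m. \<forall>b. T (a * b) = T a * b + sg (d * m) (a * T b)) \<and>
     (\<forall>m. \<forall>a\<in>gr m. \<forall>b.
        T (bracket a b) = bracket (T a) b + sg (d * (m - 1)) (bracket a (T b)))"

text \<open>
  \<open>diff_op n d T\<close>: the operator \<open>T\<close> of degree \<open>d\<close> is a differential operator of order at most
  \<open>n\<close> in the sense of Grothendieck, i.e. all its iterated graded commutators with $n + 1$
  multiplication operators vanish.
\<close>

fun diff_op ::
  "nat \<Rightarrow> int \<Rightarrow> (('i::graded_basis, 'k::field) ext_lie \<Rightarrow> ('i, 'k) ext_lie) \<Rightarrow> bool" where
  "diff_op 0 d T \<longleftrightarrow> (\<forall>m. \<forall>a\<in>gr m. \<forall>x. T (a * x) - sg (d * m) (a * T x) = 0)"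
| "diff_op (Suc n) d T \<longleftrightarrow>
     (\<forall>m. \<forall>a\<in>gr m. diff_op n (d + m) (\<lambda>x. T (a * x) - sg (d * m) (a * T x)))"


section \<open>Homotopy Gerstenhaber and homotopy BV structures\<close>

definition G_infinity ::
  "(('i::graded_basis, 'k::field) ext_lie \<Rightarrow> ('i, 'k) ext_lie) \<Rightarrow> bool" where
  "G_infinity \<delta> \<longleftrightarrow> derivation 1 \<delta> \<and> (\<forall>x. \<delta> (\<delta> x) = 0)"

text \<open>
  \<open>T i\<close> is $\Delta_i$, used for odd \<open>i\<close> only. The sum $\partial + \Delta_1 + \Delta_3 + \dots$
  converges pointwise for the topology defined by the filtration.
\<close>

definition BV_infinity ::
  "(('i::graded_basis, 'k::field) ext_lie \<Rightarrow> ('i, 'k) ext_lie) \<Rightarrow>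
   (('i, 'k) ext_lie \<Rightarrow> ('i, 'k) ext_lie) \<Rightarrow> bool" where
  "BV_infinity \<delta> \<Delta> \<longleftrightarrow>
     G_infinity \<delta> \<and> operator \<Delta> \<and> (\<forall>x. \<Delta> (\<Delta> x) = 0) \<and>
     (\<exists>T :: nat \<Rightarrow> ('i, 'k) ext_lie \<Rightarrow> ('i, 'k) ext_lie.
        (\<forall>i. odd i \<longrightarrow> operator (T i) \<and> has_degree (- int i) (T i) \<and> T i 1 = 0) \<and>
        (\<forall>x p. \<exists>N. \<forall>n\<ge>N. \<Delta> x - (\<delta> x + (\<Sum>j<n. T (2 * j + 1) x)) \<in> Fil p) \<and>
        diff_op 1 (-1) (\<lambda>x. T 1 x - Delta_Lie x) \<and>
        (\<forall>i>1. diff_op i (- int (2 * i - 1)) (T (2 * i - 1))) \<and>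
        (\<forall>i. odd i \<longrightarrow> preserves_Fil (T i)))"


section \<open>The canonical deformation\<close>

text \<open>
  A pair \<open>(x, y)\<close> stands for $x + \epsilon y$. With $\epsilon$ of degree 1, $\epsilon^2 = 0$, the
  $\epsilon$-linear extensions of product and bracket satisfy $a\,\epsilon = (-1)^{|a|} \epsilon\,a$,
  $[\epsilon a, b] = \epsilon [a, b]$ and $[a, \epsilon b] = (-1)^{|a|-1} \epsilon [a, b]$.
\<close>

type_synonym ('i, 'k) ext_lie_eps = "('i, 'k) ext_lie \<times> ('i, 'k) ext_lie"

fun eps_smul ::
  "'k::field \<Rightarrow> ('i::graded_basis, 'k) ext_lie_eps \<Rightarrow> ('i, 'k) ext_lie_eps" where
  "eps_smul c (a, b) = (smul c a, smul c b)"

fun eps_times :: "('i::graded_basis, 'k::field) ext_lie_eps \<Rightarrow> ('i, 'k) ext_lie_eps \<Rightarrow>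
    ('i, 'k) ext_lie_eps" where
  "eps_times (a, b) (c, d) = (a * c, b * c + parity a * d)"

fun eps_bracket :: "('i::graded_basis, 'k::field) ext_lie_eps \<Rightarrow> ('i, 'k) ext_lie_eps \<Rightarrow>
    ('i, 'k) ext_lie_eps" where
  "eps_bracket (a, b) (c, d) = (bracket a c, bracket b c - bracket (parity a) d)"

text \<open>Multiplication by $\epsilon$ from the left.\<close>

fun eps_mult :: "('i::graded_basis, 'k::field) ext_lie_eps \<Rightarrow> ('i, 'k) ext_lie_eps" where
  "eps_mult (a, b) = (0, a)"

text \<open>
  Extension of an operator \<open>T\<close> of degree \<open>d\<close>: $T \epsilon = (-1)^d \epsilon\,T$.
\<close>

fun eps_extend :: "int \<Rightarrow> (('i::graded_basis, 'k::field) ext_lie \<Rightarrow> ('i, 'k) ext_lie) \<Rightarrow>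
    ('i, 'k) ext_lie_eps \<Rightarrow> ('i, 'k) ext_lie_eps" where
  "eps_extend d T (a, b) = (T a, sg d (T b))"

definition eps_morphism ::
  "(('i::graded_basis, 'k::field) ext_lie_eps \<Rightarrow> ('j::graded_basis, 'k) ext_lie_eps) \<Rightarrow> bool" where
  "eps_morphism \<Phi> \<longleftrightarrow>
     Vector_Spaces.linear eps_smul eps_smul \<Phi> \<and>
     (\<forall>p. \<exists>q. \<forall>z \<in> Fil q \<times> Fil q. \<Phi> z \<in> Fil p \<times> Fil p) \<and>
     (\<forall>n. \<forall>z \<in> gr n \<times> gr (n - 1). \<Phi> z \<in> gr n \<times> gr (n - 1)) \<and>
     (\<forall>z. \<Phi> (eps_mult z) = eps_mult (\<Phi> z)) \<and>
     \<Phi> (1, 0) = (1, 0) \<and>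
     (\<forall>y z. \<Phi> (eps_times y z) = eps_times (\<Phi> y) (\<Phi> z)) \<and>
     (\<forall>y z. \<Phi> (eps_bracket y z) = eps_bracket (\<Phi> y) (\<Phi> z))"

text \<open>\<open>gen (E0 i)\<close> and \<open>gen (E1 i)\<close> are the copies $w_0$, $w_1$ of \<open>w = gen i\<close>.\<close>

definition Phi :: "('i::graded_basis, 'k::field) ext_lie_eps \<Rightarrow> ('i eps, 'k) ext_lie_eps" where
  "Phi = (THE \<Phi>. eps_morphism \<Phi> \<and> (\<forall>i. \<Phi> (gen i, 0) = (gen (E0 i), gen (E1 i))))"

text \<open>$[\partial, \Delta_{\mathrm{Lie}}]$, a graded commutator of two operators of odd degree.\<close>

definition D_comm :: "(('i::graded_basis, 'k::field) ext_lie \<Rightarrow> ('i, 'k) ext_lie) \<Rightarrow>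
    ('i, 'k) ext_lie \<Rightarrow> ('i, 'k) ext_lie" where
  "D_comm \<delta> x = \<delta> (Delta_Lie x) + Delta_Lie (\<delta> x)"

definition is_partial_can :: "(('i::graded_basis, 'k::field) ext_lie \<Rightarrow> ('i, 'k) ext_lie) \<Rightarrow>
    (('i eps, 'k) ext_lie \<Rightarrow> ('i eps, 'k) ext_lie) \<Rightarrow> bool" where
  "is_partial_can \<delta> P \<longleftrightarrow> derivation 1 P \<and>
     (\<forall>z. eps_extend 1 P (Phi z)
            = Phi (eps_extend 1 \<delta> z + eps_mult (eps_extend 0 (D_comm \<delta>) z)))"

definition partial_can :: "(('i::graded_basis, 'k::field) ext_lie \<Rightarrow> ('i, 'k) ext_lie) \<Rightarrow>
    ('i eps, 'k) ext_lie \<Rightarrow> ('i eps, 'k) ext_lie" where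
  "partial_can \<delta> = (THE P. is_partial_can \<delta> P)"

text \<open>
  The dual of $\epsilon a_i \mapsto a_i$, $a_i \mapsto 0$, extended as a derivation.
\<close>

definition d_eps :: "('i::graded_basis eps, 'k::field) ext_lie \<Rightarrow> ('i eps, 'k) ext_lie" where
  "d_eps = (THE T. derivation (-1) T \<and> (\<forall>i. T (gen (E0 i)) = gen (E1 i) \<and> T (gen (E1 i)) = 0))"

end

theory Submission
  imports Defs
begin

text \<open>
  The chain differential $\Delta_{\mathrm{Lie}}$ is built first, by the recursion
  $\Delta(x r) = (-1)^{|x|} (x\,\Delta r + \mathrm{ad}_x r)$ for $x \in \mathrm{Lie}(W)$, and the
  Gerstenhaber bracket on $\Lambda(\mathrm{Lie}(W))$ is read off from its failure to be a derivation
  of the product; $\Delta^2 = 0$ and the Poisson rule then give the Jacobi identity.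

  Since $\Lambda(\mathrm{Lie}(W))$ is a free Gerstenhaber algebra, derivations of product and bracket
  may be prescribed on generators and identities between them checked there. Let $\iota$ be the
  morphism $w \mapsto w_0$; then $\Phi = \iota + \epsilon\, (\partial/\partial\epsilon)\,\iota$. Put
  $E = \Delta_{\mathrm{Lie}} + \partial/\partial\epsilon$, so that $E^2 = 0$. The derivation
  $\partial_{\mathrm{can}}$ is given by $w_0 \mapsto \iota(\partial w)$ and
  $w_1 \mapsto - E\,\iota(\partial w)$. As $E w_0 = w_1$ and $E w_1 = 0$, the graded commutator of
  $\partial_{\mathrm{can}}$ and $E$, again a derivation, vanishes on generators. Therefore
  $(\partial_{\mathrm{can}} + E)^2 = 0$, and no $\Delta_k$ with $k \ge 3$ is needed.
\<close>

section \<open>The filtration and finite linear combinations\<close>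

text \<open>The bracket, \<open>Delta_Lie\<close>, \<open>Phi\<close>, \<open>d_eps\<close> and
  \<open>partial_can\<close> are definite descriptions, so each needs existence and uniqueness
  before anything can be computed with it. The obstacle to existence is the completion: an element
  is a class of arbitrary functions on lists of trees, while the ideals contain only finitely
  supported ones. Maps are therefore prescribed on monomials, checked against the relations and
  extended by limits, which requires a bound on the loss of weight. Identities pass from monomials
  to all elements because the sets on which they hold are closed subspaces. No basis of the free Lie
  algebra is chosen and nothing is divided by an integer; signs are settled by cases on parities.
  The value of the derivation P = \<open>partial_can \<delta>\<close> on w_1 is forced: the
  coefficient of \<epsilon> in its defining equation at w says that - P w_1 is the sum of
  \<open>d_eps\<close> applied to \<iota>(\<delta> w) and of \<iota>(D w). Here D w =
  \<Delta>_Lie(\<delta> w), since \<Delta>_Lie kills generators, and \<iota> commutes with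
  \<Delta>_Lie, so the sum is E \<iota>(\<delta> w).\<close>

lemma sg_simps [simp]:
  "sg n (0::'a::group_add) = 0" "sg n (- x) = - sg n (x::'a)" "sg n (sg n x) = x" "sg 0 x = x"
  by (auto simp: sg_def)

lemma sg_add: "sg n (x + y) = sg n x + sg n (y::'a::ab_group_add)"
  and sg_diff: "sg n (x - y) = sg n x - sg n y"
  by (auto simp: sg_def)

lemma smul_simps [simp]:
  "smul c (x + y) = smul c x + smul c y" "smul (a + b) x = smul a x + smul b x"
  "smul a (smul b x) = smul (a * b) x" "smul 1 x = x" "smul 0 x
      = 0" "smul c (0 :: ('i, 'k) ext_lie) = 0"
  "smul c (x - y) = smul c x - smul c y" "smul c (- x) = - smul c x"
  "smul c x * y = smul c (x * y)" "x * smul c y = smul c (x * y)"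
  for x y :: "('i::graded_basis, 'k::field) ext_lie"
proof -
  have r: "f = g \<Longrightarrow> eqv f g" for f g :: "'i ltree list \<Rightarrow> 'k"
    by (simp add: equivp_reflp[OF equivp_eqv])
  show add: "smul c (x + y) = smul c x + smul c y"
    by transfer (rule r, auto simp: algebra_simps)
  show "smul (a + b) x = smul a x + smul b x"
    by transfer (rule r, auto simp: algebra_simps)
  show "smul a (smul b x) = smul (a * b) x"
    by transfer (rule r, auto simp: algebra_simps)
  show "smul 1 x = x"
    by transfer (rule r, auto)
  show "smul 0 x = 0"
    by transfer (rule r, auto)
  show "smul c (0 :: ('i, 'k) ext_lie) = 0"
    by transfer (rule r, rule ext, simp)
  show "smul c (x - y) = smul c x - smul c y"
    by transfer (rule r, auto simp: algebra_simps)
  show "smul c (- x) = - smul c x"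
    by transfer (rule r, auto)
  show "smul c x * y = smul c (x * y)"
    by transfer (rule r, simp add: conv_linear)
  show "x * smul c y = smul c (x * y)"
    by transfer (rule r, simp add: conv_linear)
qed

lemma smul_sg: "smul (sg n a) x = sg n (smul a x)" "smul a (sg n x) = sg n (smul a x)"
proof -
  have "smul (- a) x = - smul a x"
    using smul_simps(2)[of a "- a" x] by (simp add: eq_neg_iff_add_eq_0 add.commute)
  then show "smul (sg n a) x = sg n (smul a x)" "smul a (sg n x) = sg n (smul a x)"
    by (auto simp: sg_def)
qed

lemma smul_sum: "smul c (sum f A) = (\<Sum>x\<in>A. smul c (f x))"
  by (induction A rule: infinite_finite_induct) auto

lemma vector_space_smul: "vector_space smul"
  by unfold_locales auto

lemma linear_smul_iff:
  "Vector_Spaces.linear smul smul T \<longleftrightarrow>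
    (\<forall>x y. T (x + y) = T x + T y) \<and> (\<forall>c x. T (smul c x) = smul c (T x))"
  by (simp add: Vector_Spaces.linear_iff vector_space_smul)

text \<open>Setting a representative to zero in the weights below p stays within its class exactly
  when the discarded parts lie in the ideal, so membership can be read off from any
  representative.\<close>

lemma Fil_iff: "abs_ext_lie f \<in> Fil p \<longleftrightarrow> (\<forall>w<p. wpart w f \<in> ext_ideal)"
proof
  assume "abs_ext_lie f \<in> Fil p"
  then obtain g where g: "eqv f g" "\<forall>xs. mwt xs < p \<longrightarrow> g xs = 0"
    by (auto simp: Fil_def ext_lie.abs_eq_iff)
  have "wpart w g = 0" if "w < p" for w
    using g(2) that by (auto simp: wpart_def)
  then show "\<forall>w<p. wpart w f \<in> ext_ideal"
    using g(1) unfolding eqv_def by (metis diff_zero wpart_linear(3))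
next
  assume f: "\<forall>w<p. wpart w f \<in> ext_ideal"
  define g where "g = (\<lambda>xs. if mwt xs < p then 0 else f xs)"
  have "wpart w (f - g) = (if w < p then wpart w f else 0)" for w
    by (auto simp: wpart_def g_def)
  then have "eqv f g"
    using f by (auto simp: eqv_def intro: ext_ideal.zero)
  then show "abs_ext_lie f \<in> Fil p"
    unfolding Fil_def by (auto simp: g_def ext_lie.abs_eq_iff intro!: exI[of _ g])
qed

lemma abs_exhaust: obtains f where "x = abs_ext_lie f"
  by (metis Quotient3_abs_rep Quotient3_ext_lie)

lemma Fil_0 [simp]: "x \<in> Fil 0"
  by (cases x rule: abs_exhaust) (simp add: Fil_iff)

lemma Fil_zero [simp]: "0 \<in> Fil p"
  by (simp add: zero_ext_lie_def Fil_iff wpart_linear ext_ideal.zero)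

lemma Fil_add: "x \<in> Fil p \<Longrightarrow> y \<in> Fil p \<Longrightarrow> x + y \<in> Fil p"
  by (cases x rule: abs_exhaust; cases y rule: abs_exhaust)
    (simp add: plus_ext_lie.abs_eq Fil_iff wpart_linear ext_ideal.add)

lemma Fil_diff: "x \<in> Fil p \<Longrightarrow> y \<in> Fil p \<Longrightarrow> x - y \<in> Fil p"
  by (cases x rule: abs_exhaust; cases y rule: abs_exhaust)
    (simp add: minus_ext_lie.abs_eq Fil_iff wpart_linear ext_ideal_minus)

lemma Fil_uminus: "x \<in> Fil p \<Longrightarrow> - x \<in> Fil p"
  using Fil_diff[of 0 p x] by simp

lemma Fil_sg: "x \<in> Fil p \<Longrightarrow> sg n x \<in> Fil p"
  by (simp add: sg_def Fil_uminus)

lemma Fil_smul: "x \<in> Fil p \<Longrightarrow> smul c x \<in> Fil p"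
  by (cases x rule: abs_exhaust)
    (simp add: smul.abs_eq Fil_iff wpart_linear ext_ideal.scale)

lemma Fil_mono: "x \<in> Fil q \<Longrightarrow> p \<le> q \<Longrightarrow> x \<in> Fil p"
  by (cases x rule: abs_exhaust) (simp add: Fil_iff)

lemma Fil_times: "x \<in> Fil p \<Longrightarrow> y \<in> Fil q \<Longrightarrow> x * y \<in> Fil (p + q)"
proof (cases x rule: abs_exhaust, cases y rule: abs_exhaust)
  fix f g :: "'a ltree list \<Rightarrow> 'b"
  assume x: "x \<in> Fil p" "x = abs_ext_lie f" and y: "y \<in> Fil q" "y = abs_ext_lie g"
  have "conv (wpart u f) (wpart (w - u) g) \<in> ext_ideal" if "u \<le> w" "w < p + q" for u w
  proof (cases "u < p")
    case True
    then show ?thesis using x by (intro conv_wpart_right) (simp add: Fil_iff)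
  next
    case False
    then show ?thesis using y that by (intro conv_wpart_left) (simp add: Fil_iff)
  qed
  then show ?thesis
    using x y by (auto simp: times_ext_lie.abs_eq Fil_iff wpart_conv intro!: ext_ideal_sum)
qed

lemma Fil_times_left: "x \<in> Fil p \<Longrightarrow> x * y \<in> Fil p"
  and Fil_times_right: "x \<in> Fil p \<Longrightarrow> y * x \<in> Fil p"
  using Fil_times[of x p y 0] Fil_times[of y 0 x p] by auto

lemma Fil_Inter_zero: "(\<And>p. x \<in> Fil p) \<Longrightarrow> x = 0"
  by (cases x rule: abs_exhaust)
    (auto simp: Fil_iff zero_ext_lie_def ext_lie.abs_eq_iff eqv_def)

lemma Fil_complete:
  assumes "\<And>p. s (Suc p) - s p \<in> Fil p"
  shows "\<exists>y. \<forall>p. y - s p \<in> Fil p"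
proof -
  have "\<forall>p. \<exists>f. s p = abs_ext_lie f"
    by (meson abs_exhaust)
  then obtain f where f: "\<And>p. s p = abs_ext_lie (f p)"
    by metis
  \<comment> \<open>Diagonal choice: the difference of consecutive terms from index p on has weight
    at least p, so the part of weight w is final, modulo the ideal, from index w + 1.\<close>
  define g where "g xs = f (Suc (mwt xs)) xs" for xs
  have "wpart w (f q - f p) \<in> ext_ideal" if "w < p" "p \<le> q" for w p q
    using that(2)
  proof (induction q rule: dec_induct)
    case base
    then show ?case by (simp only: diff_self wpart_linear ext_ideal.zero)
  next
    case (step q)
    have "abs_ext_lie (f (Suc q) - f q) \<in> Fil q"
      using assms[of q] by (simp add: f minus_ext_lie.abs_eq)
    then have "wpart w (f (Suc q) - f q) \<in> ext_ideal"
      using step that(1) by (simp add: Fil_iff)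
    from ext_ideal.add[OF this step.IH] show ?case
      by (simp only: wpart_linear diff_add_cancel add_diff_eq)
  qed
  moreover have "wpart w (g - f p) = wpart w (f (Suc w) - f p)" for w p
    by (auto simp: wpart_def g_def)
  ultimately have "wpart w (g - f p) \<in> ext_ideal" if "w < p" for w p
    using that by (metis Suc_leI ext_ideal_uminus lessI minus_diff_eq wpart_linear(5))
  then have "abs_ext_lie g - s p \<in> Fil p" for p
    by (simp add: f minus_ext_lie.abs_eq Fil_iff)
  then show ?thesis by blast
qed

text \<open>The diagonal choice again: in weight w a homogeneous approximation modulo
  \<open>Fil (Suc w)\<close> is used.\<close>

lemma gr_closed:
  assumes "\<And>p. \<exists>y\<in>gr n. x - y \<in> Fil p"
  shows "x \<in> gr n"
proof (cases x rule: abs_exhaust)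
  case (1 f)
  have "\<exists>g. (\<forall>xs. mdeg xs \<noteq> n \<longrightarrow> g xs = 0) \<and> abs_ext_lie (f - g) \<in> Fil p" for p
    using assms[of p] by (auto simp: gr_def 1 minus_ext_lie.abs_eq)
  then obtain g where g: "\<And>p xs. mdeg xs \<noteq> n \<Longrightarrow> g p xs = 0"
      "\<And>p. abs_ext_lie (f - g p) \<in> Fil p"
    by metis
  define h where "h xs = g (Suc (mwt xs)) xs" for xs
  have "wpart w (f - h) = wpart w (f - g (Suc w))" for w
    by (auto simp: wpart_def h_def)
  then have "eqv f h"
    using g(2) by (auto simp: eqv_def Fil_iff)
  then show ?thesis
    using g(1) unfolding gr_def 1
    by (auto simp: h_def ext_lie.abs_eq_iff intro!: exI[of _ h])
qed

lemma gr_add: "x \<in> gr n \<Longrightarrow> y \<in> gr n \<Longrightarrow> x + y \<in> gr n"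
proof -
  assume "x \<in> gr n" "y \<in> gr n"
  then obtain f g where "x = abs_ext_lie f" "\<forall>xs. mdeg xs \<noteq> n \<longrightarrow> f xs = 0"
      "y = abs_ext_lie g" "\<forall>xs. mdeg xs \<noteq> n \<longrightarrow> g xs = 0"
    by (auto simp: gr_def)
  then show ?thesis
    unfolding gr_def by (auto simp: plus_ext_lie.abs_eq intro!: exI[of _ "f + g"])
qed

lemma gr_smul: "x \<in> gr n \<Longrightarrow> smul c x \<in> gr n"
  by (force simp: gr_def smul.abs_eq)

lemma gr_zero [simp]: "0 \<in> gr n"
  unfolding gr_def by (auto simp: zero_ext_lie_def intro!: exI[of _ 0])

lemma smul_minus_one: "smul (-1) x = - x"
  using smul_simps(2)[of 1 "-1" x] by (simp add: eq_neg_iff_add_eq_0 add.commute)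

lemma gr_uminus: "x \<in> gr n \<Longrightarrow> - x \<in> gr n"
  using gr_smul[of x n "-1"] by (simp add: smul_minus_one)

lemma gr_diff: "x \<in> gr n \<Longrightarrow> y \<in> gr n \<Longrightarrow> x - y \<in> gr n"
  using gr_add[of x n "- y"] by (simp add: gr_uminus)

lemma gr_sg: "x \<in> gr n \<Longrightarrow> sg m x \<in> gr n"
  by (simp add: sg_def gr_uminus)

section \<open>Monomials\<close>

definition monomial :: "'i::graded_basis ltree list \<Rightarrow> ('i, 'k::field) ext_lie" where
  "monomial xs = abs_ext_lie (unitv xs)"

lemma conv_unitv_append: "conv (unitv xs) f (xs @ ys) = f ys"
proof -
  have "take j (xs @ ys) = xs \<longleftrightarrow> j = length xs" if "j \<le> length (xs @ ys)" for j
    using that by (metis append_eq_conv_conj length_take min.absorb2)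
  then have "conv (unitv xs) f (xs @ ys)
      = (\<Sum>j\<le>length (xs @ ys). if j = length xs then f ys else 0)"
    unfolding conv_def by (intro sum.cong refl) (auto simp: unitv_def)
  then show ?thesis by simp
qed

lemma conv_unitv_left_nz:
  assumes "conv (unitv xs) f zs \<noteq> 0"
  shows "\<exists>ys. zs = xs @ ys"
proof -
  obtain j where "unitv xs (take j zs) * f (drop j zs) \<noteq> 0"
    using assms unfolding conv_def by (metis (no_types, lifting) sum.neutral)
  then have "take j zs = xs"
    by (auto simp: unitv_def split: if_splits)
  then show ?thesis by (metis append_take_drop_id)
qed

lemma conv_append_unitv: "conv f (unitv ys) (xs @ ys) = f xs"
proof -
  have "drop j (xs @ ys) = ys \<longleftrightarrow> j = length xs" if "j \<le> length (xs @ ys)" for j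
  proof
    assume "drop j (xs @ ys) = ys"
    then have "length (xs @ ys) - j = length ys" by (metis length_drop)
    then show "j = length xs" using that by simp
  qed simp
  then have "conv f (unitv ys) (xs @ ys)
      = (\<Sum>j\<le>length (xs @ ys). if j = length xs then f xs else 0)"
    unfolding conv_def by (intro sum.cong refl) (auto simp: unitv_def)
  then show ?thesis by simp
qed

lemma conv_unitv_right_nz:
  assumes "conv f (unitv ys) zs \<noteq> 0"
  shows "\<exists>xs. zs = xs @ ys"
proof -
  obtain j where "f (take j zs) * unitv ys (drop j zs) \<noteq> 0"
    using assms unfolding conv_def by (metis (no_types, lifting) sum.neutral)
  then have "drop j zs = ys"
    by (auto simp: unitv_def split: if_splits)
  then show ?thesis by (metis append_take_drop_id)
qed

lemma conv_unitv_unitv: "conv (unitv xs) (unitv ys) = unitv (xs @ ys)"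
proof
  fix zs :: "'a list"
  show "conv (unitv xs) (unitv ys) zs = (unitv (xs @ ys) zs :: 'b)"
  proof (cases "\<exists>ys'. zs = xs @ ys'")
    case True
    then show ?thesis by (auto simp: conv_unitv_append) (auto simp: unitv_def)
  next
    case False
    then show ?thesis
      using conv_unitv_left_nz[of xs "unitv ys" zs] by (auto simp: unitv_def)
  qed
qed

lemma monomial_append: "monomial (xs @ ys) = monomial xs * monomial ys"
  by (simp add: monomial_def times_ext_lie.abs_eq conv_unitv_unitv)

lemma monomial_Nil: "monomial [] = 1"
  by (simp add: monomial_def one_ext_lie_def)

lemma lie_elem_monomial: "lie_elem t = monomial [t]"
  by (simp add: monomial_def lie_elem.abs_eq)

lemma monomial_Cons: "monomial (t # xs) = lie_elem t * monomial xs"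
  using monomial_append[of "[t]" xs] by (simp add: lie_elem_monomial)

lemma monomial_gr: "monomial xs \<in> gr (mdeg xs)"
  unfolding gr_def monomial_def by (auto simp: unitv_def intro!: exI[of _ "unitv xs"])

lemma monomial_Fil: "monomial xs \<in> Fil (mwt xs)"
  unfolding Fil_def monomial_def by (auto simp: unitv_def intro!: exI[of _ "unitv xs"])

text \<open>The relation \<open>eqv\<close> ignores lists with a leaf outside \<open>gbasis\<close>.
  For this reason every map built below from values on lists or trees has to vanish on the
  inadmissible ones.\<close>

lemma monomial_nonadmissible: "\<not> admissible xs \<Longrightarrow> monomial xs = 0"
proof -
  assume "\<not> admissible xs"
  then have "wpart w (unitv xs - 0 :: 'a ltree list \<Rightarrow> 'b) = 0" for w
    by (auto simp: wpart_def unitv_def fun_eq_iff)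
  then show ?thesis
    by (auto simp: monomial_def zero_ext_lie_def ext_lie.abs_eq_iff eqv_def ext_ideal.zero)
qed

lemma lie_elem_gr: "lie_elem t \<in> gr (tdeg t + 1)"
  using monomial_gr[of "[t]"] by (simp add: lie_elem_monomial mdeg_def)

lemma lie_elem_Fil: "lie_elem t \<in> Fil (twt t)"
  using monomial_Fil[of "[t]"] by (simp add: lie_elem_monomial mwt_def)

lemma one_gr: "1 \<in> gr 0"
  using monomial_gr[of "[]"] by (simp add: monomial_Nil mdeg_def)

text \<open>\<open>lin_extend u h\<close> is the value at \<open>h\<close> of the linear extension of \<open>u\<close>; it is meaningful for finitely
  supported \<open>h\<close> only.\<close>

definition lin_extend :: "('b \<Rightarrow> ('j::graded_basis, 'k::field) ext_lie) \<Rightarrow> ('b \<Rightarrow> 'k) \<Rightarrow> ('j, 'k) ext_lie" where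
  "lin_extend u h = (\<Sum>x | h x \<noteq> 0. smul (h x) (u x))"

definition finite_support :: "('b \<Rightarrow> 'k::field) \<Rightarrow> bool" where
  "finite_support h \<longleftrightarrow> finite {x. h x \<noteq> 0}"

lemma lin_extend_superset: "finite A \<Longrightarrow> {x. h x \<noteq> 0} \<subseteq> A \<Longrightarrow> lin_extend u h = (\<Sum>x\<in>A. smul (h x) (u x))"
  unfolding lin_extend_def by (rule sum.mono_neutral_left) auto

lemma finite_support_zero: "finite_support 0"
  by (simp add: finite_support_def)

lemma finite_support_unitv: "finite_support (unitv x)"
  by (simp add: finite_support_def unitv_def)

lemma finite_support_add: "finite_support f \<Longrightarrow> finite_support g \<Longrightarrow> finite_support (f + g)"
  unfolding finite_support_def
  by (rule finite_subset[of "{x. (f + g) x \<noteq> 0}" "{x. f x \<noteq> 0} \<union> {x. g x \<noteq> 0}"]) auto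

lemma finite_support_uminus: "finite_support f \<Longrightarrow> finite_support (- f)"
  by (simp add: finite_support_def)

lemma finite_support_diff: "finite_support f \<Longrightarrow> finite_support g \<Longrightarrow> finite_support (f - g)"
  using finite_support_add[of f "- g"] finite_support_uminus[of g] by simp

lemma finite_support_scale: "finite_support f \<Longrightarrow> finite_support (\<lambda>x. c * f x)"
  unfolding finite_support_def by (rule finite_subset[of _ "{x. f x \<noteq> 0}"]) auto

lemma finite_support_sg: "finite_support f \<Longrightarrow> finite_support (sg n f)"
  by (simp add: sg_def finite_support_uminus)

lemmas finite_support_simps [simp] =
  finite_support_zero finite_support_unitv finite_support_add finite_support_uminus finite_support_diff finite_support_scale finite_support_sg

lemma lin_extend_zero [simp]: "lin_extend u 0 = 0"
  by (simp add: lin_extend_def)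

lemma lin_extend_unitv [simp]: "lin_extend u (unitv x) = u x"
  using lin_extend_superset[of "{x}" "unitv x" u] by (auto simp: unitv_def)

lemma lin_extend_add:
  assumes "finite_support f" "finite_support g"
  shows "lin_extend u (f + g) = lin_extend u f + lin_extend u g"
proof -
  let ?A = "{x. f x \<noteq> 0} \<union> {x. g x \<noteq> 0}"
  have "finite ?A" "{x. (f + g) x \<noteq> 0} \<subseteq> ?A" "{x. f x \<noteq> 0} \<subseteq> ?A" "{x. g x \<noteq> 0} \<subseteq> ?A"
    using assms by (auto simp: finite_support_def)
  then show ?thesis
    by (simp only: lin_extend_superset[of ?A] plus_fun_apply smul_simps sum.distrib)
qed

lemma lin_extend_scale: "lin_extend u (\<lambda>x. c * f x) = smul c (lin_extend u f)"
  by (cases "c = 0") (auto simp: lin_extend_def smul_sum)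

lemma lin_extend_uminus: "lin_extend u (- f) = - lin_extend u f"
  using lin_extend_scale[of u "-1" f] by (simp add: fun_Compl_def smul_minus_one)

lemma lin_extend_diff: "finite_support f \<Longrightarrow> finite_support g \<Longrightarrow> lin_extend u (f - g) = lin_extend u f - lin_extend u g"
  using lin_extend_add[of f "- g" u] by (simp add: lin_extend_uminus)

lemma lin_extend_sg: "lin_extend u (sg n f) = sg n (lin_extend u f)"
  by (simp add: sg_def lin_extend_uminus)

lemma lin_extend_fun_add: "lin_extend (\<lambda>x. u x + v x) h = lin_extend u h + lin_extend v h"
  by (simp add: lin_extend_def sum.distrib)

lemma lin_extend_fun_sg: "lin_extend (\<lambda>x. sg (n x) (u x :: ('a::graded_basis, 'b::field) ext_lie)) h = lin_extend u (\<lambda>x. sg (n x) (h x))"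
proof -
  have "(sg m a \<noteq> 0) = (a \<noteq> 0)" for m and a :: 'b
    by (simp add: sg_def)
  then show ?thesis
    by (simp add: lin_extend_def smul_sg)
qed

lemma lin_extend_apply:
  assumes "\<And>x y. T (x + y) = T x + T y" "\<And>c x. T (smul c x) = smul c (T x)"
  shows "T (lin_extend u h) = lin_extend (\<lambda>x::'b. T (u x)) h"
proof -
  have "T 0 = 0" using assms(2)[of 0 0] by simp
  then have "T (sum f A) = (\<Sum>x\<in>A. T (f x))" for f and A :: "'b set"
    using assms(1) by (induction A rule: infinite_finite_induct) auto
  then show ?thesis by (simp add: lin_extend_def assms(2))
qed

lemma lin_extend_times: "lin_extend u h * y = lin_extend (\<lambda>x. u x * y) h" "y * lin_extend u h = lin_extend (\<lambda>x. y * u x) h"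
  by (rule lin_extend_apply; simp add: algebra_simps)+

text \<open>The ideal rules that change shape move the support along an injection: adding a prefix
  or suffix, bracketing with a fixed tree, forming a one-letter list. Extending u over the image
  amounts to extending u after the injection, so inductions over the ideals can proceed by changing
  u.\<close>

lemma lin_extend_pushforward:
  assumes "inj g" "\<And>x. h' (g x) = h x" "\<And>y. h' y \<noteq> 0 \<Longrightarrow> y \<in> range g"
  shows "lin_extend u h' = lin_extend (\<lambda>x. u (g x)) h"
proof -
  have "{y. h' y \<noteq> 0} = g ` {x. h x \<noteq> 0}"
    using assms by (force simp: image_iff)
  then show ?thesis
    using assms(1) by (simp add: lin_extend_def sum.reindex inj_on_def inj_def assms(2))
qed

lemma finite_support_pushforward:
  assumes "\<And>x. h' (g x) = h x" "\<And>y. h' y \<noteq> 0 \<Longrightarrow> y \<in> range g" "finite_support h"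
  shows "finite_support h'"
proof -
  have "{y. h' y \<noteq> 0} = g ` {x. h x \<noteq> 0}"
    using assms by (force simp: image_iff)
  then show ?thesis using assms(3) by (simp add: finite_support_def)
qed

lemma conv_left_pushforward:
  "lin_extend u (conv (unitv xs) f) = lin_extend (\<lambda>ys. u (xs @ ys)) f"
  "finite_support f \<Longrightarrow> finite_support (conv (unitv xs) f)"
proof -
  have "zs \<in> range (\<lambda>ys. xs @ ys)" if "conv (unitv xs) f zs \<noteq> 0" for zs
    using conv_unitv_left_nz[OF that] by auto
  note * = conv_unitv_append[of xs f] this
  show "lin_extend u (conv (unitv xs) f) = lin_extend (\<lambda>ys. u (xs @ ys)) f"
    by (rule lin_extend_pushforward[where g = "\<lambda>ys. xs @ ys" and h = f, OF _ *]) (simp add: inj_def)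
  show "finite_support f \<Longrightarrow> finite_support (conv (unitv xs) f)"
    by (rule finite_support_pushforward[where g = "\<lambda>ys. xs @ ys" and h = f, OF *])
qed

lemma conv_right_pushforward:
  "lin_extend u (conv f (unitv ys)) = lin_extend (\<lambda>xs. u (xs @ ys)) f"
  "finite_support f \<Longrightarrow> finite_support (conv f (unitv ys))"
proof -
  have "zs \<in> range (\<lambda>xs. xs @ ys)" if "conv f (unitv ys) zs \<noteq> 0" for zs
    using conv_unitv_right_nz[OF that] by auto
  note * = conv_append_unitv[of f ys] this
  show "lin_extend u (conv f (unitv ys)) = lin_extend (\<lambda>xs. u (xs @ ys)) f"
    by (rule lin_extend_pushforward[where g = "\<lambda>xs. xs @ ys" and h = f, OF _ *]) (simp add: inj_def)
  show "finite_support f \<Longrightarrow> finite_support (conv f (unitv ys))"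
    by (rule finite_support_pushforward[where g = "\<lambda>xs. xs @ ys" and h = f, OF *])
qed

lemma letters_pushforward:
  "lin_extend u (letters f) = lin_extend (\<lambda>t. u [t]) f"
  "finite_support f \<Longrightarrow> finite_support (letters f)"
proof -
  have "letters f [t] = f t" for t
    by (simp add: letters_def)
  moreover have "zs \<in> range (\<lambda>t. [t])" if "letters f zs \<noteq> 0" for zs
    using that by (auto simp: letters_def split: list.splits)
  ultimately have * : "\<And>t. letters f [t] = f t" "\<And>zs. letters f zs \<noteq> 0 \<Longrightarrow> zs \<in> range (\<lambda>t. [t])"
    by blast+
  show "lin_extend u (letters f) = lin_extend (\<lambda>t. u [t]) f"
    by (rule lin_extend_pushforward[where g = "\<lambda>t. [t]" and h = f, OF _ *]) (simp add: inj_def)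
  show "finite_support f \<Longrightarrow> finite_support (letters f)"
    by (rule finite_support_pushforward[where g = "\<lambda>t. [t]" and h = f, OF *])
qed

lemma tmul_left_pushforward:
  "lin_extend u (tmul (unitv s) f) = lin_extend (\<lambda>t. u (Br s t)) f"
  "finite_support f \<Longrightarrow> finite_support (tmul (unitv s) f)"
proof -
  have *: "tmul (unitv s) f (Br s t) = f t" for t
    by (simp add: unitv_def)
  have nz: "x \<in> range (Br s)" if "tmul (unitv s) f x \<noteq> 0" for x
    using that by (cases x) (auto simp: unitv_def split: if_splits)
  show "lin_extend u (tmul (unitv s) f) = lin_extend (\<lambda>t. u (Br s t)) f"
    by (rule lin_extend_pushforward[where g = "Br s" and h = f, OF _ * nz]) (simp add: inj_def)
  show "finite_support f \<Longrightarrow> finite_support (tmul (unitv s) f)"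
    by (rule finite_support_pushforward[where g = "Br s" and h = f, OF * nz])
qed

lemma tmul_right_pushforward:
  "lin_extend u (tmul f (unitv s)) = lin_extend (\<lambda>t. u (Br t s)) f"
  "finite_support f \<Longrightarrow> finite_support (tmul f (unitv s))"
proof -
  have *: "tmul f (unitv s) (Br t s) = f t" for t
    by (simp add: unitv_def)
  have nz: "x \<in> range (\<lambda>t. Br t s)" if "tmul f (unitv s) x \<noteq> 0" for x
    using that by (cases x) (auto simp: unitv_def split: if_splits)
  show "lin_extend u (tmul f (unitv s)) = lin_extend (\<lambda>t. u (Br t s)) f"
    by (rule lin_extend_pushforward[where g = "\<lambda>t. Br t s" and h = f, OF _ * nz]) (simp add: inj_def)
  show "finite_support f \<Longrightarrow> finite_support (tmul f (unitv s))"
    by (rule finite_support_pushforward[where g = "\<lambda>t. Br t s" and h = f, OF * nz])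
qed

lemma lie_ideal_finite_support: "f \<in> lie_ideal \<Longrightarrow> finite_support f"
  by (induction rule: lie_ideal.induct)
    (simp_all only: finite_support_simps tmul_left_pushforward(2) tmul_right_pushforward(2))

lemma ext_ideal_finite_support: "f \<in> ext_ideal \<Longrightarrow> finite_support f"
  by (induction rule: ext_ideal.induct)
    (simp_all only: finite_support_simps conv_left_pushforward(2) conv_right_pushforward(2) letters_pushforward(2)
      lie_ideal_finite_support)

lemma finite_support_wpart: "finite_support (wpart w f)"
  unfolding finite_support_def by (rule finite_subset[OF _ finite_admissible[of w]]) (auto simp: wpart_def)

lemma abs_sum: "abs_ext_lie (sum f A) = (\<Sum>x\<in>A. abs_ext_lie (f x))"
  by (induction A rule: infinite_finite_induct)
    (simp_all only: zero_ext_lie_def plus_ext_lie.abs_eq sum.infinite sum.empty sum.insert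
      not_False_eq_True, metis plus_ext_lie.abs_eq)

lemma abs_finite_support:
  assumes "finite_support h"
  shows "abs_ext_lie h = lin_extend monomial h"
proof -
  have "h y = (\<Sum>x | h x \<noteq> 0. h x * unitv x y)" for y
  proof -
    have "(\<Sum>x | h x \<noteq> 0. h x * unitv x y) = (\<Sum>x | h x \<noteq> 0. if x = y then h x else 0)"
      by (intro sum.cong) (auto simp: unitv_def)
    then show ?thesis using assms by (simp add: finite_support_def)
  qed
  then have "h = (\<Sum>x | h x \<noteq> 0. (\<lambda>y. h x * unitv x y))"
    by (intro ext, subst sum_apply)
  then have "abs_ext_lie h = abs_ext_lie (\<Sum>x | h x \<noteq> 0. (\<lambda>y. h x * unitv x y))"
    by (rule arg_cong)
  then show ?thesis
    by (simp add: abs_sum lin_extend_def monomial_def smul.abs_eq)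
qed

section \<open>Weight components of the two ideals\<close>

lemma lie_ideal_tpart:
  "f \<in> lie_ideal \<Longrightarrow> (\<lambda>t. if twt t = w \<and> set_ltree t \<subseteq> gbasis then f t else 0) \<in> lie_ideal"
proof (induction arbitrary: w rule: lie_ideal.induct)
  case zero
  have "(\<lambda>t::'a ltree. if twt t = w \<and> set_ltree t \<subseteq> gbasis then 0 t else 0) = (0 :: _ \<Rightarrow> 'b)"
    by auto
  then show ?case by (simp only: lie_ideal.zero)
next
  case (add f g)
  have "(\<lambda>t. if twt t = w \<and> set_ltree t \<subseteq> gbasis then (f + g) t else 0)
      = (\<lambda>t. if twt t = w \<and> set_ltree t \<subseteq> gbasis then f t else 0)
        + (\<lambda>t. if twt t = w \<and> set_ltree t \<subseteq> gbasis then g t else 0)"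
    by auto
  then show ?case by (simp only: lie_ideal.add add.IH)
next
  case (scale f c)
  have "(\<lambda>t. if twt t = w \<and> set_ltree t \<subseteq> gbasis then c * f t else 0)
      = (\<lambda>t. c * (if twt t = w \<and> set_ltree t \<subseteq> gbasis then f t else 0))"
    by auto
  then show ?case by (simp only: lie_ideal.scale scale.IH)
next
  case (antisym s t)
  let ?f = "unitv (Br s t) + sg (tdeg s * tdeg t) (unitv (Br t s)) :: 'a ltree \<Rightarrow> 'b"
  let ?P = "twt (Br s t) = w \<and> set_ltree (Br s t) \<subseteq> gbasis"
  have "(if twt x = w \<and> set_ltree x \<subseteq> gbasis then ?f x else 0) = (if ?P then 1 else 0) * ?f x" for x
  proof (cases "x \<in> {Br s t, Br t s}")
    case True
    then have "(twt x = w \<and> set_ltree x \<subseteq> gbasis) \<longleftrightarrow> ?P" by auto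
    then show ?thesis by simp
  next
    case False
    then have "?f x = 0" by (simp add: unitv_def sg_def)
    then show ?thesis by simp
  qed
  then show ?case by (simp only: lie_ideal.scale lie_ideal.antisym)
next
  case (jacobi s t u)
  let ?f = "unitv (Br s (Br t u)) - unitv (Br (Br s t) u)
             - sg (tdeg s * tdeg t) (unitv (Br t (Br s u))) :: 'a ltree \<Rightarrow> 'b"
  let ?P = "twt (Br s (Br t u)) = w \<and> set_ltree (Br s (Br t u)) \<subseteq> gbasis"
  have "(if twt x = w \<and> set_ltree x \<subseteq> gbasis then ?f x else 0) = (if ?P then 1 else 0) * ?f x" for x
  proof (cases "x \<in> {Br s (Br t u), Br (Br s t) u, Br t (Br s u)}")
    case True
    then have "(twt x = w \<and> set_ltree x \<subseteq> gbasis) \<longleftrightarrow> ?P" by auto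
    then show ?thesis by simp
  next
    case False
    then have "?f x = 0" by (simp add: unitv_def sg_def)
    then show ?thesis by simp
  qed
  then show ?case by (simp only: lie_ideal.scale lie_ideal.jacobi)
next
  case (left f t)
  let ?P = "twt t \<le> w \<and> set_ltree t \<subseteq> gbasis"
  have "(if twt x = w \<and> set_ltree x \<subseteq> gbasis then tmul (unitv t) f x else 0) = (if ?P then 1 else 0) *
      tmul (unitv t) (\<lambda>x. if twt x = w - twt t \<and> set_ltree x \<subseteq> gbasis then f x else 0) x" for x
    by (cases x) (auto simp: unitv_def)
  then show ?case by (simp only: lie_ideal.scale lie_ideal.left left.IH)
next
  case (right f t)
  let ?P = "twt t \<le> w \<and> set_ltree t \<subseteq> gbasis"
  have "(if twt x = w \<and> set_ltree x \<subseteq> gbasis then tmul f (unitv t) x else 0) = (if ?P then 1 else 0) *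
      tmul (\<lambda>x. if twt x = w - twt t \<and> set_ltree x \<subseteq> gbasis then f x else 0) (unitv t) x" for x
    by (cases x) (auto simp: unitv_def)
  then show ?case by (simp only: lie_ideal.scale lie_ideal.right right.IH)
qed

text \<open>Since \<open>eqv\<close> tests each weight separately, this homogeneity is what makes
  elements of the ideal represent zero. Selecting a weight multiplies the exchange relation by 0 or
  1, and splits a convolution into convolutions of parts.\<close>

lemma ext_ideal_wpart: "f \<in> ext_ideal \<Longrightarrow> wpart w f \<in> ext_ideal"
proof (induction arbitrary: w rule: ext_ideal.induct)
  case (lie f)
  have "wpart w (letters f)
      = letters (\<lambda>t. if twt t = w \<and> set_ltree t \<subseteq> gbasis then f t else 0)"
    by (auto simp: wpart_def letters_def mwt_def admissible_def fun_eq_iff split: list.split)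
  then show ?case
    by (simp only: ext_ideal.lie lie_ideal_tpart lie)
next
  case (comm s t)
  let ?f = "unitv [s, t] - sg ((tdeg s + 1) * (tdeg t + 1)) (unitv [t, s]) :: 'a ltree list \<Rightarrow> 'b"
  let ?P = "mwt [s, t] = w \<and> admissible [s, t]"
  have "wpart w ?f x = (if ?P then 1 else 0) * ?f x" for x
  proof (cases "x \<in> {[s, t], [t, s]}")
    case True
    then have "(mwt x = w \<and> admissible x) \<longleftrightarrow> ?P" by (auto simp: mwt_def admissible_def)
    then show ?thesis by (simp add: wpart_def)
  next
    case False
    then have "?f x = 0" by (simp add: unitv_def sg_def)
    then show ?thesis by (simp add: wpart_def)
  qed
  then have "wpart w ?f = (\<lambda>x. (if ?P then 1 else 0) * ?f x)" by blast
  then show ?case by (simp only: ext_ideal.scale ext_ideal.comm)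
next
  case (left f xs)
  then show ?case
    unfolding wpart_conv by (intro ext_ideal_sum conv_wpart_left)
next
  case (right f xs)
  then show ?case
    unfolding wpart_conv by (intro ext_ideal_sum conv_wpart_right)
qed (simp_all only: wpart_linear ext_ideal.intros)

lemma abs_ext_ideal: "f \<in> ext_ideal \<Longrightarrow> abs_ext_lie f = 0"
  by (simp add: zero_ext_lie_def ext_lie.abs_eq_iff eqv_def wpart_linear ext_ideal_wpart)

lemma lin_extend_lie_elem: "f \<in> lie_ideal \<Longrightarrow> lin_extend lie_elem f = 0"
  using abs_ext_ideal[OF ext_ideal.lie, of f] abs_finite_support[OF ext_ideal_finite_support[OF ext_ideal.lie], of f]
  by (simp add: letters_pushforward flip: lie_elem_monomial)

lemma lin_extend_ext_ideal:
  assumes comm: "\<And>xs ys s t.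
      u (xs @ [s, t] @ ys) = sg ((tdeg s + 1) * (tdeg t + 1)) (u (xs @ [t, s] @ ys))"
    and lie: "\<And>xs ys f. f \<in> lie_ideal \<Longrightarrow> lin_extend (\<lambda>t. u (xs @ [t] @ ys)) f = 0"
    and "f \<in> ext_ideal"
  shows "lin_extend u f = 0"
proof -
  \<comment> \<open>The rules \<open>left\<close> and \<open>right\<close> place the element in a
    longer context, so prefix and suffix must be general in the induction.\<close>
  have "lin_extend (\<lambda>zs. u (xs @ zs @ ys)) f = 0" for xs ys
    using assms(3)
  proof (induction arbitrary: xs ys rule: ext_ideal.induct)
    case (add f g)
    then show ?case by (simp only: lin_extend_add ext_ideal_finite_support add_0)
  next
    case (lie f)
    then show ?case using assms(2) by (simp add: letters_pushforward)
  next
    case (comm s t)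
    show ?case
      using assms(1)[of xs s t ys] by (simp add: lin_extend_diff lin_extend_sg del: minus_apply)
  next
    case (left f zs)
    then show ?case
      using left.IH[of "xs @ zs" ys] by (simp add: conv_left_pushforward)
  next
    case (right f zs)
    then show ?case
      using right.IH[of xs "zs @ ys"] by (simp add: conv_right_pushforward)
  qed (simp_all add: lin_extend_scale del: zero_fun_apply)
  from this[of "[]" "[]"] show ?thesis by simp
qed

section \<open>Continuous linear maps\<close>

text \<open>The notion \<open>operator\<close> is for endomorphisms; the map \<iota> goes from the
  algebra of A to that of A[\<epsilon>] and needs the same condition with two index types.\<close>

definition cont_linear ::
  "(('i::graded_basis, 'k::field) ext_lie \<Rightarrow> ('j::graded_basis, 'k) ext_lie) \<Rightarrow> bool" where
  "cont_linear T \<longleftrightarrow> (\<forall>x y. T (x + y) = T x + T y) \<and> (\<forall>c x. T (smul c x) = smul c (T x)) \<and>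
    (\<forall>p. \<exists>q. \<forall>x\<in>Fil q. T x \<in> Fil p)"

lemma operator_iff_cont_linear: "operator T \<longleftrightarrow> cont_linear T"
  by (simp add: operator_def cont_linear_def linear_smul_iff)

lemma cont_linear_add: "cont_linear T \<Longrightarrow> T (x + y) = T x + T y"
  and cont_linear_smul: "cont_linear T \<Longrightarrow> T (smul c x) = smul c (T x)"
  by (simp_all add: cont_linear_def)

lemma cont_linear_zero: "cont_linear T \<Longrightarrow> T 0 = 0"
  using cont_linear_smul[of T 0 0] by simp

lemma cont_linear_uminus: "cont_linear T \<Longrightarrow> T (- x) = - T x"
  using cont_linear_smul[of T "-1" x] by (simp add: smul_minus_one)

lemma cont_linear_diff: "cont_linear T \<Longrightarrow> T (x - y) = T x - T y"
  using cont_linear_add[of T x "- y"] by (simp add: cont_linear_uminus)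

lemma cont_linear_sg: "cont_linear T \<Longrightarrow> T (sg n x) = sg n (T x)"
  by (simp add: sg_def cont_linear_uminus)

lemmas cont_linear_simps = cont_linear_add cont_linear_smul cont_linear_zero cont_linear_uminus cont_linear_diff cont_linear_sg

lemma cont_linear_lin_extend: "cont_linear T \<Longrightarrow> T (lin_extend u h) = lin_extend (\<lambda>x. T (u x)) h"
  by (intro lin_extend_apply) (simp_all add: cont_linear_simps)

lemma cont_linearI:
  assumes "\<And>x y. T (x + y) = T x + T y" "\<And>c x. T (smul c x) = smul c (T x)"
    "\<And>p x. x \<in> Fil p \<Longrightarrow> T x \<in> Fil (p - c)"
  shows "cont_linear T"
  unfolding cont_linear_def using assms by (metis diff_add_inverse2)

named_theorems cont_linear_intros

lemma cont_linear_id [cont_linear_intros]: "cont_linear (\<lambda>x. x)"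
  by (rule cont_linearI[of _ 0]) auto

lemma cont_linear_const [cont_linear_intros]: "cont_linear (\<lambda>x. 0)"
  by (rule cont_linearI[of _ 0]) auto

lemma cont_linear_comp: "cont_linear T \<Longrightarrow> cont_linear S \<Longrightarrow> cont_linear (\<lambda>x. T (S x))"
  unfolding cont_linear_def by metis

lemma cont_linear_plus [cont_linear_intros]: "cont_linear T \<Longrightarrow> cont_linear S \<Longrightarrow> cont_linear (\<lambda>x. T x + S x)"
proof -
  assume "cont_linear T" "cont_linear S"
  moreover have "\<exists>q. \<forall>x\<in>Fil q. T x + S x \<in> Fil p" for p
  proof -
    obtain q r where "\<forall>x\<in>Fil q. T x \<in> Fil p" "\<forall>x\<in>Fil r. S x \<in> Fil p"
      using \<open>cont_linear T\<close> \<open>cont_linear S\<close> unfolding cont_linear_def by metis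
    then show ?thesis
      by (intro exI[of _ "max q r"]) (metis Fil_add Fil_mono max.cobounded1 max.cobounded2)
  qed
  ultimately show ?thesis
    unfolding cont_linear_def by (simp add: algebra_simps)
qed

lemma cont_linear_negative [cont_linear_intros]: "cont_linear T \<Longrightarrow> cont_linear (\<lambda>x. - T x)"
  by (rule cont_linear_comp[of uminus]) (auto intro!: cont_linearI[of _ 0] Fil_uminus)

lemma cont_linear_minus [cont_linear_intros]: "cont_linear T \<Longrightarrow> cont_linear S \<Longrightarrow> cont_linear (\<lambda>x. T x - S x)"
  using cont_linear_plus[OF _ cont_linear_negative, of T S] by simp

lemma cont_linear_signed [cont_linear_intros]: "cont_linear T \<Longrightarrow> cont_linear (\<lambda>x. sg n (T x))"
  by (cases "even n") (auto simp: sg_def cont_linear_negative)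

lemma cont_linear_mult_left [cont_linear_intros]: "cont_linear T \<Longrightarrow> cont_linear (\<lambda>x. y * T x)"
  by (rule cont_linear_comp[of "\<lambda>x. y * x"])
    (auto intro!: cont_linearI[of _ 0] Fil_times_right simp: algebra_simps)

lemma cont_linear_mult_right [cont_linear_intros]: "cont_linear T \<Longrightarrow> cont_linear (\<lambda>x. T x * y)"
  by (rule cont_linear_comp[of "\<lambda>x. x * y"])
    (auto intro!: cont_linearI[of _ 0] Fil_times_left simp: algebra_simps)

lemma Fil_parity: "x \<in> Fil p \<Longrightarrow> parity x \<in> Fil p"
  unfolding Fil_def by (force simp: parity.abs_eq)

lemma parity_add: "parity (x + y) = parity x + parity y"
  by (cases x rule: abs_exhaust; cases y rule: abs_exhaust)
    (auto simp: plus_ext_lie.abs_eq parity.abs_eq sg_add intro!: arg_cong[of _ _ abs_ext_lie])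

lemma parity_smul: "parity (smul c x) = smul c (parity x)"
  by (cases x rule: abs_exhaust)
    (auto simp: smul.abs_eq parity.abs_eq sg_def intro!: arg_cong[of _ _ abs_ext_lie])

lemma cont_linear_parity' [cont_linear_intros]: "cont_linear parity"
  by (rule cont_linearI[of _ 0]) (auto simp: parity_add parity_smul Fil_parity)

lemma cont_linear_parity [cont_linear_intros]: "cont_linear T \<Longrightarrow> cont_linear (\<lambda>x. parity (T x))"
  by (rule cont_linear_comp[OF cont_linear_parity'])

lemma parity_gr: "x \<in> gr n \<Longrightarrow> parity x = sg n x"
proof -
  assume "x \<in> gr n"
  then obtain f where f: "x = abs_ext_lie f" "\<forall>xs. mdeg xs \<noteq> n \<longrightarrow> f xs = 0"
    by (auto simp: gr_def)
  have "(\<lambda>xs. sg (mdeg xs) (f xs)) = sg n f"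
  proof
    fix xs show "sg (mdeg xs) (f xs) = sg n f xs"
      using f(2) by (cases "mdeg xs = n") (auto simp: sg_def)
  qed
  then have "parity x = abs_ext_lie (sg n f)"
    by (simp add: f parity.abs_eq)
  then show ?thesis
    by (simp add: f sg_def uminus_ext_lie.abs_eq)
qed

text \<open>Closedness is expressed by approximation modulo every \<open>Fil p\<close>. Equalizers
  of continuous linear maps and preimages of \<open>gr n\<close> and \<open>Fil n\<close> are of
  this kind, so extending a statement from monomials becomes a membership question.\<close>

definition closed_subspace :: "('i::graded_basis, 'k::field) ext_lie set \<Rightarrow> bool" where
  "closed_subspace S \<longleftrightarrow> 0 \<in> S \<and> (\<forall>x\<in>S. \<forall>y\<in>S. x + y \<in> S) \<and> (\<forall>c. \<forall>x\<in>S. smul c x \<in> S) \<and>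
    (\<forall>x. (\<forall>p. \<exists>y\<in>S. x - y \<in> Fil p) \<longrightarrow> x \<in> S)"

lemma closed_subspace_eq:
  assumes "cont_linear T" "cont_linear T'"
  shows "closed_subspace {x. T x = T' x}"
proof -
  have "T x = T' x" if x: "\<forall>p. \<exists>y\<in>{x. T x = T' x}. x - y \<in> Fil p" for x
  proof -
    have "T x - T' x \<in> Fil p" for p
    proof -
      obtain q where q: "\<forall>x\<in>Fil q. T x - T' x \<in> Fil p"
        using cont_linear_minus[OF assms] unfolding cont_linear_def by blast
      obtain y where y: "T y = T' y" "x - y \<in> Fil q" using x by auto
      have "T x - T' x = T (x - y) - T' (x - y)"
        using y(1) by (simp add: cont_linear_simps assms)
      then show ?thesis using q y(2) by simp
    qed
    then show ?thesis using Fil_Inter_zero[of "T x - T' x"] by simp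
  qed
  then show ?thesis
    unfolding closed_subspace_def by (auto simp: cont_linear_simps assms)
qed

lemma closed_subspace_gr:
  assumes "cont_linear T"
  shows "closed_subspace {x. T x \<in> gr n}"
proof -
  have "T x \<in> gr n" if x: "\<forall>p. \<exists>y\<in>{x. T x \<in> gr n}. x - y \<in> Fil p" for x
  proof (rule gr_closed)
    fix p
    obtain q where q: "\<forall>x\<in>Fil q. T x \<in> Fil p"
      using assms unfolding cont_linear_def by blast
    obtain y where y: "T y \<in> gr n" "x - y \<in> Fil q" using x by auto
    have "T x - T y = T (x - y)"
      by (simp add: cont_linear_simps assms)
    then show "\<exists>y\<in>gr n. T x - y \<in> Fil p" using q y by metis
  qed
  then show ?thesis
    unfolding closed_subspace_def by (auto simp: cont_linear_simps assms gr_add gr_smul)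
qed

lemma closed_subspace_Fil:
  assumes "cont_linear T"
  shows "closed_subspace {x. T x \<in> Fil n}"
proof -
  have "T x \<in> Fil n" if x: "\<forall>p. \<exists>y\<in>{x. T x \<in> Fil n}. x - y \<in> Fil p" for x
  proof -
    obtain q where q: "\<forall>x\<in>Fil q. T x \<in> Fil n"
      using assms unfolding cont_linear_def by blast
    obtain y where y: "T y \<in> Fil n" "x - y \<in> Fil q" using x by auto
    have "T x = T y + T (x - y)"
      by (simp add: cont_linear_simps assms)
    then show "T x \<in> Fil n" using q y by (simp add: Fil_add)
  qed
  then show ?thesis
    unfolding closed_subspace_def by (auto simp: cont_linear_simps assms Fil_add Fil_smul)
qed

lemma closed_subspace_sum: "closed_subspace S \<Longrightarrow> (\<And>x. x \<in> A \<Longrightarrow> f x \<in> S) \<Longrightarrow> sum f A \<in> S"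
  by (induction A rule: infinite_finite_induct) (auto simp: closed_subspace_def)

lemma closed_subspace_smul: "closed_subspace S \<Longrightarrow> x \<in> S \<Longrightarrow> smul c x \<in> S"
  by (auto simp: closed_subspace_def)

lemma closed_subspace_lin_extend: "closed_subspace S \<Longrightarrow> (\<And>x. h x \<noteq> 0 \<Longrightarrow> u x \<in> S) \<Longrightarrow> lin_extend u h \<in> S"
  unfolding lin_extend_def by (intro closed_subspace_sum closed_subspace_smul) auto

section \<open>Truncation and maps out of the completion\<close>

definition trunc :: "nat \<Rightarrow> ('i::graded_basis ltree list \<Rightarrow> 'k::field) \<Rightarrow> 'i ltree list \<Rightarrow> 'k" where
  "trunc p f xs = (if mwt xs < p \<and> admissible xs then f xs else 0)"

lemma wpart_trunc: "wpart w (trunc p f) = (if w < p then wpart w f else 0)"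
  by (auto simp: wpart_def trunc_def fun_eq_iff)

lemma trunc_Suc: "trunc (Suc p) f = trunc p f + wpart p f"
  by (auto simp: wpart_def trunc_def fun_eq_iff)

lemma trunc_0: "trunc 0 f = 0"
  by (auto simp: trunc_def)

lemma trunc_linear:
  "trunc p (f + g) = trunc p f + trunc p g" "trunc p (f - g) = trunc p f - trunc p g"
  "trunc p (\<lambda>xs. c * f xs) = (\<lambda>xs. c * trunc p f xs)"
  by (auto simp: trunc_def fun_eq_iff)

lemma finite_support_trunc: "finite_support (trunc p f)"
  by (induction p) (simp_all only: trunc_0 trunc_Suc finite_support_simps finite_support_wpart)

lemma trunc_ext_ideal: "(\<And>w. w < p \<Longrightarrow> wpart w f \<in> ext_ideal) \<Longrightarrow> trunc p f \<in> ext_ideal"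
  by (induction p) (simp_all add: trunc_0 trunc_Suc ext_ideal.intros del: zero_fun_apply plus_fun_apply)

lemma abs_trunc: "abs_ext_lie f - abs_ext_lie (trunc p f) \<in> Fil p"
  by (simp add: minus_ext_lie.abs_eq Fil_iff wpart_linear wpart_trunc ext_ideal.zero)

text \<open>Truncations of f are finite combinations of monomials from its support and converge to
  its class. Restricting the hypothesis to the support makes the argument apply inside
  \<open>gr n\<close> and \<open>Fil p\<close> as well.\<close>

lemma abs_in_closed_subspace:
  assumes "closed_subspace S" "\<And>xs. f xs \<noteq> 0 \<Longrightarrow> monomial xs \<in> S"
  shows "abs_ext_lie f \<in> S"
proof -
  have "abs_ext_lie (trunc p f) \<in> S" for p
    unfolding abs_finite_support[OF finite_support_trunc]
    by (rule closed_subspace_lin_extend) (use assms in \<open>auto simp: trunc_def split: if_splits\<close>)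
  then show ?thesis
    using assms(1) abs_trunc[of f] unfolding closed_subspace_def by blast
qed

lemma monomial_induct:
  assumes "closed_subspace S" "\<And>xs. monomial xs \<in> S"
  shows "x \<in> S"
  by (cases x rule: abs_exhaust) (simp add: assms abs_in_closed_subspace)

lemma gr_induct:
  assumes "closed_subspace S" "\<And>xs. mdeg xs = n \<Longrightarrow> monomial xs \<in> S" "x \<in> gr n"
  shows "x \<in> S"
  using assms by (auto simp: gr_def intro!: abs_in_closed_subspace)

text \<open>By \<open>comm\<close> and \<open>lie\<close> the linear extension of u kills the ideal,
  so its values on truncations depend only on the class. As u loses at most c in weight, these
  values form a Cauchy sequence, and the image is their limit.\<close>

lemma linear_extension:
  fixes u :: "'i::graded_basis ltree list \<Rightarrow> ('j::graded_basis, 'k::field) ext_lie"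
  assumes comm: "\<And>xs ys s t.
      u (xs @ [s, t] @ ys) = sg ((tdeg s + 1) * (tdeg t + 1)) (u (xs @ [t, s] @ ys))"
    and lie: "\<And>xs ys f. f \<in> lie_ideal \<Longrightarrow> lin_extend (\<lambda>t. u (xs @ [t] @ ys)) f = 0"
    and adm: "\<And>xs. \<not> admissible xs \<Longrightarrow> u xs = 0"
    and fil: "\<And>xs. u xs \<in> Fil (mwt xs - c)"
  shows "\<exists>T. cont_linear T \<and> (\<forall>p. \<forall>x\<in>Fil p. T x \<in> Fil (p - c)) \<and> (\<forall>xs. T (monomial xs) = u xs)"
proof -
  define G where "G p f = lin_extend u (trunc p f)" for p f
  have kill: "lin_extend u f = 0" if "f \<in> ext_ideal" for f
    using lin_extend_ext_ideal[of u] comm lie that by blast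
  have G_lin: "G p (f + g) = G p f + G p g" "G p (f - g) = G p f - G p g"
      "G p (\<lambda>xs. a * f xs) = smul a (G p f)" for p f g a
    by (simp_all only: G_def trunc_linear lin_extend_add lin_extend_diff lin_extend_scale finite_support_trunc)
  have G_kill: "G p f = 0" if "\<And>w. w < p \<Longrightarrow> wpart w f \<in> ext_ideal" for p f
    unfolding G_def using that by (intro kill trunc_ext_ideal)
  have G_eqv: "G p f = G p g" if "eqv f g" for p f g
    using G_kill[of p "f - g"] that unfolding eqv_def G_lin by auto
  \<comment> \<open>The truncation goes c steps beyond the accuracy p, because terms of weight at
    least p + c are sent into \<open>Fil p\<close>.\<close>
  define val where "val f y \<longleftrightarrow> (\<forall>p. y - G (p + c) f \<in> Fil p)" for f y
  have val_ex: "\<exists>y. val f y" for f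
    unfolding val_def
  proof (rule Fil_complete)
    fix p
    have "G (Suc p + c) f - G (p + c) f = lin_extend u (wpart (p + c) f)"
      by (simp add: G_def trunc_Suc lin_extend_add finite_support_trunc finite_support_wpart)
    also have "\<dots> \<in> Fil p"
    proof -
      have "u xs \<in> Fil p" if "wpart (p + c) f xs \<noteq> 0" for xs
        using that fil[of xs] by (auto simp: wpart_def split: if_splits)
      then show ?thesis
        using closed_subspace_lin_extend[OF closed_subspace_Fil[OF cont_linear_id], of "wpart (p + c) f" u] by simp
    qed
    finally show "G (Suc p + c) f - G (p + c) f \<in> Fil p" .
  qed
  have val_unique: "y = z" if "val f y" "val f z" for f y z
  proof -
    have "y - z \<in> Fil p" for p
      using Fil_diff[of "y - G (p + c) f" p "z - G (p + c) f"] that unfolding val_def by simp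
    then show ?thesis using Fil_Inter_zero[of "y - z"] by simp
  qed
  \<comment> \<open>The choice of the representative is harmless: \<open>G_eqv\<close> transfers the
    limit property to every other representative.\<close>
  define T where "T x = (SOME y. val (rep_ext_lie x) y)" for x
  have T: "val f (T (abs_ext_lie f))" for f
  proof -
    have "val (rep_ext_lie (abs_ext_lie f)) (T (abs_ext_lie f))"
      unfolding T_def using val_ex by (rule someI_ex)
    moreover have "eqv (rep_ext_lie (abs_ext_lie f)) f"
      using Quotient3_ext_lie by (metis Quotient3_abs_rep ext_lie.abs_eq_iff)
    ultimately show ?thesis
      using G_eqv by (simp add: val_def)
  qed
  have T_eq: "T (abs_ext_lie f) = y" if "val f y" for f y
    using val_unique[OF T that] .
  have "T (x + y) = T x + T y" for x y
  proof (cases x rule: abs_exhaust, cases y rule: abs_exhaust)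
    fix f g assume "x = abs_ext_lie f" "y = abs_ext_lie g"
    moreover have "val (f + g) (T (abs_ext_lie f) + T (abs_ext_lie g))"
      using T unfolding val_def G_lin by (metis Fil_add add_diff_add)
    ultimately show ?thesis by (simp only: plus_ext_lie.abs_eq T_eq)
  qed
  moreover have "T (smul a x) = smul a (T x)" for a x
  proof (cases x rule: abs_exhaust)
    fix f assume "x = abs_ext_lie f"
    moreover have "val (\<lambda>xs. a * f xs) (smul a (T (abs_ext_lie f)))"
      using Fil_smul[of "T (abs_ext_lie f) - G (_ + c) f" _ a] T unfolding val_def G_lin by simp
    ultimately show ?thesis by (simp only: smul.abs_eq T_eq)
  qed
  moreover have fil: "T x \<in> Fil (p - c)" if "x \<in> Fil p" for p x
  proof (cases x rule: abs_exhaust)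
    case (1 f)
    show ?thesis
    proof (cases "c \<le> p")
      case True
      then have "G (p - c + c) f = 0"
        using that by (intro G_kill) (simp add: 1 Fil_iff)
      then show ?thesis using T[of f] unfolding val_def 1 by (metis diff_zero)
    qed simp
  qed
  moreover have "T (monomial xs) = u xs" for xs
  proof -
    have "G p (unitv xs) = (if mwt xs < p then u xs else 0)" for p
    proof (cases "mwt xs < p \<and> admissible xs")
      case True
      then have "trunc p (unitv xs) = (unitv xs :: 'i ltree list \<Rightarrow> 'k)"
        by (auto simp: trunc_def unitv_def fun_eq_iff)
      then show ?thesis using True by (simp add: G_def)
    next
      case False
      then have "trunc p (unitv xs) = (0 :: 'i ltree list \<Rightarrow> 'k)"
        by (auto simp: trunc_def unitv_def fun_eq_iff)
      then show ?thesis using False adm by (auto simp: G_def)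
    qed
    then have "val (unitv xs) (u xs)"
      using assms(4)[of xs] by (auto simp: val_def intro: Fil_mono)
    then show ?thesis by (simp add: monomial_def T_eq)
  qed
  ultimately show ?thesis
    by (intro exI[of _ T]) (auto intro: cont_linearI[where c = c])
qed

section \<open>Graded commutativity and derivations of the product\<close>

lemma sg_sg [simp]: "sg m (sg n x) = sg (m + n) (x :: 'a::group_add)"
  by (auto simp: sg_def)

lemma sg_mult [simp]:
  "sg n x * y = sg n (x * y)" "x * sg n y = sg n (x * y)" for x y :: "'a::ring"
  by (auto simp: sg_def)

lemma sg_cong: "even (m - n) \<Longrightarrow> sg m x = sg n x"
  by (auto simp: sg_def)

lemma mdeg_simps [simp]: "mdeg [] = 0" "mdeg (t # xs) = tdeg t + 1 + mdeg xs"
  by (simp_all add: mdeg_def)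

lemma mwt_simps [simp]: "mwt [] = 0" "mwt (t # xs) = twt t + mwt xs"
  by (simp_all add: mwt_def)

lemma admissible_Cons: "admissible (t # xs) \<longleftrightarrow> set_ltree t \<subseteq> gbasis \<and> admissible xs"
  by (auto simp: admissible_def)

lemma admissible_Nil: "admissible []"
  by (simp add: admissible_def)

lemma lie_elem_zero: "\<not> set_ltree t \<subseteq> gbasis \<Longrightarrow> lie_elem t = 0"
  by (simp add: lie_elem_monomial monomial_nonadmissible admissible_Cons)

text \<open>A closure argument handles one variable, so the left factor is kept a monomial while the
  right one becomes general, and is then released itself. The two-variable statements below mostly
  follow this pattern.\<close>

lemma gr_times:
  assumes "x \<in> gr m" "y \<in> gr n"
  shows "x * y \<in> gr (m + n)"
proof -
  have "y \<in> {y. monomial xs * y \<in> gr (mdeg xs + n)}" for xs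
    by (rule gr_induct[OF closed_subspace_gr _ assms(2)])
      (auto intro!: cont_linear_intros simp flip: monomial_append mdeg_append intro: monomial_gr)
  note base = this
  have "x \<in> {x. x * y \<in> gr (m + n)}"
    by (rule gr_induct[OF closed_subspace_gr _ assms(1)]) (auto simp: base[simplified] intro!: cont_linear_intros)
  then show ?thesis by simp
qed

lemma lie_elem_swap:
  "lie_elem s * lie_elem t = sg ((tdeg s + 1) * (tdeg t + 1)) (lie_elem t * lie_elem s)"
proof -
  let ?f = "unitv [s, t] - sg ((tdeg s + 1) * (tdeg t + 1)) (unitv [t, s]) :: 'a ltree list \<Rightarrow> 'b"
  have "?f \<in> ext_ideal"
    by (rule ext_ideal.comm)
  then have "lin_extend monomial ?f = 0"
    by (metis abs_ext_ideal abs_finite_support ext_ideal_finite_support)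
  then show ?thesis
    by (simp add: lin_extend_diff lin_extend_sg monomial_Cons monomial_Nil del: minus_apply)
qed

lemma lie_elem_monomial_swap:
  "lie_elem s * monomial ys
    = sg ((tdeg s + 1) * mdeg ys) (monomial ys * lie_elem s :: ('i::graded_basis, 'k::field) ext_lie)"
proof (induction ys)
  case (Cons t ys)
  have "lie_elem s * (monomial (t # ys) :: ('i, 'k) ext_lie) = (lie_elem s * lie_elem t) * monomial ys"
    by (simp add: monomial_Cons mult.assoc)
  also have "\<dots> = sg ((tdeg s + 1) * (tdeg t + 1)) (lie_elem t * (lie_elem s * monomial ys))"
    by (simp add: lie_elem_swap[of s t] mult.assoc)
  finally show ?case
    by (simp add: Cons.IH monomial_Cons mult.assoc algebra_simps)
qed (simp add: monomial_Nil)

lemma monomial_swap: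
  "monomial xs * monomial ys = sg (mdeg xs * mdeg ys) (monomial ys * monomial xs :: ('i::graded_basis, 'k::field) ext_lie)"
proof (induction xs)
  case (Cons s xs)
  have "monomial (s # xs) * (monomial ys :: ('i, 'k) ext_lie) = lie_elem s * (monomial xs * monomial ys)"
    by (simp add: monomial_Cons mult.assoc)
  also have "\<dots> = sg (mdeg xs * mdeg ys) ((lie_elem s * monomial ys) * monomial xs)"
    by (simp only: Cons.IH sg_mult mult.assoc)
  also have "\<dots> = sg (mdeg (s # xs) * mdeg ys) (monomial ys * monomial (s # xs))"
    by (simp add: lie_elem_monomial_swap) (simp add: monomial_Cons mult.assoc algebra_simps)
  finally show ?case .
qed (simp add: monomial_Nil)

lemma graded_commute:
  assumes "x \<in> gr m" "y \<in> gr n"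
  shows "x * y = sg (m * n) (y * x)"
proof -
  have "y \<in> {y. monomial xs * y = sg (mdeg xs * n) (y * monomial xs)}" for xs
    by (rule gr_induct[OF closed_subspace_eq _ assms(2)]) (auto intro!: cont_linear_intros monomial_swap)
  note base = this
  have "x \<in> {x. x * y = sg (m * n) (y * x)}"
    by (rule gr_induct[OF closed_subspace_eq _ assms(1)]) (auto simp: base[simplified] intro!: cont_linear_intros)
  then show ?thesis by simp
qed

text \<open>The relations are homogeneous modulo 2, so signs depending on the parity of a tree
  preserve the ideal. This absorbs the signs that appear when one factor of a product varies along a
  relation.\<close>

lemma lie_ideal_sign': "f \<in> lie_ideal \<Longrightarrow> (\<lambda>t. sg (a * tdeg t + b) (f t)) \<in> lie_ideal"
proof -
  assume f: "f \<in> lie_ideal"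
  have "(\<lambda>t. sg (a * tdeg t + b) (f t))
      = (\<lambda>t. sg b 1 * (if even a then f else (\<lambda>t. sg (tdeg t) (f t))) t)"
    by (auto simp: sg_def)
  also have "\<dots> \<in> lie_ideal"
    using f by (intro lie_ideal.scale) (simp add: lie_ideal_sign)
  finally show ?thesis .
qed

lemma lin_extend_lie_elem_times:
  "f \<in> lie_ideal \<Longrightarrow> lin_extend (\<lambda>t. sg (a * tdeg t + b) (x * lie_elem t * y)) f = 0"
  by (simp only: lin_extend_fun_sg flip: lin_extend_times) (simp add: lin_extend_lie_elem lie_ideal_sign')

text \<open>The bracket rule is left out: such maps serve to construct the bracket itself, and later
  form the first stage of derivations of both operations.\<close>

definition product_derivation ::
  "int \<Rightarrow> (('i::graded_basis, 'k::field) ext_lie \<Rightarrow> ('i, 'k) ext_lie) \<Rightarrow> bool" where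
  "product_derivation d T \<longleftrightarrow> cont_linear T \<and> (\<forall>n. \<forall>x\<in>gr n. T x \<in> gr (n + d)) \<and>
     (\<forall>m. \<forall>a\<in>gr m. \<forall>b. T (a * b) = T a * b + sg (d * m) (a * T b))"

lemma product_derivationD:
  assumes "product_derivation d T"
  shows "cont_linear T" "x \<in> gr n \<Longrightarrow> T x \<in> gr (n + d)"
    "a \<in> gr m \<Longrightarrow> T (a * b) = T a * b + sg (d * m) (a * T b)" "T 1 = 0"
proof -
  show *: "cont_linear T" "x \<in> gr n \<Longrightarrow> T x \<in> gr (n + d)"
      "a \<in> gr m \<Longrightarrow> T (a * b) = T a * b + sg (d * m) (a * T b)" for x n a b m
    using assms by (auto simp: product_derivation_def)
  show "T 1 = 0"
    using *(3)[OF one_gr, of 1] by simp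
qed

lemma product_derivation_monomial_Cons:
  "product_derivation d T \<Longrightarrow>
    T (monomial (t # xs)) = T (lie_elem t) * monomial xs + sg (d * (tdeg t + 1)) (lie_elem t * T (monomial xs))"
  by (simp add: monomial_Cons product_derivationD(3)[OF _ lie_elem_gr])

lemma product_derivation_eqI:
  assumes "product_derivation d T" "product_derivation d T'"
    and "\<And>t. T (lie_elem t) = T' (lie_elem t)"
  shows "T x = T' x"
proof -
  have "T (monomial xs) = T' (monomial xs)" for xs
    by (induction xs) (simp_all add: monomial_Nil assms product_derivationD(4)[OF assms(1)]
        product_derivationD(4)[OF assms(2)] product_derivation_monomial_Cons[OF assms(1)]
        product_derivation_monomial_Cons[OF assms(2)])
  note base = this
  have "x \<in> {x. T x = T' x}"
    by (rule monomial_induct[OF closed_subspace_eq[OF assms(1,2)[THEN product_derivationD(1)]]]) (auto simp: base)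

  then show ?thesis by simp
qed

primrec leibniz_list :: "int \<Rightarrow> ('i ltree \<Rightarrow> ('i::graded_basis, 'k::field) ext_lie) \<Rightarrow> 'i ltree list \<Rightarrow> ('i, 'k) ext_lie" where
  "leibniz_list d v [] = 0"
| "leibniz_list d v (t # xs) = v t * monomial xs + sg (d * (tdeg t + 1)) (lie_elem t * leibniz_list d v xs)"

lemma leibniz_list_append:
  "leibniz_list d v (xs @ ys) = leibniz_list d v xs * monomial ys + sg (d * mdeg xs) (monomial xs * leibniz_list d v ys)"
  by (induction xs) (simp_all add: monomial_Nil monomial_Cons monomial_append mdeg_append sg_add algebra_simps)

text \<open>Freeness of the graded symmetric algebra: values on trees that respect the Lie relations
  spread over products by the Leibniz rule, and compatibility with exchanging factors is graded
  commutativity of a value with a tree. The constant c bounds the loss of weight.\<close>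

lemma product_derivation_exists:
  fixes v :: "'i ltree \<Rightarrow> ('i::graded_basis, 'k::field) ext_lie"
  assumes gr: "\<And>t. v t \<in> gr (tdeg t + 1 + d)"
    and fil: "\<And>t. v t \<in> Fil (twt t - c)"
    and adm: "\<And>t. \<not> set_ltree t \<subseteq> gbasis \<Longrightarrow> v t = 0"
    and kill: "\<And>f. f \<in> lie_ideal \<Longrightarrow> lin_extend v f = 0"
  shows "\<exists>T. product_derivation d T \<and> (\<forall>p. \<forall>x\<in>Fil p. T x \<in> Fil (p - c)) \<and>
    (\<forall>t. T (lie_elem t) = v t)"
proof -
  \<comment> \<open>Two letters suffice, since \<open>leibniz_list_append\<close> carries the
    exchange into any context.\<close>
  have swap: "leibniz_list d v [s, t] = sg ((tdeg s + 1) * (tdeg t + 1)) (leibniz_list d v [t, s])" for s t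
    using graded_commute[OF gr[of s] lie_elem_gr[of t]] graded_commute[OF lie_elem_gr[of s] gr[of t]]
    by (cases "even (tdeg s)"; cases "even (tdeg t)"; cases "even d")
      (simp_all add: monomial_Nil monomial_Cons sg_def)
  have "\<exists>T. cont_linear T \<and> (\<forall>p. \<forall>x\<in>Fil p. T x \<in> Fil (p - c)) \<and> (\<forall>xs. T (monomial xs) = leibniz_list d v xs)"
  proof (rule linear_extension)
    show "leibniz_list d v (xs @ [s, t] @ ys)
        = sg ((tdeg s + 1) * (tdeg t + 1)) (leibniz_list d v (xs @ [t, s] @ ys))" for xs ys s t
    proof -
      have "monomial [s, t] = sg ((tdeg s + 1) * (tdeg t + 1)) (monomial [t, s] :: ('i, 'k) ext_lie)"
        using lie_elem_swap[of s t] by (simp add: monomial_Cons monomial_Nil)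
      then show ?thesis
        unfolding leibniz_list_append[of _ _ xs] leibniz_list_append[of _ _ "[_, _]"] monomial_append swap[of s t]
        by (simp add: sg_add algebra_simps del: leibniz_list.simps)
    qed
  next
    fix xs ys and f :: "'i ltree \<Rightarrow> 'k"
    assume f: "f \<in> lie_ideal"
    have "leibniz_list d v (xs @ [t] @ ys) = leibniz_list d v xs * lie_elem t * monomial ys
        + (sg (d * mdeg xs) (monomial xs * (v t * monomial ys))
        + sg (d * tdeg t + (d * mdeg xs + d)) (monomial xs * lie_elem t * leibniz_list d v ys))" for t
      by (simp add: leibniz_list_append monomial_Cons monomial_Nil sg_add algebra_simps)
    moreover have "lin_extend (\<lambda>t. leibniz_list d v xs * lie_elem t * monomial ys) f = 0"
      using lin_extend_lie_elem_times[OF f, of 0 0] by simp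
    moreover have "lin_extend (\<lambda>t. sg (d * mdeg xs) (monomial xs * (v t * monomial ys))) f = 0"
    proof -
      have "lin_extend (\<lambda>t. sg (d * mdeg xs) (monomial xs * (v t * monomial ys))) f
          = sg (d * mdeg xs) (monomial xs * (lin_extend v f * monomial ys))"
        by (subst cont_linear_lin_extend[of "\<lambda>x. sg (d * mdeg xs) (monomial xs * (x * monomial ys))"])
          (auto intro!: cont_linear_intros)
      then show ?thesis by (simp add: kill[OF f])
    qed
    ultimately show "lin_extend (\<lambda>t. leibniz_list d v (xs @ [t] @ ys)) f = 0"
      by (simp add: lin_extend_fun_add lin_extend_lie_elem_times[OF f])
  next
    show "leibniz_list d v xs = 0" if "\<not> admissible xs" for xs
      using that
    proof (induction xs)
      case (Cons t xs)
      then show ?case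
        by (cases "set_ltree t \<subseteq> gbasis")
          (simp_all add: admissible_Cons adm lie_elem_zero monomial_nonadmissible)
    qed (simp add: admissible_Nil)
    show "leibniz_list d v xs \<in> Fil (mwt xs - c)" for xs
    proof (induction xs)
      case (Cons t xs)
      have "v t * monomial xs \<in> Fil (twt t - c + mwt xs)"
        by (intro Fil_times fil monomial_Fil)
      moreover have "lie_elem t * leibniz_list d v xs \<in> Fil (twt t + (mwt xs - c))"
        by (intro Fil_times lie_elem_Fil Cons.IH)
      ultimately show ?case
        by (auto intro!: Fil_add Fil_sg elim!: Fil_mono)
    qed simp
  qed
  then obtain T where T: "cont_linear T" "\<And>p x. x \<in> Fil p \<Longrightarrow> T x \<in> Fil (p - c)"
      "\<And>xs. T (monomial xs) = leibniz_list d v xs"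
    by blast
  have "T x \<in> gr (n + d)" if "x \<in> gr n" for x n
  proof -
    have "leibniz_list d v xs \<in> gr (mdeg xs + d)" for xs
    proof (induction xs)
      case (Cons t xs)
      have "v t * monomial xs \<in> gr (mdeg (t # xs) + d)"
        using gr_times[OF gr[of t] monomial_gr[of xs]] by (simp add: algebra_simps)
      moreover have "lie_elem t * leibniz_list d v xs \<in> gr (mdeg (t # xs) + d)"
        using gr_times[OF lie_elem_gr[of t] Cons.IH] by (simp add: algebra_simps)
      ultimately show ?case by (simp add: gr_add gr_sg)
    qed simp
    note base = this
    have "x \<in> {x. T x \<in> gr (n + d)}"
      by (rule gr_induct[OF closed_subspace_gr[OF T(1)] _ that]) (auto simp: T(3) base)
    then show ?thesis by simp
  qed
  moreover have "T (a * b) = T a * b + sg (d * m) (a * T b)" if "a \<in> gr m" for a b m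
  proof -
    note [cont_linear_intros] = cont_linear_comp[OF T(1)]
    have "a \<in> {a. T (a * monomial ys) = T a * monomial ys + sg (d * m) (a * T (monomial ys))}" for ys
      by (rule gr_induct[OF closed_subspace_eq _ that])
        (auto intro!: cont_linear_intros simp: T(3) leibniz_list_append simp flip: monomial_append)
    note base = this
    have "b \<in> {b. T (a * b) = T a * b + sg (d * m) (a * T b)}"
      by (rule monomial_induct[OF closed_subspace_eq]) (auto simp: base[simplified] intro!: cont_linear_intros)
    then show ?thesis by simp
  qed
  moreover have "T (lie_elem t) = v t" for t
    by (simp add: lie_elem_monomial T(3) monomial_Nil)
  ultimately show ?thesis
    using T(1,2) unfolding product_derivation_def by blast
qed

section \<open>The chain differential\<close>

lemma lie_elem_relations:
  "lie_elem (Br s t) = - sg (tdeg s * tdeg t) (lie_elem (Br t s))"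
  "lie_elem (Br s (Br t u)) = lie_elem (Br (Br s t) u)
    + sg (tdeg s * tdeg t) (lie_elem (Br t (Br s u)))"
proof -
  show "lie_elem (Br s t) = - sg (tdeg s * tdeg t) (lie_elem (Br t s))"
    using lin_extend_lie_elem[OF lie_ideal.antisym[of s t]]
    by (simp add: lin_extend_add lin_extend_sg eq_neg_iff_add_eq_0 del: plus_fun_apply)
  show "lie_elem (Br s (Br t u)) = lie_elem (Br (Br s t) u)
    + sg (tdeg s * tdeg t) (lie_elem (Br t (Br s u)))"
    using lin_extend_lie_elem[OF lie_ideal.jacobi[of s t u]]
    by (simp add: lin_extend_diff lin_extend_sg del: minus_apply) (simp add: algebra_simps)
qed

lemma lin_extend_lie_elem_Br:
  "f \<in> lie_ideal \<Longrightarrow> lin_extend (\<lambda>t. lie_elem (Br s t)) f = 0"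
  "f \<in> lie_ideal \<Longrightarrow> lin_extend (\<lambda>t. lie_elem (Br t s)) f = 0"
  using lin_extend_lie_elem[OF lie_ideal.left, of f s] lin_extend_lie_elem[OF lie_ideal.right, of f s]
  by (simp_all add: tmul_left_pushforward tmul_right_pushforward)

text \<open>The adjoint action on the exterior algebra. Its degree is \<open>tdeg s\<close>: the
  shift raises the degree of s by one and the bracket lowers it by one.\<close>

definition lie_ad :: "'i::graded_basis ltree \<Rightarrow> ('i, 'k::field) ext_lie \<Rightarrow> ('i, 'k) ext_lie" where
  "lie_ad s = (SOME T. product_derivation (tdeg s) T \<and> (\<forall>t. T (lie_elem t) = lie_elem (Br s t)))"

lemma lie_ad:
  fixes s :: "'a::graded_basis ltree"
  shows "product_derivation (tdeg s) (lie_ad s :: ('a, 'b::field) ext_lie \<Rightarrow> _)"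
    "lie_ad s (lie_elem t) = (lie_elem (Br s t) :: ('a, 'b) ext_lie)"
proof -
  have "\<exists>T :: ('a, 'b) ext_lie \<Rightarrow> _. product_derivation (tdeg s) T \<and> (\<forall>p. \<forall>x\<in>Fil p. T x \<in> Fil (p - 0)) \<and>
      (\<forall>t. T (lie_elem t) = lie_elem (Br s t))"
  proof (rule product_derivation_exists)
    show "lie_elem (Br s t) \<in> gr (tdeg t + 1 + tdeg s)" for t
      using lie_elem_gr[of "Br s t"] by (simp add: algebra_simps)
    show "lie_elem (Br s t) \<in> Fil (twt t - 0)" for t
      using lie_elem_Fil[of "Br s t"] by (auto elim: Fil_mono)
  qed (auto simp: lin_extend_lie_elem_Br intro!: lie_elem_zero)
  then have "\<exists>T :: ('a, 'b) ext_lie \<Rightarrow> _. product_derivation (tdeg s) T \<and> (\<forall>t. T (lie_elem t) = lie_elem (Br s t))"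
    by blast
  from someI_ex[OF this] show "product_derivation (tdeg s) (lie_ad s :: ('a, 'b) ext_lie \<Rightarrow> _)"
      "lie_ad s (lie_elem t) = (lie_elem (Br s t) :: ('a, 'b) ext_lie)"
    unfolding lie_ad_def by auto
qed

lemmas cont_linear_lie_ad = product_derivationD(1)[OF lie_ad(1)]
lemmas cont_linear_lie_ad' [cont_linear_intros] = cont_linear_comp[OF cont_linear_lie_ad]

lemma lie_ad_lie_elem_times:
  "lie_ad s (lie_elem t * b) = lie_elem (Br s t) * b + sg (tdeg s * (tdeg t + 1)) (lie_elem t * lie_ad s b)"
  by (simp add: product_derivationD(3)[OF lie_ad(1) lie_elem_gr] lie_ad)

lemma lie_ad_one: "lie_ad s 1 = 0"
  by (rule product_derivationD(4)[OF lie_ad(1)])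

lemma lie_ad_monomial_Fil: "lie_ad s (monomial xs) \<in> Fil (twt s + mwt xs)"
proof (induction xs)
  case (Cons t xs)
  show ?case
    using Fil_times[OF lie_elem_Fil[of "Br s t"] monomial_Fil[of xs]]
      Fil_times[OF lie_elem_Fil[of t] Cons.IH]
    by (auto simp: monomial_Cons lie_ad_lie_elem_times algebra_simps intro!: Fil_add Fil_sg)
qed (simp add: monomial_Nil lie_ad_one)

text \<open>The zero map is a derivation with the same values on trees, so uniqueness
  applies.\<close>

lemma lie_ad_nonadmissible: "\<not> set_ltree s \<subseteq> gbasis \<Longrightarrow> lie_ad s x = 0"
  by (rule product_derivation_eqI[OF lie_ad(1)])
    (auto simp: product_derivation_def cont_linear_const lie_ad lie_elem_zero)

text \<open>It makes the adjoint action depend only on the class of the acting tree. Passing a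
  factor costs a sign that depends on s, so the induction hypothesis is used for a sign-twisted
  f.\<close>

lemma lie_ad_lie_ideal:
  assumes "f \<in> lie_ideal"
  shows "lin_extend (\<lambda>s. lie_ad s (monomial xs)) f = 0"
  using assms
proof (induction xs arbitrary: f)
  case Nil
  then show ?case by (simp add: monomial_Nil lie_ad_one lin_extend_def)
next
  case (Cons t xs)
  have "lin_extend (\<lambda>s. lie_elem (Br s t) * monomial xs) f = 0"
    using lin_extend_lie_elem_Br(2)[OF Cons.prems, of t] by (simp flip: lin_extend_times)
  moreover have "lin_extend (\<lambda>s. sg (tdeg s * (tdeg t + 1)) (lie_elem t * lie_ad s (monomial xs))) f = 0"
    using Cons.IH[OF lie_ideal_sign'[OF Cons.prems, of "tdeg t + 1" 0]]
    by (simp add: lin_extend_fun_sg mult.commute flip: lin_extend_times)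
  ultimately show ?case
    by (simp add: monomial_Cons lie_ad_lie_elem_times lin_extend_fun_add)
qed

text \<open>On a single tree this is the Jacobi relation, and both sides obey the same Leibniz rule
  because a graded commutator of derivations is a derivation.\<close>

lemma lie_ad_Br:
  fixes x :: "('i::graded_basis, 'k::field) ext_lie"
  shows "lie_ad (Br s t) x = lie_ad s (lie_ad t x) - sg (tdeg s * tdeg t) (lie_ad t (lie_ad s x))"
proof -
  have "lie_ad (Br s t) (monomial xs) = lie_ad s (lie_ad t (monomial xs :: ('i, 'k) ext_lie))
      - sg (tdeg s * tdeg t) (lie_ad t (lie_ad s (monomial xs)))" for xs
  proof (induction xs)
    case (Cons u xs)
    have "lie_elem (Br s (Br t u)) * monomial xs = lie_elem (Br (Br s t) u) * monomial xs
        + sg (tdeg s * tdeg t) (lie_elem (Br t (Br s u)) * monomial xs :: ('i, 'k) ext_lie)"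
      by (simp add: lie_elem_relations(2)[of s t u] distrib_right)
    then show ?case
      by (cases "even (tdeg s)"; cases "even (tdeg t)"; cases "even (tdeg u)")
        (simp_all add: monomial_Cons lie_ad_lie_elem_times cont_linear_simps[OF cont_linear_lie_ad] Cons.IH sg_def algebra_simps)
  qed (simp add: monomial_Nil lie_ad_one cont_linear_simps[OF cont_linear_lie_ad])
  note base = this
  have "x \<in> {x. lie_ad (Br s t) x = lie_ad s (lie_ad t x) - sg (tdeg s * tdeg t) (lie_ad t (lie_ad s x))}"
    by (rule monomial_induct[OF closed_subspace_eq]) (auto simp: base intro!: cont_linear_intros cont_linear_lie_ad)
  then show ?thesis by simp
qed

text \<open>The Chevalley-Eilenberg sum over pairs of factors, grouped by the first member of the
  pair: \<open>lie_ad t\<close> collects the brackets of t with all later factors.\<close>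

primrec chain_diff_list :: "'i::graded_basis ltree list \<Rightarrow> ('i, 'k::field) ext_lie" where
  "chain_diff_list [] = 0"
| "chain_diff_list (t # xs) = sg (tdeg t + 1) (lie_elem t * chain_diff_list xs + lie_ad t (monomial xs))"

text \<open>Exchanging the first two factors interchanges the two adjoint terms and turns the new
  factor [s, t] into [t, s], which antisymmetry compensates. Exchanges and Lie relations further
  inside pass through multiplication and adjoint action.\<close>

lemma chain_diff_list_extension:
  "\<exists>T. cont_linear T \<and> (\<forall>p. \<forall>x\<in>Fil p. T x \<in> Fil (p - 0)) \<and> (\<forall>xs. T (monomial xs) = chain_diff_list xs)"
proof (rule linear_extension)
  have swap: "monomial (xs @ [s, t] @ ys) = sg ((tdeg s + 1) * (tdeg t + 1)) (monomial (xs @ [t, s] @ ys) :: ('a, 'b) ext_lie)"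
    for xs ys :: "'a ltree list" and s t
  proof -
    have "lie_elem s * (lie_elem t * monomial ys)
        = sg ((tdeg s + 1) * (tdeg t + 1)) (lie_elem t * (lie_elem s * monomial ys :: ('a, 'b) ext_lie))"
      by (simp add: lie_elem_swap[of s t] flip: mult.assoc)
    then show ?thesis by (simp add: monomial_append monomial_Cons)
  qed
  show "chain_diff_list (xs @ [s, t] @ ys)
      = sg ((tdeg s + 1) * (tdeg t + 1)) (chain_diff_list (xs @ [t, s] @ ys) :: ('a, 'b) ext_lie)" for xs ys s t
  proof (induction xs)
    case Nil
    have "lie_elem s * (lie_elem t * x)
        = sg ((tdeg s + 1) * (tdeg t + 1)) (lie_elem t * (lie_elem s * x))" for x :: "('a, 'b) ext_lie"
      by (simp add: lie_elem_swap[of s t] flip: mult.assoc)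
    moreover have "lie_elem (Br s t) = - sg (tdeg s * tdeg t) (lie_elem (Br t s) :: ('a, 'b) ext_lie)"
      by (rule lie_elem_relations)
    ultimately show ?case
      by (cases "even (tdeg s)"; cases "even (tdeg t)")
        (simp_all add: monomial_Cons lie_ad_lie_elem_times sg_def algebra_simps)
  next
    case (Cons u xs)
    show ?case
      using Cons.IH swap[of xs s t ys]
      by (simp add: cont_linear_simps[OF cont_linear_lie_ad] sg_add algebra_simps)
  qed
next
  show "lin_extend (\<lambda>t. chain_diff_list (xs @ [t] @ ys)) f = (0 :: ('a, 'b) ext_lie)" if "f \<in> lie_ideal" for xs ys f
  proof (induction xs)
    case Nil
    have "lin_extend (\<lambda>t. sg (tdeg t + 1) (lie_elem t * chain_diff_list ys)) f = 0"
      using lin_extend_lie_elem_times[OF that, of 1 1 1] by simp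
    moreover have "lin_extend (\<lambda>t. sg (tdeg t + 1) (lie_ad t (monomial ys))) f = 0"
      using lie_ad_lie_ideal[OF lie_ideal_sign'[OF that, of 1 1]] by (simp add: lin_extend_fun_sg)
    ultimately show ?case
      by (simp add: sg_add lin_extend_fun_add)
  next
    case (Cons u xs)
    have "lin_extend (\<lambda>t. monomial (xs @ [t] @ ys)) f = (0 :: ('a, 'b) ext_lie)"
      using lin_extend_lie_elem_times[OF that, of 0 0 "monomial xs" "monomial ys"]
      by (simp add: monomial_append monomial_Cons mult.assoc)
    then have "lin_extend (\<lambda>t. lie_ad u (monomial (xs @ [t] @ ys))) f = (0 :: ('a, 'b) ext_lie)"
      by (simp add: cont_linear_simps[OF cont_linear_lie_ad] flip: cont_linear_lin_extend[OF cont_linear_lie_ad])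
    moreover have "lin_extend (\<lambda>t. lie_elem u * chain_diff_list (xs @ [t] @ ys)) f = (0 :: ('a, 'b) ext_lie)"
      using Cons.IH by (simp flip: lin_extend_times)
    moreover have "lin_extend (\<lambda>t. sg (tdeg u + 1) (lie_elem u * chain_diff_list (xs @ [t] @ ys) + lie_ad u (monomial (xs @ [t] @ ys)))) f
        = sg (tdeg u + 1) (lin_extend (\<lambda>t. lie_elem u * chain_diff_list (xs @ [t] @ ys) + lie_ad u (monomial (xs @ [t] @ ys))) f
          :: ('a, 'b) ext_lie)"
      by (subst cont_linear_lin_extend[of "sg _"]) (auto intro!: cont_linear_signed cont_linear_id)
    ultimately show ?case by (simp add: lin_extend_fun_add)
  qed
next
  show "chain_diff_list xs = (0 :: ('a, 'b) ext_lie)" if "\<not> admissible xs" for xs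
    using that
  proof (induction xs)
    case (Cons t xs)
    then show ?case
      by (cases "set_ltree t \<subseteq> gbasis") (simp_all add: admissible_Cons lie_elem_zero
          monomial_nonadmissible lie_ad_nonadmissible cont_linear_simps[OF cont_linear_lie_ad])
  qed (simp add: admissible_Nil)
  show "chain_diff_list xs \<in> (Fil (mwt xs - 0) :: ('a, 'b) ext_lie set)" for xs
  proof (induction xs)
    case (Cons t xs)
    show ?case
      using Fil_times[OF lie_elem_Fil[of t] Cons.IH] lie_ad_monomial_Fil[of t xs]
      by (auto intro!: Fil_sg Fil_add)
  qed simp
qed

definition chain_diff :: "('i::graded_basis, 'k::field) ext_lie \<Rightarrow> ('i, 'k) ext_lie" where
  "chain_diff = (SOME T. cont_linear T \<and> (\<forall>p. \<forall>x\<in>Fil p. T x \<in> Fil p) \<and> (\<forall>xs. T (monomial xs) = chain_diff_list xs))"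

lemma cont_linear_chain_diff: "cont_linear chain_diff"
  and chain_diff_Fil: "x \<in> Fil p \<Longrightarrow> chain_diff x \<in> Fil p"
  and chain_diff_monomial: "chain_diff (monomial xs) = chain_diff_list xs"
  using someI_ex[OF chain_diff_list_extension[simplified]] unfolding chain_diff_def[symmetric] by auto

lemmas cont_linear_chain_diff' [cont_linear_intros] = cont_linear_comp[OF cont_linear_chain_diff]

lemma chain_diff_one: "chain_diff 1 = 0"
  using chain_diff_monomial[of "[]"] by (simp add: monomial_Nil)

lemma chain_diff_lie_elem: "chain_diff (lie_elem t) = 0"
  by (simp add: lie_elem_monomial chain_diff_monomial monomial_Nil lie_ad_one)

lemma chain_diff_lie_elem_times:
  "chain_diff (lie_elem t * x) = sg (tdeg t + 1) (lie_elem t * chain_diff x + lie_ad t x)"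
proof -
  have "x \<in> {x. chain_diff (lie_elem t * x) = sg (tdeg t + 1) (lie_elem t * chain_diff x + lie_ad t x)}"
    by (rule monomial_induct[OF closed_subspace_eq])
      (auto intro!: cont_linear_intros cont_linear_lie_ad cont_linear_chain_diff simp: chain_diff_monomial simp flip: monomial_Cons)
  then show ?thesis by simp
qed

lemma chain_diff_gr: "x \<in> gr n \<Longrightarrow> chain_diff x \<in> gr (n - 1)"
proof -
  have "chain_diff_list xs \<in> (gr (mdeg xs - 1) :: ('a, 'b) ext_lie set)" for xs
  proof (induction xs)
    case (Cons t xs)
    show ?case
      using gr_times[OF lie_elem_gr[of t] Cons.IH] product_derivationD(2)[OF lie_ad(1)[of t] monomial_gr[of xs]]
      by (auto intro!: gr_sg gr_add simp: algebra_simps)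
  qed simp
  moreover assume x: "x \<in> gr n"
  ultimately have "x \<in> {x. chain_diff x \<in> gr (n - 1)}"
    using gr_induct[OF closed_subspace_gr[OF cont_linear_chain_diff] _ x, of "n - 1"] by (auto simp: chain_diff_monomial)
  then show ?thesis by simp
qed

text \<open>Equivariance of the chain differential. In the inductive step the two orders of
  \<open>lie_ad s\<close> and \<open>lie_ad t\<close> differ by \<open>lie_ad (Br s t)\<close>,
  which is the contribution of the factor [s, t] created by \<open>lie_ad s\<close>.\<close>

lemma chain_diff_lie_ad: "chain_diff (lie_ad s x) = sg (tdeg s) (lie_ad s (chain_diff x))"
proof -
  have "chain_diff (lie_ad s (monomial xs)) = sg (tdeg s) (lie_ad s (chain_diff (monomial xs)))" for xs
  proof (induction xs)
    case (Cons t xs)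
    then show ?case
      by (cases "even (tdeg s)"; cases "even (tdeg t)")
        (simp_all add: monomial_Cons lie_ad_lie_elem_times cont_linear_simps[OF cont_linear_lie_ad] chain_diff_lie_elem_times
          cont_linear_simps[OF cont_linear_chain_diff] sg_def algebra_simps lie_ad_Br)
  qed (simp add: monomial_Nil lie_ad_one chain_diff_one cont_linear_simps[OF cont_linear_lie_ad] cont_linear_simps[OF cont_linear_chain_diff])
  note base = this
  have "x \<in> {x. chain_diff (lie_ad s x) = sg (tdeg s) (lie_ad s (chain_diff x))}"
    by (rule monomial_induct[OF closed_subspace_eq]) (auto simp: base intro!: cont_linear_intros cont_linear_lie_ad cont_linear_chain_diff)
  then show ?thesis by simp
qed

text \<open>Applying the recursion twice to t times r leaves, besides the inductive term,
  \<open>lie_ad t (chain_diff r)\<close> twice. One copy carries the square of the recursion sign,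
  the other the recursion sign times the equivariance sign, and these two signs are
  opposite.\<close>

lemma chain_diff_square: "chain_diff (chain_diff x) = 0"
proof -
  have "chain_diff (chain_diff (monomial xs)) = 0" for xs
  proof (induction xs)
    case (Cons t xs)
    then show ?case
      by (cases "even (tdeg t)")
        (simp_all add: monomial_Cons chain_diff_lie_elem_times cont_linear_simps[OF cont_linear_chain_diff] sg_def
          chain_diff_lie_ad)
  qed (simp add: monomial_Nil chain_diff_one cont_linear_simps[OF cont_linear_chain_diff])
  note base = this
  have "x \<in> {x. chain_diff (chain_diff x) = 0}"
    by (rule monomial_induct[OF closed_subspace_eq]) (auto simp: base intro!: cont_linear_intros cont_linear_chain_diff)
  then show ?thesis by simp
qed

section \<open>The bracket derived from the chain differential\<close>

text \<open>The Batalin-Vilkovisky identity solved for the bracket. With \<open>parity\<close> in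
  place of the sign of a homogeneous a, the formula is linear in a.\<close>

definition chain_bracket :: "('i::graded_basis, 'k::field) ext_lie \<Rightarrow> ('i, 'k) ext_lie \<Rightarrow> ('i, 'k) ext_lie" where
  "chain_bracket a b = chain_diff (parity a * b) - chain_diff (parity a) * b - a * chain_diff b"

lemma cont_linear_chain_bracket_left [cont_linear_intros]: "cont_linear T \<Longrightarrow> cont_linear (\<lambda>x. chain_bracket (T x) b)"
  unfolding chain_bracket_def by (intro cont_linear_intros)

lemma cont_linear_chain_bracket_right [cont_linear_intros]: "cont_linear T \<Longrightarrow> cont_linear (\<lambda>x. chain_bracket a (T x))"
  unfolding chain_bracket_def by (intro cont_linear_intros)

lemmas chain_bracket_simps =
  cont_linear_simps[OF cont_linear_chain_bracket_left[OF cont_linear_id]] cont_linear_simps[OF cont_linear_chain_bracket_right[OF cont_linear_id]]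

lemmas chain_diff_simps = cont_linear_simps[OF cont_linear_chain_diff]

lemma chain_bracket_gr_eq:
  "a \<in> gr m \<Longrightarrow> chain_bracket a b = sg m (chain_diff (a * b)) - sg m (chain_diff a * b) - a * chain_diff b"
  by (simp add: chain_bracket_def parity_gr chain_diff_simps)

lemma chain_bracket_lie_elem: "chain_bracket (lie_elem t) b = lie_ad t b"
  by (simp add: chain_bracket_gr_eq[OF lie_elem_gr] chain_diff_lie_elem chain_diff_lie_elem_times sg_add sg_cong)

lemma chain_diff_times:
  "a \<in> gr m \<Longrightarrow> chain_diff (a * b) = chain_diff a * b + sg m (a * chain_diff b) + sg m (chain_bracket a b)"
  by (simp add: chain_bracket_gr_eq sg_diff)

lemma chain_bracket_gr: "a \<in> gr m \<Longrightarrow> b \<in> gr n \<Longrightarrow> chain_bracket a b \<in> gr (m + n - 1)"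
  using chain_diff_gr[OF gr_times[of a m b n]] gr_times[OF chain_diff_gr[of a m], of b n]
    gr_times[of a m "chain_diff b" "n - 1"] chain_diff_gr[of b n]
  by (auto simp: chain_bracket_gr_eq algebra_simps intro!: gr_diff gr_add gr_sg)

lemma chain_bracket_Fil: "a \<in> Fil p \<Longrightarrow> b \<in> Fil q \<Longrightarrow> chain_bracket a b \<in> Fil (p + q)"
  unfolding chain_bracket_def by (intro Fil_diff Fil_times chain_diff_Fil Fil_parity)

text \<open>A tree split off from the first argument acts on the second through
  \<open>lie_ad\<close>, a derivation of the product; this drives the induction showing that
  \<open>chain_diff\<close> has order two.\<close>

lemma chain_bracket_lie_elem_times:
  assumes "a \<in> gr m"
  shows "chain_bracket (lie_elem t * a) b = lie_elem t * chain_bracket a b + sg ((tdeg t + 1) * m) (a * lie_ad t b)"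
proof -
  have "lie_ad t (a * b) = lie_ad t a * b + sg (tdeg t * m) (a * lie_ad t b)"
    by (rule product_derivationD(3)[OF lie_ad(1) assms])
  then show ?thesis
    by (cases "even (tdeg t)"; cases "even m")
      (simp_all add: chain_bracket_gr_eq[OF gr_times[OF lie_elem_gr assms]] chain_bracket_gr_eq[OF assms] mult.assoc
        chain_diff_lie_elem_times sg_def algebra_simps)
qed

text \<open>The induction runs over the first argument, not over the factors b and c: each tree
  split off contributes a \<open>lie_ad\<close>, for which the product rule is known, and b is moved
  past the remaining factors by graded commutativity.\<close>

lemma chain_bracket_times_right:
  assumes "a \<in> gr m" "b \<in> gr n"
  shows "chain_bracket a (b * c) = chain_bracket a b * c + sg ((m - 1) * n) (b * chain_bracket a c)"
proof -
  have base: "chain_bracket (monomial xs) (b * c) = chain_bracket (monomial xs) b * c + sg ((mdeg xs - 1) * n) (b * chain_bracket (monomial xs) c)" for xs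
  proof (induction xs)
    case Nil
    have "chain_bracket 1 x = 0" for x :: "('a, 'b) ext_lie"
      by (simp add: chain_bracket_gr_eq[OF one_gr] chain_diff_one)
    then show ?case by (simp add: monomial_Nil)
  next
    case (Cons t xs)
    have "monomial xs * lie_ad t (b * c) = monomial xs * (lie_ad t b * c) + sg (tdeg t * n) (monomial xs * (b * lie_ad t c))"
      by (simp add: product_derivationD(3)[OF lie_ad(1) assms(2)] distrib_left)
    moreover have "b * (lie_elem t * x) = sg (n * (tdeg t + 1)) (lie_elem t * (b * x))"
        "b * (monomial xs * x) = sg (n * mdeg xs) (monomial xs * (b * x))" for x
      using graded_commute[OF assms(2) lie_elem_gr[of t]] graded_commute[OF assms(2) monomial_gr[of xs]]
      by (simp_all flip: mult.assoc)
    ultimately show ?case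
      by (cases "even (tdeg t)"; cases "even n"; cases "even (mdeg xs)")
        (simp_all add: monomial_Cons chain_bracket_lie_elem_times[OF monomial_gr] Cons.IH mult.assoc sg_def algebra_simps)
  qed
  have "a \<in> {a. chain_bracket a (b * c) = chain_bracket a b * c + sg ((m - 1) * n) (b * chain_bracket a c)}"
    by (rule gr_induct[OF closed_subspace_eq _ assms(1)]) (auto simp: base intro!: cont_linear_intros)
  then show ?thesis by simp
qed

text \<open>Swapping a and b exchanges the two correction terms of the defining formula, up to the
  signs of graded commutativity.\<close>

lemma chain_bracket_antisym:
  assumes "a \<in> gr m" "b \<in> gr n"
  shows "chain_bracket a b = - sg ((m - 1) * (n - 1)) (chain_bracket b a)"
proof -
  have "b * a = sg (n * m) (a * b)" "chain_diff b * a = sg ((n - 1) * m) (a * chain_diff b)"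
      "b * chain_diff a = sg (n * (m - 1)) (chain_diff a * b)"
    by (intro graded_commute assms chain_diff_gr)+
  then show ?thesis
    by (cases "even m"; cases "even n")
      (simp_all add: chain_bracket_gr_eq[OF assms(1)] chain_bracket_gr_eq[OF assms(2)] sg_def chain_diff_simps)
qed

text \<open>Applying \<open>chain_diff\<close> to the defining formula removes the term in which it
  would act twice on the product; the same happens in the brackets on the right.\<close>

lemma chain_diff_chain_bracket:
  assumes "a \<in> gr m"
  shows "chain_diff (chain_bracket a b) = chain_bracket (chain_diff a) b + sg (m - 1) (chain_bracket a (chain_diff b))"
  by (cases "even m")
    (simp_all add: chain_bracket_gr_eq[OF assms] chain_bracket_gr_eq[OF chain_diff_gr[OF assms]] chain_diff_square chain_diff_simps
      sg_def algebra_simps)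

lemma chain_bracket_chain_diff:
  assumes "a \<in> gr m"
  shows "chain_bracket a (chain_diff b) = sg (m - 1) (chain_diff (chain_bracket a b) - chain_bracket (chain_diff a) b)"
  by (simp add: chain_diff_chain_bracket[OF assms])

text \<open>The inner bracket is written through \<open>chain_diff\<close>. Taking
  \<open>chain_diff\<close> out of the outer bracket lets it act on the products of [a, b] with c
  and of b with [a, c], and its defects there are the two terms on the right; all other terms
  cancel.\<close>

lemma chain_bracket_jacobi:
  assumes a: "a \<in> gr m" and b: "b \<in> gr n"
  shows "chain_bracket a (chain_bracket b c) = chain_bracket (chain_bracket a b) c + sg ((m - 1) * (n - 1)) (chain_bracket b (chain_bracket a c))"
proof -
  note a' = chain_diff_gr[OF a] and b' = chain_diff_gr[OF b] and ab = chain_bracket_gr[OF a b]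
  have "chain_bracket a (chain_bracket b c) = sg n (chain_bracket a (chain_diff (b * c))) - sg n (chain_bracket a (chain_diff b * c))
      - chain_bracket a (b * chain_diff c)"
    by (simp add: chain_bracket_gr_eq[OF b] chain_bracket_simps)
  also have "chain_bracket a (chain_diff (b * c))
      = sg (m - 1) (chain_diff (chain_bracket a b * c) + sg ((m - 1) * n) (chain_diff (b * chain_bracket a c))
        - chain_bracket (chain_diff a) b * c - sg ((m - 2) * n) (b * chain_bracket (chain_diff a) c))"
    by (simp add: chain_bracket_chain_diff[OF a] chain_bracket_times_right[OF a b] chain_bracket_times_right[OF a' b] chain_diff_simps
        sg_add sg_diff algebra_simps)
  also have "chain_diff (chain_bracket a b * c) = chain_diff (chain_bracket a b) * c
      + sg (m + n - 1) (chain_bracket a b * chain_diff c) + sg (m + n - 1) (chain_bracket (chain_bracket a b) c)"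
    by (rule chain_diff_times[OF ab])
  also have "chain_diff (b * chain_bracket a c) = chain_diff b * chain_bracket a c + sg n (b * chain_diff (chain_bracket a c))
      + sg n (chain_bracket b (chain_bracket a c))"
    by (rule chain_diff_times[OF b])
  also have "chain_bracket a (chain_diff b * c) = chain_bracket a (chain_diff b) * c
      + sg ((m - 1) * (n - 1)) (chain_diff b * chain_bracket a c)"
    by (rule chain_bracket_times_right[OF a b'])
  also have "chain_bracket a (b * chain_diff c) = chain_bracket a b * chain_diff c + sg ((m - 1) * n) (b * chain_bracket a (chain_diff c))"
    by (rule chain_bracket_times_right[OF a b])
  finally show ?thesis
    by (cases "even m"; cases "even n") (simp_all add: chain_diff_chain_bracket[OF a] sg_def algebra_simps)
qed

section \<open>Agreement with the bracket and the chain differential of the statement\<close>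

lemma gerstenhaber_bracket_chain_bracket: "gerstenhaber_bracket chain_bracket"
  unfolding gerstenhaber_bracket_def operator_iff_cont_linear
  by (intro conjI allI ballI cont_linear_intros chain_bracket_gr chain_bracket_antisym chain_bracket_jacobi chain_bracket_times_right)

text \<open>Products are treated in the second argument only, as \<open>sym\<close> exchanges the
  arguments. Homogeneity may be assumed in these hypotheses because monomials are
  homogeneous.\<close>

lemma bilinear_induct:
  fixes Q :: "('i::graded_basis, 'k::field) ext_lie \<Rightarrow> ('i, 'k) ext_lie \<Rightarrow> bool"
  assumes closed: "\<And>a. closed_subspace {b. Q a b}" "\<And>b. closed_subspace {a. Q a b}"
    and one: "\<And>a m. a \<in> gr m \<Longrightarrow> Q a 1"
    and times: "\<And>a b c m n. a \<in> gr m \<Longrightarrow> b \<in> gr n \<Longrightarrow> Q a b \<Longrightarrow> Q a c \<Longrightarrow> Q a (b * c)"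
    and sym: "\<And>a b m n. a \<in> gr m \<Longrightarrow> b \<in> gr n \<Longrightarrow> Q a b \<Longrightarrow> Q b a"
    and lie: "\<And>s t. Q (lie_elem s) (lie_elem t)"
  shows "Q a b"
proof -
  have right: "Q a (monomial ys)" if "a \<in> gr m" "\<And>t. Q a (lie_elem t)" for a m ys
    by (induction ys) (auto simp: monomial_Nil monomial_Cons intro: one times that lie_elem_gr)
  have "Q (lie_elem s) (monomial ys)" for s ys
    by (rule right[OF lie_elem_gr lie])
  then have "Q (monomial xs) (lie_elem t)" for t xs
    by (rule sym[OF lie_elem_gr monomial_gr])
  then have monomial: "Q (monomial xs) (monomial ys)" for xs ys
    by (rule right[OF monomial_gr])
  have "b \<in> {b. Q (monomial xs) b}" for xs
    by (rule monomial_induct[OF closed(1)]) (simp add: monomial)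
  then have "Q (monomial xs) b" for xs by simp
  then have "a \<in> {a. Q a b}"
    using monomial_induct[OF closed(2), of b a] by simp
  then show ?thesis by simp
qed

text \<open>The product rule and antisymmetry reduce a Gerstenhaber bracket to its values on pairs
  of trees, which the description prescribes.\<close>

lemma bracket_eq_chain_bracket: "bracket = (chain_bracket :: ('i::graded_basis, 'k::field) ext_lie \<Rightarrow> _)"
  unfolding bracket_def
proof (rule the_equality)
  have "chain_bracket (smul c 1) a = 0" for c and a :: "('i, 'k) ext_lie"
    by (simp add: chain_bracket_simps chain_bracket_gr_eq[OF one_gr] chain_diff_one)
  then show "gerstenhaber_bracket (chain_bracket :: ('i, 'k) ext_lie \<Rightarrow> _) \<and>
      (\<forall>s t. chain_bracket (lie_elem s) (lie_elem t) = (lie_elem (Br s t) :: ('i, 'k) ext_lie)) \<and>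
      (\<forall>c a. chain_bracket (smul c 1) a = (0 :: ('i, 'k) ext_lie))"
    by (simp add: gerstenhaber_bracket_chain_bracket chain_bracket_lie_elem lie_ad)
next
  fix B :: "('i, 'k) ext_lie \<Rightarrow> _"
  assume B: "gerstenhaber_bracket B \<and> (\<forall>s t. B (lie_elem s) (lie_elem t) = lie_elem (Br s t)) \<and>
    (\<forall>c a. B (smul c 1) a = 0)"
  then have cont_linear: "cont_linear (B a)" "cont_linear (\<lambda>a. B a b)" for a b
    by (auto simp: gerstenhaber_bracket_def operator_iff_cont_linear)
  have antisym: "B a b = - sg ((m - 1) * (n - 1)) (B b a)" if "a \<in> gr m" "b \<in> gr n" for a b m n
    using B that unfolding gerstenhaber_bracket_def by blast
  have times: "B a (b * c) = B a b * c + sg ((m - 1) * n) (b * B a c)"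
    if "a \<in> gr m" "b \<in> gr n" for a b c m n
    using B that unfolding gerstenhaber_bracket_def by blast
  have "B a b = chain_bracket a b" for a b
  proof (rule bilinear_induct[of "\<lambda>a b. B a b = chain_bracket a b"])
    show "closed_subspace {b. B a b = chain_bracket a b}" "closed_subspace {a. B a b = chain_bracket a b}" for a b
      by (intro closed_subspace_eq cont_linear cont_linear_chain_bracket_right[OF cont_linear_id] cont_linear_chain_bracket_left[OF cont_linear_id])+
    show "B a 1 = chain_bracket a 1" if "a \<in> gr m" for a m
    proof -
      have "B 1 a = 0" using B smul_simps(4)[of 1] by metis
      then show ?thesis
        using antisym[OF that one_gr] chain_bracket_antisym[OF that one_gr]
        by (simp add: chain_bracket_gr_eq[OF one_gr] chain_diff_one)
    qed
    show "B b a = chain_bracket b a" if "a \<in> gr m" "b \<in> gr n" "B a b = chain_bracket a b" for a b m n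
      using antisym[OF that(2,1)] chain_bracket_antisym[OF that(2,1)] that(3) by simp
  qed (use B in \<open>auto simp: times chain_bracket_times_right chain_bracket_lie_elem lie_ad\<close>)
  then show "B = chain_bracket" by blast
qed

lemmas cont_linear_bracket_left [cont_linear_intros] = cont_linear_chain_bracket_left[folded bracket_eq_chain_bracket]
lemmas cont_linear_bracket_right [cont_linear_intros] = cont_linear_chain_bracket_right[folded bracket_eq_chain_bracket]
lemmas bracket_simps = chain_bracket_simps[folded bracket_eq_chain_bracket]
lemmas bracket_gr = chain_bracket_gr[folded bracket_eq_chain_bracket]
lemmas bracket_Fil = chain_bracket_Fil[folded bracket_eq_chain_bracket]
lemmas bracket_antisym = chain_bracket_antisym[folded bracket_eq_chain_bracket]
lemmas bracket_jacobi = chain_bracket_jacobi[folded bracket_eq_chain_bracket]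
lemmas bracket_times_right = chain_bracket_times_right[folded bracket_eq_chain_bracket]

lemma bracket_lie_elem: "bracket (lie_elem s) (lie_elem t) = lie_elem (Br s t)"
  by (simp add: bracket_eq_chain_bracket chain_bracket_lie_elem lie_ad)

lemma bracket_one: "bracket 1 a = 0" "bracket a 1 = 0"
proof -
  show "bracket 1 a = 0" for a
    by (simp add: bracket_eq_chain_bracket chain_bracket_gr_eq[OF one_gr] chain_diff_one)
  show "bracket a 1 = 0"
    by (simp add: bracket_eq_chain_bracket chain_bracket_def chain_diff_one)
qed

text \<open>For a tree as first factor the Batalin-Vilkovisky identity is the recursion behind
  \<open>chain_diff\<close>, so vanishing on trees and on 1 determines the operator.\<close>

lemma Delta_Lie_eq_chain_diff: "Delta_Lie = (chain_diff :: ('i::graded_basis, 'k::field) ext_lie \<Rightarrow> _)"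
  unfolding Delta_Lie_def
proof (rule the_equality)
  have "BV_operator (chain_diff :: ('i, 'k) ext_lie \<Rightarrow> _)"
    unfolding BV_operator_def operator_iff_cont_linear has_degree_def bracket_eq_chain_bracket
    by (auto simp: cont_linear_chain_diff chain_diff_square chain_diff_times intro: chain_diff_gr)
  moreover have "chain_diff (lie_elem s * lie_elem t)
      = sg (tdeg s + 1) (bracket (lie_elem s) (lie_elem t) :: ('i, 'k) ext_lie)" for s t
    by (simp add: chain_diff_lie_elem_times chain_diff_lie_elem lie_ad bracket_lie_elem)
  ultimately show "BV_operator (chain_diff :: ('i, 'k) ext_lie \<Rightarrow> _) \<and>
      (\<forall>t. chain_diff (lie_elem t) = (0 :: ('i, 'k) ext_lie)) \<and>
      (\<forall>s t. chain_diff (lie_elem s * lie_elem t)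
        = sg (tdeg s + 1) (bracket (lie_elem s) (lie_elem t) :: ('i, 'k) ext_lie))"
    by (simp add: chain_diff_lie_elem)
next
  fix D :: "('i, 'k) ext_lie \<Rightarrow> _"
  assume D: "BV_operator D \<and> (\<forall>t. D (lie_elem t) = 0) \<and>
    (\<forall>s t. D (lie_elem s * lie_elem t) = sg (tdeg s + 1) (bracket (lie_elem s) (lie_elem t)))"
  then have cont_linear: "cont_linear D" and times: "D (a * b) = D a * b + sg m (a * D b) + sg m (bracket a b)"
    if "a \<in> gr m" for a b m
    using that one_gr by (auto simp: BV_operator_def operator_iff_cont_linear)
  \<comment> \<open>The identity for the product of 1 with itself reads D 1 = D 1 + D 1.\<close>
  have "D 1 = 0"
    using times[OF one_gr, of 1] by (simp add: bracket_one)
  then have "D (monomial xs) = chain_diff (monomial xs)" for xs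
    by (induction xs) (simp_all add: monomial_Nil chain_diff_one monomial_Cons times[OF lie_elem_gr] D
      chain_diff_times[OF lie_elem_gr] chain_diff_lie_elem bracket_eq_chain_bracket)
  note base = this
  have "x \<in> {x. D x = chain_diff x}" for x
    by (rule monomial_induct[OF closed_subspace_eq[OF cont_linear[OF one_gr] cont_linear_chain_diff]]) (simp add: base)
  then show "D = chain_diff" by auto
qed

lemmas cont_linear_Delta_Lie = cont_linear_chain_diff[folded Delta_Lie_eq_chain_diff]
lemmas cont_linear_Delta_Lie' [cont_linear_intros] = cont_linear_comp[OF cont_linear_Delta_Lie]
lemmas Delta_Lie_simps = chain_diff_simps[folded Delta_Lie_eq_chain_diff]
lemmas Delta_Lie_gr = chain_diff_gr[folded Delta_Lie_eq_chain_diff]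
lemmas Delta_Lie_Fil = chain_diff_Fil[folded Delta_Lie_eq_chain_diff]
lemmas Delta_Lie_one = chain_diff_one[folded Delta_Lie_eq_chain_diff]
lemmas Delta_Lie_lie_elem = chain_diff_lie_elem[folded Delta_Lie_eq_chain_diff]
lemmas Delta_Lie_square = chain_diff_square[folded Delta_Lie_eq_chain_diff]
lemmas Delta_Lie_times = chain_diff_times[folded Delta_Lie_eq_chain_diff bracket_eq_chain_bracket]
lemmas Delta_Lie_bracket = chain_diff_chain_bracket[folded Delta_Lie_eq_chain_diff bracket_eq_chain_bracket]

text \<open>Trees are iterated brackets of generators and monomials are products of trees, so the
  generators produce a dense subspace. It is the tool for comparing derivations or morphisms by
  their values on generators.\<close>

lemma gerstenhaber_induct:
  assumes S: "closed_subspace S" "1 \<in> S" "\<And>i. gen i \<in> S"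
    and times: "\<And>a b m n. a \<in> gr m \<Longrightarrow> b \<in> gr n \<Longrightarrow> a \<in> S \<Longrightarrow> b \<in> S \<Longrightarrow> a * b \<in> S"
    and bracket: "\<And>a b m n. a \<in> gr m \<Longrightarrow> b \<in> gr n \<Longrightarrow> a \<in> S \<Longrightarrow> b \<in> S \<Longrightarrow> bracket a b \<in> S"
  shows "x \<in> S"
proof (rule monomial_induct[OF S(1)])
  have lie: "lie_elem t \<in> S" for t
  proof (induction t)
    case (Leaf i)
    then show ?case using S(3)[of i] by (simp add: gen_def)
  next
    case (Br s t)
    then show ?case
      using bracket[OF lie_elem_gr lie_elem_gr, of s t] by (simp add: bracket_lie_elem)
  qed
  show "monomial xs \<in> S" for xs
    by (induction xs) (auto simp: monomial_Nil monomial_Cons S(2) intro: times[OF lie_elem_gr monomial_gr] lie)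
qed

section \<open>Derivations with prescribed values on the generators\<close>

lemma derivationD:
  assumes "derivation d T"
  shows "cont_linear T" "x \<in> gr n \<Longrightarrow> T x \<in> gr (n + d)"
    "a \<in> gr m \<Longrightarrow> T (a * b) = T a * b + sg (d * m) (a * T b)"
    "a \<in> gr m \<Longrightarrow> T (bracket a b) = bracket (T a) b + sg (d * (m - 1)) (bracket a (T b))"
    "T 1 = 0"
proof -
  show *: "cont_linear T" "x \<in> gr n \<Longrightarrow> T x \<in> gr (n + d)"
      "a \<in> gr m \<Longrightarrow> T (a * b) = T a * b + sg (d * m) (a * T b)"
      "a \<in> gr m \<Longrightarrow> T (bracket a b) = bracket (T a) b + sg (d * (m - 1)) (bracket a (T b))"
    for x n a b m
    using assms by (auto simp: derivation_def operator_iff_cont_linear has_degree_def)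
  show "T 1 = 0"
    using *(3)[OF one_gr, of 1] by simp
qed

lemma derivation_unique:
  assumes T: "derivation d T" and T': "derivation d T'"
    and gen: "\<And>i. T (gen i) = T' (gen i)"
  shows "T = T'"
proof
  fix x
  have "x \<in> {x. T x = T' x}"
    by (rule gerstenhaber_induct[OF closed_subspace_eq[OF derivationD(1)[OF T] derivationD(1)[OF T']]])
      (simp_all add: gen derivationD(3-5)[OF T] derivationD(3-5)[OF T'])
  then show "T x = T' x" by simp
qed

text \<open>For odd d the Leibniz sign is the one built into \<open>parity\<close>, which frees the
  rules from homogeneity and brings them into the form used by \<open>eps_times\<close> and
  \<open>eps_bracket\<close>.\<close>

lemma derivation_parity:
  assumes T: "derivation d T" and "odd d"
  shows "T (a * b) = T a * b + parity a * T b"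
    "T (bracket a b) = bracket (T a) b - bracket (parity a) (T b)"
proof -
  note [cont_linear_intros] = cont_linear_comp[OF derivationD(1)[OF T]] derivationD(1)[OF T]
  have "a \<in> {a. T (a * b) = T a * b + parity a * T b}"
    by (rule monomial_induct[OF closed_subspace_eq])
      (use \<open>odd d\<close> in \<open>auto intro!: cont_linear_intros simp: derivationD(3)[OF T monomial_gr] parity_gr[OF monomial_gr] sg_def\<close>)
  then show "T (a * b) = T a * b + parity a * T b" by simp
  have "a \<in> {a. T (bracket a b) = bracket (T a) b - bracket (parity a) (T b)}"
    by (rule monomial_induct[OF closed_subspace_eq])
      (use \<open>odd d\<close> in \<open>auto intro!: cont_linear_intros simp: derivationD(4)[OF T monomial_gr] parity_gr[OF monomial_gr]
        sg_def bracket_simps\<close>)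
  then show "T (bracket a b) = bracket (T a) b - bracket (parity a) (T b)" by simp
qed

primrec leibniz_tree :: "int \<Rightarrow> ('i \<Rightarrow> ('i::graded_basis, 'k::field) ext_lie) \<Rightarrow> 'i ltree \<Rightarrow> ('i, 'k) ext_lie" where
  "leibniz_tree d g (Leaf i) = g i"
| "leibniz_tree d g (Br s t) = bracket (leibniz_tree d g s) (lie_elem t)
     + sg (d * tdeg s) (bracket (lie_elem s) (leibniz_tree d g t))"

lemma leibniz_tree_gr:
  assumes "\<And>i. g i \<in> gr (wdeg i + 1 + d)"
  shows "leibniz_tree d g t \<in> gr (tdeg t + 1 + d)"
proof (induction t)
  case (Br s t)
  show ?case
    using bracket_gr[OF Br.IH(1) lie_elem_gr[of t]] bracket_gr[OF lie_elem_gr[of s] Br.IH(2)]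
    by (auto simp: algebra_simps intro!: gr_add gr_sg)
qed (simp add: assms)

text \<open>Differentiating a relation gives a sum of relations with one entry replaced by its
  derivative. These hold because antisymmetry and Jacobi are known for all homogeneous elements, not
  only for trees.\<close>

lemma leibniz_tree_lie_ideal:
  fixes g :: "'i \<Rightarrow> ('i::graded_basis, 'k::field) ext_lie"
  assumes "\<And>i. g i \<in> gr (wdeg i + 1 + d)" and "f \<in> lie_ideal"
  shows "lin_extend (leibniz_tree d g) f = 0"
  using assms(2)
proof (induction rule: lie_ideal.induct)
  case (add f h)
  then show ?case by (simp only: lin_extend_add lie_ideal_finite_support add_0)
next
  case (antisym s t)
  note gr = leibniz_tree_gr[of g d, OF assms(1)] lie_elem_gr
  show ?case
    using bracket_antisym[OF gr(1)[of s] gr(2)[of t]] bracket_antisym[OF gr(2)[of s] gr(1)[of t]]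
    by (cases "even (tdeg s)"; cases "even (tdeg t)"; cases "even d")
      (simp_all add: lin_extend_add lin_extend_sg sg_add del: plus_fun_apply, simp_all add: sg_def)
next
  case (jacobi s t u)
  note gr = leibniz_tree_gr[of g d, OF assms(1)] lie_elem_gr
  have "bracket (leibniz_tree d g s) (bracket (lie_elem t) (lie_elem u))
      = bracket (bracket (leibniz_tree d g s) (lie_elem t)) (lie_elem u)
        + sg ((tdeg s + d) * tdeg t) (bracket (lie_elem t) (bracket (leibniz_tree d g s) (lie_elem u)))"
    using bracket_jacobi[OF gr(1)[of s] gr(2)[of t]] by (simp add: algebra_simps)
  moreover have "bracket (lie_elem s) (bracket (leibniz_tree d g t) (lie_elem u))
      = bracket (bracket (lie_elem s) (leibniz_tree d g t)) (lie_elem u)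
        + sg (tdeg s * (tdeg t + d)) (bracket (leibniz_tree d g t) (bracket (lie_elem s) (lie_elem u)))"
    using bracket_jacobi[OF gr(2)[of s] gr(1)[of t]] by (simp add: algebra_simps)
  moreover have "bracket (lie_elem s) (bracket (lie_elem t) (leibniz_tree d g u))
      = bracket (bracket (lie_elem s) (lie_elem t)) (leibniz_tree d g u)
        + sg (tdeg s * tdeg t) (bracket (lie_elem t) (bracket (lie_elem s) (leibniz_tree d g u)))"
    using bracket_jacobi[OF gr(2)[of s] gr(2)[of t]] by simp
  ultimately have "leibniz_tree d g (Br s (Br t u)) - leibniz_tree d g (Br (Br s t) u)
        - sg (tdeg s * tdeg t) (leibniz_tree d g (Br t (Br s u))) = 0"
    by (cases "even (tdeg s)"; cases "even (tdeg t)"; cases "even d")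
      (simp_all add: sg_def bracket_simps flip: bracket_lie_elem)
  moreover have "lin_extend (leibniz_tree d g) (unitv (Br s (Br t u)) - unitv (Br (Br s t) u)
        - sg (tdeg s * tdeg t) (unitv (Br t (Br s u))))
      = leibniz_tree d g (Br s (Br t u)) - leibniz_tree d g (Br (Br s t) u)
        - sg (tdeg s * tdeg t) (leibniz_tree d g (Br t (Br s u)))"
    by (simp add: lin_extend_diff lin_extend_sg del: minus_apply leibniz_tree.simps)
  ultimately show ?case by (simp only:)
next
  case (left f t)
  have "lin_extend (\<lambda>s. bracket (leibniz_tree d g t) (lie_elem s)) f = bracket (leibniz_tree d g t) (lin_extend lie_elem f)"
    by (subst cont_linear_lin_extend[of "bracket _"]) (auto intro!: cont_linear_bracket_right cont_linear_id)
  moreover have "lin_extend (\<lambda>s. sg (d * tdeg t) (bracket (lie_elem t) (leibniz_tree d g s))) f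
      = sg (d * tdeg t) (bracket (lie_elem t) (lin_extend (leibniz_tree d g) f))"
    by (subst cont_linear_lin_extend[of "\<lambda>x. sg (d * tdeg t) (bracket (lie_elem t) x)"]) (auto intro!: cont_linear_intros)
  ultimately show ?case
    using left by (simp add: tmul_left_pushforward lin_extend_fun_add lin_extend_lie_elem bracket_simps)
next
  case (right f t)
  have "lin_extend (\<lambda>s. bracket (leibniz_tree d g s) (lie_elem t)) f = bracket (lin_extend (leibniz_tree d g) f) (lie_elem t)"
    by (subst cont_linear_lin_extend[of "\<lambda>x. bracket x _"]) (auto intro!: cont_linear_intros)
  moreover have "lin_extend (\<lambda>s. sg (d * tdeg s) (bracket (lie_elem s) (leibniz_tree d g t))) f
      = bracket (lin_extend lie_elem (\<lambda>s. sg (d * tdeg s + 0) (f s))) (leibniz_tree d g t)"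
    by (subst cont_linear_lin_extend[of "\<lambda>x. bracket x _"]) (auto intro!: cont_linear_intros simp: lin_extend_fun_sg)
  ultimately show ?case
    using right lie_ideal_sign'[OF right(1), of d 0]
    by (simp add: tmul_right_pushforward lin_extend_fun_add lin_extend_lie_elem bracket_simps)
qed (simp_all add: lin_extend_scale del: zero_fun_apply)

text \<open>The product rule comes from \<open>product_derivation_exists\<close>. The bracket rule
  holds by construction on pairs of trees and is spread by \<open>bilinear_induct\<close>; for odd d
  it can be stated with \<open>parity\<close>, hence linearly in both arguments.\<close>

lemma derivation_exists:
  fixes g :: "'i \<Rightarrow> ('i::graded_basis, 'k::field) ext_lie"
  assumes "odd d" and gr: "\<And>i. g i \<in> gr (wdeg i + 1 + d)" and zero: "\<And>i. i \<notin> gbasis \<Longrightarrow> g i = 0"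
  shows "\<exists>T. derivation d T \<and> (\<forall>i. T (gen i) = g i)"
proof -
  \<comment> \<open>The loss of weight is 1: one leaf is replaced by a value of g, about whose
    weight nothing is assumed.\<close>
  have "\<exists>T. product_derivation d T \<and> (\<forall>p. \<forall>x\<in>Fil p. T x \<in> Fil (p - 1)) \<and>
      (\<forall>t. T (lie_elem t) = leibniz_tree d g t)"
  proof (rule product_derivation_exists)
    show "leibniz_tree d g t \<in> Fil (twt t - 1)" for t
    proof (induction t)
      case (Br s t)
      have "bracket (leibniz_tree d g s) (lie_elem t) \<in> Fil (twt s - 1 + twt t)"
        by (intro bracket_Fil Br.IH lie_elem_Fil)
      moreover have "bracket (lie_elem s) (leibniz_tree d g t) \<in> Fil (twt s + (twt t - 1))"
        by (intro bracket_Fil Br.IH lie_elem_Fil)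
      ultimately show ?case
        by (auto intro!: Fil_add Fil_sg elim!: Fil_mono)
    qed simp
    show "leibniz_tree d g t = 0" if "\<not> set_ltree t \<subseteq> gbasis" for t
      using that
    proof (induction t)
      case (Br s t)
      then show ?case
        by (cases "set_ltree s \<subseteq> gbasis") (simp_all add: lie_elem_zero bracket_simps)
    qed (simp add: zero)
  qed (use gr in \<open>auto intro: leibniz_tree_gr leibniz_tree_lie_ideal\<close>)
  then obtain T where T: "product_derivation d T" "\<And>t. T (lie_elem t) = leibniz_tree d g t"
    by blast
  note TD = product_derivationD[OF T(1)]
  note [cont_linear_intros] = cont_linear_comp[OF TD(1)] TD(1)
  have br: "T (bracket a b) = bracket (T a) b - bracket (parity a) (T b)" for a b
  proof (rule bilinear_induct[of "\<lambda>a b. T (bracket a b) = bracket (T a) b - bracket (parity a) (T b)"])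
    show "closed_subspace {b. T (bracket a b) = bracket (T a) b - bracket (parity a) (T b)}"
        "closed_subspace {a. T (bracket a b) = bracket (T a) b - bracket (parity a) (T b)}" for a b
      by (intro closed_subspace_eq cont_linear_intros)+
    show "T (bracket a 1) = bracket (T a) 1 - bracket (parity a) (T 1)" for a
      by (simp add: bracket_one TD(4) bracket_simps cont_linear_simps[OF TD(1)])
    show "T (bracket (lie_elem s) (lie_elem t))
        = bracket (T (lie_elem s)) (lie_elem t) - bracket (parity (lie_elem s)) (T (lie_elem t))" for s t
      using \<open>odd d\<close> by (simp add: bracket_lie_elem T(2) parity_gr[OF lie_elem_gr] bracket_simps)
        (simp add: sg_def)
  next
    fix a b c :: "('i, 'k) ext_lie" and m n
    assume a: "a \<in> gr m" and b: "b \<in> gr n"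
    assume ab: "T (bracket a b) = bracket (T a) b - bracket (parity a) (T b)"
    show "T (bracket b a) = bracket (T b) a - bracket (parity b) (T a)"
      using ab \<open>odd d\<close> bracket_antisym[OF b a] bracket_antisym[OF TD(2)[OF a] b]
        bracket_antisym[OF a TD(2)[OF b]]
      by (cases "even m"; cases "even n")
        (simp_all add: parity_gr[OF a] parity_gr[OF b] sg_def bracket_simps cont_linear_simps[OF TD(1)])
    assume ac: "T (bracket a c) = bracket (T a) c - bracket (parity a) (T c)"
    show "T (bracket a (b * c)) = bracket (T a) (b * c) - bracket (parity a) (T (b * c))"
      using \<open>odd d\<close>
      by (cases "even m"; cases "even n")
        (simp_all add: ab ac parity_gr[OF a] sg_def bracket_simps cont_linear_simps[OF TD(1)] TD(3)[OF b]
          TD(3)[OF bracket_gr[OF a b]] bracket_times_right[OF a b] bracket_times_right[OF TD(2)[OF a] b]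
          bracket_times_right[OF a TD(2)[OF b]] algebra_simps)
  qed
  have "derivation d T"
    unfolding derivation_def operator_iff_cont_linear has_degree_def
  proof (intro conjI allI ballI)
    fix m and a b :: "('i, 'k) ext_lie"
    assume "a \<in> gr m"
    then show "T (bracket a b) = bracket (T a) b + sg (d * (m - 1)) (bracket a (T b))"
      using \<open>odd d\<close> by (simp add: br parity_gr sg_def bracket_simps)
  qed (simp_all add: TD)
  then show ?thesis
    using T(2) by (auto simp: gen_def)
qed

text \<open>The condition of square zero is left out, so that the class is stable under adding
  derivations of degree -1 and thus contains both \<Delta>_Lie and E.\<close>

definition BV_like ::
  "(('i::graded_basis, 'k::field) ext_lie \<Rightarrow> ('i, 'k) ext_lie) \<Rightarrow> bool" where
  "BV_like E \<longleftrightarrow> cont_linear E \<and> (\<forall>n. \<forall>x\<in>gr n. E x \<in> gr (n - 1)) \<and>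
     (\<forall>m. \<forall>a\<in>gr m. \<forall>b. E (a * b) = E a * b + sg m (a * E b) + sg m (bracket a b)) \<and>
     (\<forall>m. \<forall>a\<in>gr m. \<forall>b. E (bracket a b) = bracket (E a) b + sg (m - 1) (bracket a (E b)))"

lemma BV_likeD:
  assumes "BV_like E"
  shows "cont_linear E" "x \<in> gr n \<Longrightarrow> E x \<in> gr (n - 1)"
    "a \<in> gr m \<Longrightarrow> E (a * b) = E a * b + sg m (a * E b) + sg m (bracket a b)"
    "a \<in> gr m \<Longrightarrow> E (bracket a b) = bracket (E a) b + sg (m - 1) (bracket a (E b))"
    "E 1 = 0"
proof -
  show *: "cont_linear E" "x \<in> gr n \<Longrightarrow> E x \<in> gr (n - 1)"
    "a \<in> gr m \<Longrightarrow> E (a * b) = E a * b + sg m (a * E b) + sg m (bracket a b)"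
    "a \<in> gr m \<Longrightarrow> E (bracket a b) = bracket (E a) b + sg (m - 1) (bracket a (E b))"
    for x n a b m
    using assms by (auto simp: BV_like_def)
  show "E 1 = 0"
    using *(3)[OF one_gr, of 1] by (simp add: bracket_one)
qed

lemma BV_like_Delta_Lie: "BV_like Delta_Lie"
  by (simp add: BV_like_def cont_linear_Delta_Lie Delta_Lie_gr Delta_Lie_times Delta_Lie_bracket)

lemma BV_like_add_derivation:
  assumes E: "BV_like E" and T: "derivation (-1) T"
  shows "BV_like (\<lambda>x. E x + T x)"
  unfolding BV_like_def
proof (intro conjI allI ballI)
  show "cont_linear (\<lambda>x. E x + T x)"
    by (intro cont_linear_intros BV_likeD(1)[OF E] derivationD(1)[OF T])
  show "E x + T x \<in> gr (n - 1)" if "x \<in> gr n" for x n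
    using BV_likeD(2)[OF E that] derivationD(2)[OF T that] by (simp add: gr_add)
  fix m and a b :: "('a, 'b) ext_lie" assume a: "a \<in> gr m"
  show "E (a * b) + T (a * b) = (E a + T a) * b + sg m (a * (E b + T b)) + sg m (bracket a b)"
    by (simp add: BV_likeD(3)[OF E a] derivationD(3)[OF T a] sg_def algebra_simps)
  show "E (bracket a b) + T (bracket a b)
      = bracket (E a + T a) b + sg (m - 1) (bracket a (E b + T b))"
    by (simp add: BV_likeD(4)[OF E a] derivationD(4)[OF T a] sg_def bracket_simps algebra_simps)
qed

text \<open>E violates the product rule by a signed bracket. As T is a derivation of the bracket,
  the violations cancel in T E + E T, which is therefore a derivation of both operations and is
  determined by generators.\<close>

lemma derivation_anticommute:
  assumes T: "derivation d T" "odd d" and E: "BV_like E"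
    and gen: "\<And>i. T (E (gen i)) + E (T (gen i)) = 0"
  shows "T (E x) + E (T x) = 0"
proof -
  note TD = derivationD[OF T(1)] and ED = BV_likeD[OF E]
  have "x \<in> {x. T (E x) + E (T x) = 0}"
  proof (rule gerstenhaber_induct)
    show "closed_subspace {x. T (E x) + E (T x) = 0}"
      by (intro closed_subspace_eq cont_linear_intros cont_linear_comp[OF TD(1)] cont_linear_comp[OF ED(1)] TD(1) ED(1))
  next
    fix a b :: "('a, 'b) ext_lie" and m n
    assume a: "a \<in> gr m" and b: "b \<in> gr n"
    assume "a \<in> {x. T (E x) + E (T x) = 0}" "b \<in> {x. T (E x) + E (T x) = 0}"
    then have *: "T (E a) = - E (T a)" "T (E b) = - E (T b)"
      by (simp_all add: eq_neg_iff_add_eq_0)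
    show "a * b \<in> {x. T (E x) + E (T x) = 0}"
      using \<open>odd d\<close> by (cases "even m")
        (simp_all add: ED(3)[OF a] TD(3)[OF a] TD(4)[OF a] cont_linear_simps[OF TD(1)] cont_linear_simps[OF ED(1)]
          TD(3)[OF ED(2)[OF a]] ED(3)[OF TD(2)[OF a]] * sg_def algebra_simps)
    show "bracket a b \<in> {x. T (E x) + E (T x) = 0}"
      using \<open>odd d\<close> by (cases "even m")
        (simp_all add: ED(4)[OF a] TD(4)[OF a] cont_linear_simps[OF TD(1)] cont_linear_simps[OF ED(1)]
          TD(4)[OF ED(2)[OF a]] ED(4)[OF TD(2)[OF a]] * sg_def bracket_simps algebra_simps)
  qed (simp_all add: gen TD(5) ED(5) cont_linear_simps[OF TD(1)] cont_linear_simps[OF ED(1)])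
  then show ?thesis by simp
qed

text \<open>For odd d the mixed terms, with T applied once to each argument, cancel in pairs. The
  square is treated directly, not as half of a commutator, so characteristic 2 causes no
  trouble.\<close>

lemma derivation_square_zero:
  assumes T: "derivation d T" "odd d" and gen: "\<And>i. T (T (gen i)) = 0"
  shows "T (T x) = 0"
proof -
  note TD = derivationD[OF T(1)]
  have "x \<in> {x. T (T x) = 0}"
  proof (rule gerstenhaber_induct)
    show "closed_subspace {x. T (T x) = 0}"
      by (intro closed_subspace_eq cont_linear_intros cont_linear_comp[OF TD(1)] TD(1))
  next
    fix a b :: "('a, 'b) ext_lie" and m n
    assume a: "a \<in> gr m" and b: "b \<in> gr n"
    assume *: "a \<in> {x. T (T x) = 0}" "b \<in> {x. T (T x) = 0}"
    show "a * b \<in> {x. T (T x) = 0}"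
      using * \<open>odd d\<close> by (cases "even m")
        (simp_all add: TD(3)[OF a] cont_linear_simps[OF TD(1)] TD(3)[OF TD(2)[OF a]] sg_def)
    show "bracket a b \<in> {x. T (T x) = 0}"
      using * \<open>odd d\<close> by (cases "even m")
        (simp_all add: TD(4)[OF a] cont_linear_simps[OF TD(1)] TD(4)[OF TD(2)[OF a]] sg_def bracket_simps)
  qed (simp_all add: gen TD(5) cont_linear_simps[OF TD(1)])
  then show ?thesis by simp
qed

section \<open>The embedding of the undeformed algebra\<close>

lemma map_E0_simps [simp]:
  "tdeg (map_ltree E0 t) = tdeg t" "twt (map_ltree E0 t) = twt t"
  by (induction t) (simp_all add: wdeg_def)

lemma map_E0_admissible: "set_ltree (map_ltree E0 t) \<subseteq> gbasis \<longleftrightarrow> set_ltree t \<subseteq> gbasis"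
  by (auto simp: ltree.set_map gbasis_eps_def)

text \<open>Relabelling by \<open>E0\<close> keeps the degrees of leaves, so the signs in the
  relations are unchanged.\<close>

lemma map_E0_lie_ideal:
  "f \<in> lie_ideal \<Longrightarrow> lin_extend (\<lambda>t. lie_elem (map_ltree E0 t)) f = 0"
proof (induction rule: lie_ideal.induct)
  case (add f g)
  then show ?case by (simp only: lin_extend_add lie_ideal_finite_support add_0)
next
  case (antisym s t)
  show ?case
    by (simp add: lin_extend_add lin_extend_sg lie_elem_relations(1)[of "map_ltree E0 s" "map_ltree E0 t"]
        del: plus_fun_apply)
next
  case (jacobi s t u)
  show ?case
    by (simp add: lin_extend_diff lin_extend_sg 
        lie_elem_relations(2)[of "map_ltree E0 s" "map_ltree E0 t" "map_ltree E0 u"] del: minus_apply)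
next
  case (left f t)
  have "lin_extend (\<lambda>s. bracket (lie_elem (map_ltree E0 t)) (lie_elem (map_ltree E0 s))) f
      = bracket (lie_elem (map_ltree E0 t)) (lin_extend (\<lambda>s. lie_elem (map_ltree E0 s)) f)"
    by (subst cont_linear_lin_extend[of "bracket _"]) (auto intro!: cont_linear_bracket_right cont_linear_id)
  then show ?case
    using left by (simp add: tmul_left_pushforward bracket_simps flip: bracket_lie_elem)
next
  case (right f t)
  have "lin_extend (\<lambda>s. bracket (lie_elem (map_ltree E0 s)) (lie_elem (map_ltree E0 t))) f
      = bracket (lin_extend (\<lambda>s. lie_elem (map_ltree E0 s)) f) (lie_elem (map_ltree E0 t))"
    by (subst cont_linear_lin_extend[of "\<lambda>x. bracket x _"]) (auto intro!: cont_linear_intros)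
  then show ?case
    using right by (simp add: tmul_right_pushforward bracket_simps flip: bracket_lie_elem)
qed (simp_all add: lin_extend_scale del: zero_fun_apply)

text \<open>The morphism \<iota>, introduced as the linear map that relabels leaves; its
  compatibility with product, bracket and \<Delta>_Lie is established afterwards.\<close>

definition embed :: "('i::graded_basis, 'k::field) ext_lie \<Rightarrow> ('i eps, 'k) ext_lie" where
  "embed = (SOME T. cont_linear T \<and> (\<forall>xs. T (monomial xs) = monomial (map (map_ltree E0) xs)))"

lemma embed:
  "cont_linear (embed :: ('i::graded_basis, 'k::field) ext_lie \<Rightarrow> _)"
  "embed (monomial xs) = (monomial (map (map_ltree E0) xs) :: ('i eps, 'k) ext_lie)"
proof -
  have "\<exists>T :: ('i, 'k) ext_lie \<Rightarrow> _.
      cont_linear T \<and> (\<forall>p. \<forall>x\<in>Fil p. T x \<in> Fil (p - 0)) \<and> (\<forall>xs. T (monomial xs) = monomial (map (map_ltree E0) xs))"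
  proof (rule linear_extension)
    fix xs ys :: "'i ltree list" and s t
    show "monomial (map (map_ltree E0) (xs @ [s, t] @ ys)) = sg ((tdeg s + 1) * (tdeg t + 1))
        (monomial (map (map_ltree E0) (xs @ [t, s] @ ys)) :: ('i eps, 'k) ext_lie)"
    proof -
      have "lie_elem (map_ltree E0 s) * (lie_elem (map_ltree E0 t) * x)
          = sg ((tdeg s + 1) * (tdeg t + 1)) (lie_elem (map_ltree E0 t) * (lie_elem (map_ltree E0 s) * x))"
        for x :: "('i eps, 'k) ext_lie"
        using lie_elem_swap[of "map_ltree E0 s" "map_ltree E0 t", where 'b = 'k]
        by (simp flip: mult.assoc)
      then show ?thesis by (simp add: monomial_append monomial_Cons)
    qed
    show "lin_extend (\<lambda>t. monomial (map (map_ltree E0) (xs @ [t] @ ys))) f = (0 :: ('i eps, 'k) ext_lie)"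
      if "f \<in> lie_ideal" for f
      using map_E0_lie_ideal[OF that]
      by (simp add: monomial_append monomial_Cons flip: lin_extend_times mult.assoc)
    show "monomial (map (map_ltree E0) xs) = (0 :: ('i eps, 'k) ext_lie)" if "\<not> admissible xs"
      using that by (intro monomial_nonadmissible) (simp add: admissible_def map_E0_admissible)
    have "mwt (map (map_ltree E0) xs) = mwt xs"
      by (induction xs) simp_all
    then show "monomial (map (map_ltree E0) xs) \<in> (Fil (mwt xs - 0) :: ('i eps, 'k) ext_lie set)"
      using monomial_Fil[of "map (map_ltree E0) xs"] by simp
  qed
  then have "\<exists>T :: ('i, 'k) ext_lie \<Rightarrow> _. cont_linear T \<and> (\<forall>xs. T (monomial xs) = monomial (map (map_ltree E0) xs))"
    by blast
  from someI_ex[OF this]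
  show "cont_linear (embed :: ('i, 'k) ext_lie \<Rightarrow> _)"
      "embed (monomial xs) = (monomial (map (map_ltree E0) xs) :: ('i eps, 'k) ext_lie)"
    unfolding embed_def by auto
qed

lemmas cont_linear_embed = embed(1) and embed_monomial = embed(2)

lemmas cont_linear_embed' [cont_linear_intros] = cont_linear_comp[OF cont_linear_embed]
lemmas embed_simps = cont_linear_simps[OF cont_linear_embed]

lemma mdeg_map_E0: "mdeg (map (map_ltree E0) xs) = mdeg xs"
  by (induction xs) simp_all

lemma embed_gr: "x \<in> gr n \<Longrightarrow> embed x \<in> gr n"
proof -
  assume x: "x \<in> gr n"
  have base: "monomial (map (map_ltree E0) xs) \<in> gr (mdeg xs)" for xs :: "'a ltree list"
    using monomial_gr[of "map (map_ltree E0) xs"] by (simp add: mdeg_map_E0)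
  have "x \<in> {x. embed x \<in> gr n}"
    by (rule gr_induct[OF closed_subspace_gr[OF cont_linear_embed] _ x]) (auto simp: embed_monomial base)
  then show ?thesis by simp
qed

lemma embed_one: "embed 1 = 1"
  using embed_monomial[of "[]"] by (simp add: monomial_Nil)

lemma embed_lie_elem: "embed (lie_elem t) = lie_elem (map_ltree E0 t)"
  using embed_monomial[of "[t]"] by (simp add: lie_elem_monomial)

lemma embed_gen: "embed (gen i) = gen (E0 i)"
  by (simp add: gen_def embed_lie_elem)

lemma embed_parity: "embed (parity x) = parity (embed x)"
proof -
  have "x \<in> {x. embed (parity x) = parity (embed x)}"
    by (rule monomial_induct[OF closed_subspace_eq])
      (auto intro!: cont_linear_intros cont_linear_embed simp: parity_gr[OF monomial_gr] parity_gr[OF embed_gr[OF monomial_gr]] embed_simps)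
  then show ?thesis by simp
qed

lemma embed_times: "embed (a * b) = embed a * embed b"
proof -
  have "b \<in> {b. embed (monomial xs * b) = embed (monomial xs) * embed b}" for xs
    by (rule monomial_induct[OF closed_subspace_eq])
      (auto intro!: cont_linear_intros cont_linear_embed simp: embed_monomial monomial_append simp flip: monomial_append)
  note base = this[simplified]
  have "a \<in> {a. embed (a * b) = embed a * embed b}"
    by (rule monomial_induct[OF closed_subspace_eq]) (auto intro!: cont_linear_intros cont_linear_embed simp: base)
  then show ?thesis by simp
qed

lemma embed_bracket: "embed (bracket a b) = bracket (embed a) (embed b)"
proof (rule bilinear_induct[of "\<lambda>a b. embed (bracket a b) = bracket (embed a) (embed b)"])
  show "closed_subspace {b. embed (bracket a b) = bracket (embed a) (embed b)}"
    "closed_subspace {a. embed (bracket a b) = bracket (embed a) (embed b)}" for a b :: "('a, 'b) ext_lie"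
    by (intro closed_subspace_eq cont_linear_intros cont_linear_embed)+
  show "embed (bracket b a) = bracket (embed b) (embed a)"
    if "a \<in> gr m" "b \<in> gr n" "embed (bracket a b) = bracket (embed a) (embed b)"
    for a b :: "('a, 'b) ext_lie" and m n
    using bracket_antisym[OF that(2,1)] bracket_antisym[OF embed_gr[OF that(2)] embed_gr[OF that(1)]] that(3)
    by (simp add: embed_simps)
qed (simp_all add: embed_one bracket_one embed_times embed_simps bracket_times_right
    bracket_times_right[OF embed_gr embed_gr] bracket_lie_elem embed_lie_elem)

text \<open>Both composites obey the same Batalin-Vilkovisky identity along \<iota> and vanish on
  generators. This lets \<iota>(D x) be expressed by operators on the deformed algebra.\<close>

lemma embed_Delta_Lie: "embed (Delta_Lie x) = Delta_Lie (embed x)"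
proof -
  have "x \<in> {x. embed (Delta_Lie x) = Delta_Lie (embed x)}"
    by (rule gerstenhaber_induct[OF closed_subspace_eq])
      (auto intro!: cont_linear_intros cont_linear_embed cont_linear_Delta_Lie
        simp: Delta_Lie_one embed_one embed_simps gen_def Delta_Lie_lie_elem embed_lie_elem
          Delta_Lie_times Delta_Lie_times[OF embed_gr] Delta_Lie_bracket Delta_Lie_bracket[OF embed_gr]
          embed_times embed_bracket)
  then show ?thesis by simp
qed

section \<open>The canonical deformation\<close>

lemma gen_gr: "gen i \<in> gr (wdeg i + 1)"
  using lie_elem_gr[of "Leaf i"] by (simp add: gen_def)

lemma gen_Fil: "gen i \<in> Fil (Suc 0)"
  using lie_elem_Fil[of "Leaf i"] by (simp add: gen_def)

lemma gen_zero: "i \<notin> gbasis \<Longrightarrow> gen i = 0"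
  by (simp add: gen_def lie_elem_zero)

lemma d_eps:
  "derivation (-1) (d_eps :: ('i::graded_basis eps, 'k::field) ext_lie \<Rightarrow> _)"
  "d_eps (gen (E0 i)) = (gen (E1 i) :: ('i eps, 'k) ext_lie)"
  "d_eps (gen (E1 i)) = (0 :: ('i eps, 'k) ext_lie)"
proof -
  let ?g = "case_eps (\<lambda>i. gen (E1 i)) (\<lambda>i. 0) :: 'i eps \<Rightarrow> ('i eps, 'k) ext_lie"
  \<comment> \<open>The degrees fit because \<open>wdeg (E1 i)\<close> is one less than
    \<open>wdeg (E0 i)\<close>.\<close>
  have "?g j \<in> gr (wdeg j + 1 + -1)" for j
    using gen_gr[of "E1 i" for i :: 'i]
    by (cases j) (auto simp: wdeg_def algebra_simps)
  moreover have "?g j = 0" if "j \<notin> gbasis" for j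
    using that by (cases j) (auto simp: gbasis_eps_def image_iff gen_zero)
  ultimately obtain T :: "('i eps, 'k) ext_lie \<Rightarrow> _"
    where T: "derivation (-1) T" "\<And>j. T (gen j) = ?g j"
    using derivation_exists[of "-1" ?g] by auto
  let ?P = "\<lambda>T :: ('i eps, 'k) ext_lie \<Rightarrow> _.
    derivation (-1) T \<and> (\<forall>i. T (gen (E0 i)) = gen (E1 i) \<and> T (gen (E1 i)) = 0)"
  have "?P T" by (simp add: T)
  moreover have "T' = T" if "?P T'" for T'
  proof (rule derivation_unique)
    show "T' (gen j) = T (gen j)" for j
      using that by (cases j) (auto simp: T)
  qed (use that T in auto)
  ultimately have "?P d_eps"
    unfolding d_eps_def by (rule theI)
  then show "derivation (-1) (d_eps :: ('i eps, 'k) ext_lie \<Rightarrow> _)"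
    "d_eps (gen (E0 i)) = (gen (E1 i) :: ('i eps, 'k) ext_lie)"
    "d_eps (gen (E1 i)) = (0 :: ('i eps, 'k) ext_lie)"
    by auto
qed

lemmas derivation_d_eps = d_eps(1) and d_eps_gen = d_eps(2,3)

lemmas cont_linear_d_eps = derivationD(1)[OF derivation_d_eps]
lemmas cont_linear_d_eps' [cont_linear_intros] = cont_linear_comp[OF cont_linear_d_eps]
lemmas d_eps_simps = cont_linear_simps[OF cont_linear_d_eps]

text \<open>Continuity permits a loss of weight, whereas the components of a homotopy BV structure
  must preserve each \<open>Fil p\<close>. Here generators go to generators or to zero, so brackets
  and products keep their weight.\<close>

lemma d_eps_Fil:
  fixes x :: "('i::graded_basis eps, 'k::field) ext_lie"
  assumes "x \<in> Fil p"
  shows "d_eps x \<in> Fil p"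
proof -
  have lie: "d_eps (lie_elem t) \<in> (Fil (twt t) :: ('i eps, 'k) ext_lie set)" for t
  proof (induction t)
    case (Leaf j)
    then show ?case
      by (cases j) (simp_all add: d_eps_gen gen_Fil flip: gen_def)
  next
    case (Br s t)
    show ?case
      using bracket_Fil[OF Br.IH(1) lie_elem_Fil[of t]] bracket_Fil[OF lie_elem_Fil[of s] Br.IH(2)]
      by (auto simp: derivationD(4)[OF derivation_d_eps lie_elem_gr] intro!: Fil_add Fil_sg
          simp flip: bracket_lie_elem)
  qed
  have monomial: "d_eps (monomial xs) \<in> (Fil (mwt xs) :: ('i eps, 'k) ext_lie set)" for xs
  proof (induction xs)
    case (Cons t xs)
    show ?case
      using Fil_times[OF lie[of t] monomial_Fil[of xs]] Fil_times[OF lie_elem_Fil[of t] Cons.IH]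
      by (auto simp: monomial_Cons derivationD(3)[OF derivation_d_eps lie_elem_gr] intro!: Fil_add Fil_sg)
  qed (simp add: monomial_Nil derivationD(5)[OF derivation_d_eps])
  obtain f where f: "x = abs_ext_lie f" "\<And>xs. mwt xs < p \<Longrightarrow> f xs = 0"
    using assms by (auto simp: Fil_def)
  have "x \<in> {x. d_eps x \<in> Fil p}"
    unfolding f(1)
  proof (rule abs_in_closed_subspace[OF closed_subspace_Fil[OF cont_linear_d_eps]])
    show "monomial xs \<in> {x :: ('i eps, 'k) ext_lie. d_eps x \<in> Fil p}" if "f xs \<noteq> 0" for xs
      using that f(2)[of xs] Fil_mono[OF monomial[of xs]] by (cases "mwt xs < p") auto
  qed
  then show ?thesis by simp
qed

lemma vector_space_eps_smul: "vector_space eps_smul"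
  by unfold_locales (auto simp: plus_prod_def)

text \<open>For a morphism F with the prescribed values, the \<epsilon>-free part of F on an element
  x is multiplicative in x, and the \<epsilon>-coefficient is an odd derivation along that part.
  Generators determine both, and \<epsilon>-linearity gives the values on multiples of
  \<epsilon>.\<close>

lemma Phi_eq:
  fixes x y :: "('i::graded_basis, 'k::field) ext_lie"
  shows "Phi (x, y) = (embed x, d_eps (embed x) + embed y)"
proof -
  let ?F = "\<lambda>(x, y). (embed x, d_eps (embed x) + embed y)
    :: ('i eps, 'k) ext_lie_eps"
  let ?P = "\<lambda>F :: ('i, 'k) ext_lie_eps \<Rightarrow> ('i eps, 'k) ext_lie_eps.
    eps_morphism F \<and> (\<forall>i. F (gen i, 0) = (gen (E0 i), gen (E1 i)))"
  have "?P ?F"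
    unfolding eps_morphism_def
  proof (intro conjI allI ballI)
    show "Vector_Spaces.linear eps_smul eps_smul ?F"
      by (auto simp: Vector_Spaces.linear_iff vector_space_eps_smul embed_simps d_eps_simps algebra_simps)
    show "\<exists>q. \<forall>z\<in>Fil q \<times> Fil q. ?F z \<in> Fil p \<times> Fil p" for p
    proof -
      obtain q where "\<forall>x::('i, 'k) ext_lie\<in>Fil q. embed x \<in> Fil p"
        using cont_linear_embed unfolding cont_linear_def by blast
      then show ?thesis
        by (intro exI[of _ q]) (auto intro!: Fil_add d_eps_Fil)
    qed
    show "?F z \<in> gr n \<times> gr (n - 1)" if "z \<in> gr n \<times> gr (n - 1)" for n z
      using that derivationD(2)[OF derivation_d_eps embed_gr] by (auto intro!: gr_add embed_gr)
    show "?F (eps_mult z) = eps_mult (?F z)" for z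
      by (cases z) (simp add: embed_simps d_eps_simps)
    show "?F (1, 0) = (1, 0)"
      by (simp add: embed_simps embed_one derivationD(5)[OF derivation_d_eps])
    show "?F (eps_times y z) = eps_times (?F y) (?F z)" for y z
      by (cases y; cases z) (simp add: embed_times embed_simps embed_parity
          derivation_parity(1)[OF derivation_d_eps] algebra_simps)
    show "?F (eps_bracket y z) = eps_bracket (?F y) (?F z)" for y z
      by (cases y; cases z) (simp add: embed_bracket embed_simps embed_parity bracket_simps
          derivation_parity(2)[OF derivation_d_eps] algebra_simps)
    show "?F (gen i, 0) = (gen (E0 i), gen (E1 i))" for i
      by (simp add: embed_gen embed_simps d_eps_gen)
  qed
  moreover have "F = ?F" if "?P F" for F
  proof
    have F: "eps_morphism F" "\<And>i. F (gen i, 0) = (gen (E0 i), gen (E1 i))"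
      using that by auto
    have F_add: "F (y + z) = F y + F z" and F_smul: "F (eps_smul c z) = eps_smul c (F z)"
      and F_mult: "F (eps_mult z) = eps_mult (F z)" and F_one: "F (1, 0) = (1, 0)"
      and F_times: "F (eps_times y z) = eps_times (F y) (F z)"
      and F_bracket: "F (eps_bracket y z) = eps_bracket (F y) (F z)" for y z c
      using F(1) unfolding eps_morphism_def Vector_Spaces.linear_iff by blast+
    have F_cont: "\<exists>q. \<forall>z\<in>Fil q \<times> Fil q. F z \<in> Fil p \<times> Fil p" for p
      using F(1) by (auto simp: eps_morphism_def)
    define f g where "f x = fst (F (x, 0))" and "g x = snd (F (x, 0))" for x
    have F_fg: "F (x, 0) = (f x, g x)" for x
      by (simp add: f_def g_def)
    have cont_linear: "cont_linear f" "cont_linear g"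
      unfolding cont_linear_def
    proof -
      have "F (x + y, 0) = F (x, 0) + F (y, 0)" for x y
        using F_add[of "(x, 0)" "(y, 0)"] by simp
      moreover have "F (smul c x, 0) = eps_smul c (F (x, 0))" for c x
        using F_smul[of c "(x, 0)"] by simp
      moreover have "\<exists>q. \<forall>x\<in>Fil q. f x \<in> Fil p \<and> g x \<in> Fil p" for p
      proof -
        obtain q where "\<forall>z\<in>Fil q \<times> Fil q. F z \<in> Fil p \<times> Fil p"
          using F_cont by blast
        then have "\<forall>x\<in>Fil q. F (x, 0) \<in> Fil p \<times> Fil p" by simp
        then show ?thesis by (auto simp: F_fg)
      qed
      ultimately show "(\<forall>x y. f (x + y) = f x + f y) \<and> (\<forall>c x. f (smul c x) = smul c (f x)) \<and>
            (\<forall>p. \<exists>q. \<forall>x\<in>Fil q. f x \<in> Fil p)"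
          "(\<forall>x y. g (x + y) = g x + g y) \<and> (\<forall>c x. g (smul c x) = smul c (g x)) \<and>
            (\<forall>p. \<exists>q. \<forall>x\<in>Fil q. g x \<in> Fil p)"
        by (auto simp: F_fg) metis+
    qed
    have fg_times: "f (a * b) = f a * f b" "g (a * b) = g a * f b + parity (f a) * g b" for a b
      using F_times[of "(a, 0)" "(b, 0)"] by (simp_all add: F_fg cont_linear_simps[OF cont_linear_parity'])
    have fg_bracket: "f (bracket a b) = bracket (f a) (f b)"
        "g (bracket a b) = bracket (g a) (f b) - bracket (parity (f a)) (g b)" for a b
      using F_bracket[of "(a, 0)" "(b, 0)"]
      by (simp_all add: F_fg cont_linear_simps[OF cont_linear_parity'] bracket_simps)
    have fg_gen: "f (gen i) = gen (E0 i)" "g (gen i) = gen (E1 i)" for i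
      using F(2)[of i] by (simp_all add: F_fg)
    have fg_one: "f 1 = 1" "g 1 = 0"
      using F_one by (simp_all add: F_fg)
    have f: "f x = embed x" for x
    proof -
      have "x \<in> {x. f x = embed x}"
        by (rule gerstenhaber_induct[OF closed_subspace_eq[OF cont_linear(1) cont_linear_embed]])
          (simp_all add: fg_gen fg_one embed_one embed_gen embed_times fg_times embed_bracket fg_bracket)
      then show ?thesis by simp
    qed
    have g: "g x = d_eps (embed x)" for x
    proof -
      have "x \<in> {x. g x = d_eps (embed x)}"
        by (rule gerstenhaber_induct[OF closed_subspace_eq[OF cont_linear(2) cont_linear_comp[OF cont_linear_d_eps cont_linear_embed]]])
          (simp_all add: fg_gen fg_one embed_one embed_gen embed_times fg_times embed_bracket fg_bracket f d_eps_gen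
            derivation_parity[OF derivation_d_eps] derivationD(5)[OF derivation_d_eps])
      then show ?thesis by simp
    qed
    fix z show "F z = ?F z"
    proof (cases z)
      case (Pair x y)
      have "F (x, y) = F (x, 0) + F (0, y)"
        using F_add[of "(x, 0)" "(0, y)"] by simp
      also have "F (0, y) = eps_mult (F (y, 0))"
        using F_mult[of "(y, 0)"] by simp
      finally show ?thesis
        by (simp add: F_fg f g Pair)
    qed
  qed
  ultimately have "Phi = ?F"
    unfolding Phi_def by (rule the_equality)
  then have "Phi (x, y) = ?F (x, y)"
    by (rule fun_cong)
  then show ?thesis by (simp only: case_prod_conv)
qed

lemma diff_op_zero: "diff_op n d (\<lambda>x. 0)"
  by (induction n arbitrary: d) auto

text \<open>The commutator of T with multiplication by a is multiplication by T a, which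
  graded-commutes with every further multiplication.\<close>

lemma diff_op_derivation: "derivation d T \<Longrightarrow> diff_op 1 d T"
proof -
  assume T: "derivation d T"
  have "T a * (b * x) = sg ((d + m) * n) (b * (T a * x))" if "a \<in> gr m" "b \<in> gr n" for a b x m n
    using graded_commute[OF derivationD(2)[OF T that(1)] that(2)]
    by (simp add: algebra_simps flip: mult.assoc)
  then show ?thesis
    by (simp add: derivationD(3)[OF T])
qed

theorem proposition2p7:
  fixes \<delta> :: "('i::graded_basis, 'k::field) ext_lie \<Rightarrow> ('i, 'k) ext_lie"
  assumes "G_infinity \<delta>"
  shows "(\<exists>!P. is_partial_can \<delta> P) \<and> G_infinity (partial_can \<delta>) \<and>
    BV_infinity (partial_can \<delta>) (\<lambda>x. partial_can \<delta> x + Delta_Lie x + d_eps x)"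
proof -
  have \<delta>: "derivation 1 \<delta>" "\<And>x. \<delta> (\<delta> x) = 0"
    using assms by (auto simp: G_infinity_def)
  note \<delta>D = derivationD[OF \<delta>(1)]
  define E where "E x = Delta_Lie x + d_eps x" for x :: "('i eps, 'k) ext_lie"
  have E: "BV_like E"
    unfolding E_def by (rule BV_like_add_derivation[OF BV_like_Delta_Lie derivation_d_eps])
  note ED = BV_likeD[OF E]
  have Delta_gen: "Delta_Lie (gen j) = 0" for j :: "'i eps"
    by (simp add: gen_def Delta_Lie_lie_elem)
  have E_gen: "E (gen (E0 i)) = gen (E1 i)" "E (gen (E1 i)) = 0" for i
    by (simp_all add: E_def Delta_gen d_eps_gen)
  \<comment> \<open>On generators both summands vanish, as \<open>d_eps\<close> sends them to
    generators or zero and \<Delta>_Lie kills generators.\<close>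
  have "d_eps (Delta_Lie x) + Delta_Lie (d_eps x) = 0" for x :: "('i eps, 'k) ext_lie"
  proof (rule derivation_anticommute[OF derivation_d_eps _ BV_like_Delta_Lie])
    show "d_eps (Delta_Lie (gen j)) + Delta_Lie (d_eps (gen j)) = 0" for j :: "'i eps"
      by (cases j) (simp_all add: Delta_gen d_eps_gen d_eps_simps Delta_Lie_simps)
  qed simp
  moreover have "d_eps (d_eps x) = 0" for x :: "('i eps, 'k) ext_lie"
  proof (rule derivation_square_zero[OF derivation_d_eps])
    show "d_eps (d_eps (gen j)) = 0" for j :: "'i eps"
      by (cases j) (simp_all add: d_eps_gen d_eps_simps)
  qed simp
  ultimately have E_square: "E (E x) = 0" for x
    by (simp add: E_def d_eps_simps Delta_Lie_simps Delta_Lie_square add.commute)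
  let ?g = "case_eps (\<lambda>i. embed (\<delta> (gen i))) (\<lambda>i. - E (embed (\<delta> (gen i))))"
  have "?g j \<in> gr (wdeg j + 1 + 1)" for j
    using embed_gr[OF \<delta>D(2)[OF gen_gr]] ED(2)[OF embed_gr[OF \<delta>D(2)[OF gen_gr]]]
    by (cases j) (auto simp: wdeg_def algebra_simps intro!: gr_uminus)
  moreover have "?g j = 0" if "j \<notin> gbasis" for j
    using that by (cases j) (auto simp: gbasis_eps_def image_iff gen_zero cont_linear_simps[OF \<delta>D(1)]
        cont_linear_simps[OF ED(1)] embed_simps)
  ultimately obtain P where P: "derivation 1 P" and P_gen: "\<And>j. P (gen j) = ?g j"
    using derivation_exists[of 1 ?g] by auto
  note PD = derivationD[OF P]
  \<comment> \<open>On w_0 the summands are P w_1 and E \<iota>(\<delta> w), opposite by the choice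
    of P; on w_1 they are P 0 and - E E \<iota>(\<delta> w).\<close>
  have PE: "P (E x) + E (P x) = 0" for x
  proof (rule derivation_anticommute[OF P _ E])
    show "P (E (gen j)) + E (P (gen j)) = 0" for j
      by (cases j) (simp_all add: E_gen P_gen E_square cont_linear_simps[OF PD(1)] cont_linear_simps[OF ED(1)])
  qed simp
  \<comment> \<open>Both sides are derivations along \<iota> that agree on generators by the choice
    of P on w_0.\<close>
  have P_embed: "P (embed x) = embed (\<delta> x)" for x
  proof -
    have "x \<in> {x. P (embed x) = embed (\<delta> x)}"
      by (rule gerstenhaber_induct[OF closed_subspace_eq[OF cont_linear_comp[OF PD(1) cont_linear_embed]
              cont_linear_comp[OF cont_linear_embed \<delta>D(1)]]])
        (simp_all add: embed_one embed_simps PD(5) \<delta>D(5) embed_gen P_gen embed_times embed_bracket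
          PD(3)[OF embed_gr] PD(4)[OF embed_gr] \<delta>D(3) \<delta>D(4))
    then show ?thesis by simp
  qed
  have P_square: "P (P x) = 0" for x
  proof (rule derivation_square_zero[OF P])
    \<comment> \<open>On w_1 the square of P is - P E \<iota>(\<delta> w), which this turns into E P
      \<iota>(\<delta> w) = E \<iota>(\<delta> \<delta> w) = 0.\<close>
    have "P (E (embed (\<delta> y))) = - E (P (embed (\<delta> y)))" for y
      using PE[of "embed (\<delta> y)"] by (simp add: eq_neg_iff_add_eq_0)
    then show "P (P (gen j)) = 0" for j
      by (cases j) (simp_all add: P_gen P_embed \<delta>(2) cont_linear_simps[OF PD(1)] cont_linear_simps[OF ED(1)] embed_simps)
  qed simp
  have can: "is_partial_can \<delta> P"
    unfolding is_partial_can_def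
  proof (intro conjI allI P)
    fix z :: "('i, 'k) ext_lie_eps"
    obtain x y where z: "z = (x, y)" by (cases z)
    \<comment> \<open>The \<epsilon>-coefficient of the defining equation is anticommutation of P
      and E at \<iota> x: the \<Delta>_Lie part of E contributes \<iota>(D x), the
      \<open>d_eps\<close> part the other two terms.\<close>
    have "P (d_eps (embed x)) + d_eps (embed (\<delta> x)) + embed (D_comm \<delta> x) = 0"
      using PE[of "embed x"]
      by (simp add: E_def D_comm_def cont_linear_simps[OF PD(1)] embed_simps embed_Delta_Lie P_embed
          algebra_simps flip: P_embed)
    then have "- P (d_eps (embed x)) = d_eps (embed (\<delta> x)) + embed (D_comm \<delta> x)"
      by (simp add: neg_eq_iff_add_eq_0 add.assoc)
    then show "eps_extend 1 P (Phi z) = Phi (eps_extend 1 \<delta> z + eps_mult (eps_extend 0 (D_comm \<delta>) z))"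
      by (simp add: z Phi_eq P_embed embed_simps cont_linear_simps[OF PD(1)] sg_def)
  qed
  have unique: "P' = P" if P': "is_partial_can \<delta> P'" for P'
  proof (rule derivation_unique)
    show "derivation 1 P'" using P' by (simp add: is_partial_can_def)
    \<comment> \<open>Since \<Phi>(w) = w_0 + \<epsilon> w_1, the defining equation at w fixes a
      solution on both copies of w.\<close>
    have "eps_extend 1 P' (Phi (gen i, 0)) = eps_extend 1 P (Phi (gen i, 0))" for i
      using P' can by (simp add: is_partial_can_def)
    then have "P' (gen (E0 i)) = P (gen (E0 i)) \<and> P' (gen (E1 i)) = P (gen (E1 i))" for i
      by (simp add: Phi_eq embed_gen embed_simps d_eps_gen sg_def)
    then show "P' (gen j) = P (gen j)" for j
      by (cases j) auto
  qed (rule P)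
  have partial_can: "partial_can \<delta> = P"
    unfolding partial_can_def using can unique by (rule the_equality)
  have G: "G_infinity P"
    by (simp add: G_infinity_def P P_square)
  have "BV_infinity P (\<lambda>x. P x + Delta_Lie x + d_eps x)"
    unfolding BV_infinity_def operator_iff_cont_linear
  proof (intro conjI allI G)
    show "cont_linear (\<lambda>x. P x + Delta_Lie x + d_eps x)"
      by (intro cont_linear_intros PD(1) cont_linear_Delta_Lie cont_linear_d_eps)
    have PE_eq: "P x + Delta_Lie x + d_eps x = P x + E x" for x
      by (simp add: E_def)
    show "P (P x + Delta_Lie x + d_eps x) + Delta_Lie (P x + Delta_Lie x + d_eps x)
        + d_eps (P x + Delta_Lie x + d_eps x) = 0" for x
      using PE[of x] unfolding PE_eq
      by (simp add: cont_linear_simps[OF PD(1)] cont_linear_simps[OF ED(1)] P_square E_square add.commute)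
    define T where "T i = (if i = 1 then E else (\<lambda>x. 0))" for i :: nat
    have "cont_linear (T i) \<and> has_degree (- int i) (T i) \<and> T i 1 = 0" for i
      using ED by (simp add: T_def has_degree_def cont_linear_const)
    moreover have "\<exists>N. \<forall>n\<ge>N. P x + Delta_Lie x + d_eps x - (P x + (\<Sum>j<n. T (2 * j + 1) x)) \<in> Fil p"
      for x p
    proof -
      have "(\<Sum>j<n. T (2 * j + 1) x) = E x" if "1 \<le> n" for n
      proof -
        have "(\<Sum>j<n. T (2 * j + 1) x) = (\<Sum>j<n. if j = 0 then E x else 0)"
          by (intro sum.cong) (auto simp: T_def)
        then show ?thesis using that by simp
      qed
      \<comment> \<open>From N = 1 on the sum contains its term j = 0, which is \<Delta>_1 = E; the
        empty sum would leave E x over.\<close>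
      then show ?thesis by (intro exI[of _ 1]) (simp add: E_def)
    qed
    \<comment> \<open>The difference is \<open>d_eps\<close>, a derivation of degree -1.\<close>
    moreover have "diff_op 1 (-1) (\<lambda>x. T 1 x - Delta_Lie x)"
      using diff_op_derivation[OF derivation_d_eps] by (simp add: T_def E_def)
    moreover have "diff_op i (- int (2 * i - 1)) (T (2 * i - 1))" if "1 < i" for i
    proof -
      have "2 * i - 1 \<noteq> 1" using that by linarith
      then show ?thesis by (simp add: T_def diff_op_zero)
    qed
    moreover have "preserves_Fil (T i)" for i
      by (auto simp: T_def preserves_Fil_def E_def intro!: Fil_add Delta_Lie_Fil d_eps_Fil)
    ultimately show "\<exists>T :: nat \<Rightarrow> ('i eps, 'k) ext_lie \<Rightarrow> ('i eps, 'k) ext_lie.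
        (\<forall>i. odd i \<longrightarrow> cont_linear (T i) \<and> has_degree (- int i) (T i) \<and> T i 1 = 0) \<and>
        (\<forall>x p. \<exists>N. \<forall>n\<ge>N. P x + Delta_Lie x + d_eps x - (P x + (\<Sum>j<n. T (2 * j + 1) x)) \<in> Fil p) \<and>
        diff_op 1 (-1) (\<lambda>x. T 1 x - Delta_Lie x) \<and>
        (\<forall>i>1. diff_op i (- int (2 * i - 1)) (T (2 * i - 1))) \<and>
        (\<forall>i. odd i \<longrightarrow> preserves_Fil (T i))"
      by (intro exI[of _ T]) blast
  qed
  then show ?thesis
    using can unique G unfolding partial_can by blast
qed

end
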